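(* Let $n\ge 1$ and let $W_{-n}$ be the Weyl module for the current superalgebra $\mathfrak{osp}(1,2)[t]=\mathfrak{osp}(1,2)\otimes\mathbb{C}[t]$. Let $V$ be the $3$-dimensional irreducible $\mathfrak{osp}(1,2)$-module. Then $W_{-n}$, as an $\mathfrak{osp}(1,2)$-module, is isomorphic to $V^{\otimes n}$. Moreover, the $\mathfrak{osp}(1,2)[t]$-module structure is given by the graded tensor product (fusion product): for any pairwise distinct complex numbers $z_1,\dots,z_n$ the graded tensor product $V(z_1)*\dots*V(z_n)$ is isomorphic to $W_{-n}$ as an $\mathfrak{osp}(1,2)[t]$-module.
   Context: Everything is over $\mathbb{C}$. $\mathfrak{osp}(1,2)$ is the Lie superalgebra with even part $\mathfrak{sl}_2$ (standard basis $e,h,f$) and odd part with basis $g^+,g^-$; the nontrivial brackets are $[e,f]=h$, $[h,e]=2e$, $[h,f]=-2f$, $[h,g^\pm]=\pm g^\pm$, $[g^+,g^-]_+=h$, $[g^+,g^+]_+=2e$, $[g^-,g^-]_+=-2f$, $[f,g^+]=-g^-$, $[e,g^-]=-g^+$. Put $\mathfrak n^-=\mathrm{span}(f,g^-)$, $\mathfrak n^+=\mathrm{span}(e,g^+)$, $\mathfrak h=\mathbb{C}h$. For $y\in\mathfrak{osp}(1,2)$ write $y_i=y\otimes t^i$. The Weyl module $W_{-n}$, $n\ge0$, is the cyclic $\mathfrak{osp}(1,2)[t]$-module with (even) generator $w_{-n}$ and defining relations $(\mathfrak n^-\oplus\mathfrak h)\otimes t\mathbb{C}[t].w_{-n}=0$,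 $(\mathfrak n^-\otimes 1).w_{-n}=0$, $h_0w_{-n}=-nw_{-n}$, $e_0^{n+1}w_{-n}=0$. It is an $\mathfrak{osp}(1,2)$-module via $\mathfrak{osp}(1,2)=\mathfrak{osp}(1,2)\otimes 1$. Graded tensor product: let $\mathfrak g$ be a Lie superalgebra, $V^1,\dots,V^n$ cyclic $\mathfrak g$-modules with even cyclic vectors $v^1,\dots,v^n$ and $z_1,\dots,z_n\in\mathbb{C}$ pairwise distinct. $V^i(z_i)$ is the $\mathfrak g[t]$-module $V^i$ on which $y\otimes t^k$ acts as $z_i^k y$. Tensor products use the sign rule $y(a\otimes b)=ya\otimes b+(-1)^{|y||a|}a\otimes yb$. The module $\bigotimes_i V^i(z_i)$ is cyclic over $\mathfrak g[t]$ with cyclic vector $v^1\otimes\dots\otimes v^n$. Let $U(\mathfrak g[t])=\bigoplus_{s\ge0}U(\mathfrak g[t])_s$ be the grading by $t$-degree and let $F_s=\bigoplus_{r\le s}U(\mathfrak g[t])_r\,(v^1\otimes\dots\otimes v^n)$. The associated graded space of the filtration $F_\bullet$, a graded cyclic $\mathfrak g[t]$-module, is denoted $V^1(z_1)*\dots*V^n(z_n)$. For $V$ the $3$-dimensional irreducible module (with $h$-weights $-1,0,1$) the cyclic vector is the lowest weight vector (weight $-1$), taken to be even. *)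

theory Defs
  imports
    "HOL-Computational_Algebra.Polynomial"
    "HOL-Library.Poly_Mapping"
    "HOL-Library.Function_Algebras"
    "HOL-Library.Set_Algebras"
    "HOL-Library.Z2"
    "HOL-Algebra.Module"  (* last, so that its record fields mult and smult are not shadowed *)
begin

section \<open>Complex Lie superalgebras\<close>

text \<open>Parities are elements of the two-element field \<^typ>\<open>bit\<close>; the Koszul sign of
  parities \<open>p\<close> and \<open>q\<close> is \<open>ksign (p * q)\<close>.\<close>

definition ksign :: "bit \<Rightarrow> complex" where
  "ksign p = (if p = 1 then -1 else 1)"

text \<open>\<open>hcomp p x\<close> is the component of \<open>x\<close> of parity \<open>p\<close>; the axioms on \<open>hcomp\<close> say that
  the space is the direct sum of its even and its odd part.\<close>

class lie_superalgebra = ab_group_add +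
  fixes scaleC :: "complex \<Rightarrow> 'a \<Rightarrow> 'a"  (infixr \<open>*\<^sub>C\<close> 75)
    and hcomp :: "bit \<Rightarrow> 'a \<Rightarrow> 'a"
    and lbr :: "'a \<Rightarrow> 'a \<Rightarrow> 'a"
  assumes scaleC_add_right: "c *\<^sub>C (x + y) = c *\<^sub>C x + c *\<^sub>C y"
    and scaleC_add_left: "(c + d) *\<^sub>C x = c *\<^sub>C x + d *\<^sub>C x"
    and scaleC_scaleC: "c *\<^sub>C d *\<^sub>C x = (c * d) *\<^sub>C x"
    and scaleC_one: "1 *\<^sub>C x = x"
    and hcomp_add: "hcomp p (x + y) = hcomp p x + hcomp p y"
    and hcomp_scaleC: "hcomp p (c *\<^sub>C x) = c *\<^sub>C hcomp p x"
    and hcomp_hcomp: "hcomp p (hcomp q x) = (if p = q then hcomp p x else 0)"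
    and hcomp_decomp: "hcomp 0 x + hcomp 1 x = x"
    and lbr_add_left: "lbr (x + y) z = lbr x z + lbr y z"
    and lbr_add_right: "lbr x (y + z) = lbr x y + lbr x z"
    and lbr_scaleC_left: "lbr (c *\<^sub>C x) y = c *\<^sub>C lbr x y"
    and lbr_scaleC_right: "lbr x (c *\<^sub>C y) = c *\<^sub>C lbr x y"
    and lbr_parity: "hcomp p x = x \<Longrightarrow> hcomp q y = y \<Longrightarrow> hcomp (p + q) (lbr x y) = lbr x y"
    and lbr_skew: "hcomp p x = x \<Longrightarrow> hcomp q y = y \<Longrightarrow>
           lbr x y = - (ksign (p * q) *\<^sub>C lbr y x)"
    and lbr_jacobi: "hcomp p x = x \<Longrightarrow> hcomp q y = y \<Longrightarrow>
           lbr x (lbr y z) = lbr (lbr x y) z + ksign (p * q) *\<^sub>C lbr y (lbr x z)"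
begin

lemma scaleC_zero_right [simp]: "c *\<^sub>C 0 = 0"
  using scaleC_add_right[of c 0 0] by simp

lemma scaleC_zero_left [simp]: "0 *\<^sub>C x = 0"
  using scaleC_add_left[of 0 0 x] by simp

lemma scaleC_minus_right: "c *\<^sub>C (- x) = - (c *\<^sub>C x)"
  using scaleC_add_right[of c x "- x"] by (simp add: eq_neg_iff_add_eq_0 add.commute)

lemma hcomp_zero [simp]: "hcomp p 0 = 0"
  using hcomp_add[of p 0 0] by simp

lemma lbr_zero_left [simp]: "lbr 0 x = 0"
  using lbr_add_left[of 0 0 x] by simp

lemma lbr_zero_right [simp]: "lbr x 0 = 0"
  using lbr_add_right[of x 0 0] by simp

end


subsection \<open>The Lie superalgebra osp(1,2)\<close>

text \<open>\<open>Osp a b c u v\<close> is \<open>a e + b h + c f + u g\<^sup>+ + v g\<^sup>-\<close>.\<close>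

datatype osp12 =
  Osp (co_e: complex) (co_h: complex) (co_f: complex) (co_gp: complex) (co_gm: complex)

instantiation osp12 :: lie_superalgebra
begin

definition "0 = Osp 0 0 0 0 0"

definition "x + y = Osp (co_e x + co_e y) (co_h x + co_h y) (co_f x + co_f y)
  (co_gp x + co_gp y) (co_gm x + co_gm y)"

definition "x - y = Osp (co_e x - co_e y) (co_h x - co_h y) (co_f x - co_f y)
  (co_gp x - co_gp y) (co_gm x - co_gm y)"

definition "- x = Osp (- co_e x) (- co_h x) (- co_f x) (- co_gp x) (- co_gm x)"

definition "c *\<^sub>C x = Osp (c * co_e x) (c * co_h x) (c * co_f x) (c * co_gp x) (c * co_gm x)"

definition "hcomp p x =
  (if p = 0 then Osp (co_e x) (co_h x) (co_f x) 0 0 else Osp 0 0 0 (co_gp x) (co_gm x))"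

text \<open>The bilinear extension of the brackets listed in \<open>osp12_brackets\<close> below.\<close>

definition "lbr x y = Osp
  (2 * co_h x * co_e y - 2 * co_e x * co_h y + 2 * co_gp x * co_gp y)
  (co_e x * co_f y - co_f x * co_e y + co_gp x * co_gm y + co_gm x * co_gp y)
  (- 2 * co_h x * co_f y + 2 * co_f x * co_h y - 2 * co_gm x * co_gm y)
  (co_h x * co_gp y - co_gp x * co_h y - co_e x * co_gm y + co_gm x * co_e y)
  (- co_h x * co_gm y + co_gm x * co_h y - co_f x * co_gp y + co_gp x * co_f y)"

lemmas osp12_defs = zero_osp12_def plus_osp12_def minus_osp12_def uminus_osp12_def
  scaleC_osp12_def hcomp_osp12_def lbr_osp12_def

instance
proof
  fix x y z :: osp12 and c d :: complex and p q :: bit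
  show "lbr x y = - (ksign (p * q) *\<^sub>C lbr y x)" if "hcomp p x = x" "hcomp q y = y"
    using that by (cases x; cases y; cases p; cases q)
      (auto simp: osp12_defs ksign_def algebra_simps split: if_splits)
  show "hcomp (p + q) (lbr x y) = lbr x y" if "hcomp p x = x" "hcomp q y = y"
    using that by (cases x; cases y; cases p; cases q)
      (auto simp: osp12_defs ksign_def algebra_simps split: if_splits)
  show "lbr x (lbr y z) = lbr (lbr x y) z + ksign (p * q) *\<^sub>C lbr y (lbr x z)"
    if "hcomp p x = x" "hcomp q y = y"
    using that by (cases x; cases y; cases z; cases p; cases q)
      (auto simp: osp12_defs ksign_def algebra_simps split: if_splits)
qed (auto simp: osp12_defs algebra_simps)

end

definition osp_e :: osp12 where "osp_e = Osp 1 0 0 0 0"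
definition osp_h :: osp12 where "osp_h = Osp 0 1 0 0 0"
definition osp_f :: osp12 where "osp_f = Osp 0 0 1 0 0"
definition osp_gp :: osp12 where "osp_gp = Osp 0 0 0 1 0"
definition osp_gm :: osp12 where "osp_gm = Osp 0 0 0 0 1"

lemmas osp12_basis_defs = osp_e_def osp_h_def osp_f_def osp_gp_def osp_gm_def

lemma osp12_brackets:
  "lbr osp_e osp_f = osp_h"
  "lbr osp_h osp_e = 2 *\<^sub>C osp_e"
  "lbr osp_h osp_f = (-2) *\<^sub>C osp_f"
  "lbr osp_h osp_gp = osp_gp"
  "lbr osp_h osp_gm = - osp_gm"
  "lbr osp_gp osp_gm = osp_h"
  "lbr osp_gp osp_gp = 2 *\<^sub>C osp_e"
  "lbr osp_gm osp_gm = (-2) *\<^sub>C osp_f"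
  "lbr osp_f osp_gp = - osp_gm"
  "lbr osp_e osp_gm = - osp_gp"
  "lbr osp_e osp_gp = 0"
  "lbr osp_f osp_gm = 0"
  by (simp_all add: osp12_defs osp12_basis_defs)

definition n_minus :: "osp12 set" where
  "n_minus = {a *\<^sub>C osp_f + b *\<^sub>C osp_gm | a b. True}"

definition cartan :: "osp12 set" where
  "cartan = {a *\<^sub>C osp_h | a. True}"


subsection \<open>Current algebras\<close>

text \<open>\<open>\<gg>[t]\<close> is modelled as the polynomials with coefficients in \<open>\<gg>\<close>, so that
  \<open>y \<otimes> t\<^sup>i\<close> is \<open>monom y i\<close>.\<close>

instantiation poly :: (lie_superalgebra) lie_superalgebra
begin

definition "c *\<^sub>C (x :: 'a poly) = map_poly (scaleC c) x"

definition "hcomp p (x :: 'a poly) = map_poly (hcomp p) x"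

definition "lbr (x :: 'a poly) y =
  (\<Sum>i\<le>degree x. \<Sum>j\<le>degree y. monom (lbr (coeff x i) (coeff y j)) (i + j))"

lemma coeff_scaleC: "coeff (c *\<^sub>C x) i = c *\<^sub>C coeff (x :: 'a poly) i"
  by (simp add: scaleC_poly_def coeff_map_poly)

lemma coeff_hcomp: "coeff (hcomp p x) i = hcomp p (coeff (x :: 'a poly) i)"
  by (simp add: hcomp_poly_def coeff_map_poly)

lemma lbr_poly_eq:
  assumes "degree x \<le> N" "degree y \<le> M"
  shows "lbr (x :: 'a poly) y =
    (\<Sum>i\<le>N. \<Sum>j\<le>M. monom (lbr (coeff x i) (coeff y j)) (i + j))"
proof -
  have "lbr x y = (\<Sum>i\<le>N. \<Sum>j\<le>degree y. monom (lbr (coeff x i) (coeff y j)) (i + j))"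
    unfolding lbr_poly_def using assms
    by (intro sum.mono_neutral_left) (auto simp: coeff_eq_0 not_le)
  also have "\<dots> = (\<Sum>i\<le>N. \<Sum>j\<le>M. monom (lbr (coeff x i) (coeff y j)) (i + j))"
    using assms by (intro sum.cong refl sum.mono_neutral_left) (auto simp: coeff_eq_0 not_le)
  finally show ?thesis .
qed

lemma lbr_poly_add_left: "lbr (x + y) (z :: 'a poly) = lbr x z + lbr y z"
proof -
  define N where "N = max (degree x) (degree y)"
  have "degree (x + y) \<le> N" "degree x \<le> N" "degree y \<le> N"
    by (auto simp: N_def degree_add_le_max)
  thus ?thesis
    by (simp add: lbr_poly_eq[where N = N and M = "degree z"] lbr_add_left add_monom[symmetric]
        sum.distrib)
qed

lemma lbr_poly_add_right: "lbr z (x + y :: 'a poly) = lbr z x + lbr z y"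
proof -
  define N where "N = max (degree x) (degree y)"
  have "degree (x + y) \<le> N" "degree x \<le> N" "degree y \<le> N"
    by (auto simp: N_def degree_add_le_max)
  thus ?thesis
    by (simp add: lbr_poly_eq[where M = N and N = "degree z"] lbr_add_right add_monom[symmetric]
        sum.distrib)
qed

lemma lbr_monom: "lbr (monom a i) (monom (b :: 'a) j) = monom (lbr a b) (i + j)"
proof -
  have "lbr (monom a i) (monom b j) =
    (\<Sum>k\<le>i. \<Sum>l\<le>j. if k = i \<and> l = j then monom (lbr a b) (i + j) else 0)"
    by (subst lbr_poly_eq[of _ i _ j]) (auto simp: degree_monom_le intro!: sum.cong)
  also have "\<dots> = (\<Sum>k\<le>i. if k = i then monom (lbr a b) (i + j) else 0)"
    by (intro sum.cong refl) auto
  also have "\<dots> = monom (lbr a b) (i + j)" by simp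
  finally show ?thesis .
qed

lemma scaleC_monom: "c *\<^sub>C monom (a :: 'a) i = monom (c *\<^sub>C a) i"
  by (rule poly_eqI) (simp add: coeff_scaleC)

lemma poly_homog_induct [consumes 1, case_names monom add]:
  assumes x: "hcomp p x = (x :: 'a poly)"
    and mon: "\<And>a i. hcomp p a = a \<Longrightarrow> P (monom a i)"
    and add: "\<And>x y. P x \<Longrightarrow> P y \<Longrightarrow> P (x + y)"
  shows "P x"
proof -
  have c: "hcomp p (coeff x i) = coeff x i" for i
    using x by (metis coeff_hcomp)
  have "P (\<Sum>i\<le>n. monom (coeff x i) i)" for n
    by (induction n) (auto intro!: mon add c)
  from this[of "degree x"] show ?thesis by (simp add: poly_as_sum_of_monoms)
qed

lemma poly_monom_induct [case_names monom add]:
  assumes mon: "\<And>a i. P (monom (a :: 'a) i)"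
    and add: "\<And>x y. P x \<Longrightarrow> P y \<Longrightarrow> P (x + y)"
  shows "P x"
proof -
  have "P (\<Sum>i\<le>n. monom (coeff x i) i)" for n
    by (induction n) (auto intro!: mon add)
  from this[of "degree x"] show ?thesis by (simp add: poly_as_sum_of_monoms)
qed

instance
proof
  fix x y z :: "'a poly" and c d :: complex and p q :: bit
  show sc_add: "c *\<^sub>C (x + y) = c *\<^sub>C x + c *\<^sub>C y" for x y :: "'a poly" and c
    by (rule poly_eqI) (simp add: coeff_scaleC scaleC_add_right)
  show "(c + d) *\<^sub>C x = c *\<^sub>C x + d *\<^sub>C x"
    by (rule poly_eqI) (simp add: coeff_scaleC scaleC_add_left)
  show "c *\<^sub>C d *\<^sub>C x = (c * d) *\<^sub>C x"
    by (rule poly_eqI) (simp add: coeff_scaleC scaleC_scaleC)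
  show "1 *\<^sub>C x = x"
    by (rule poly_eqI) (simp add: coeff_scaleC scaleC_one)
  show hc_add: "hcomp p (x + y) = hcomp p x + hcomp p y" for x y :: "'a poly" and p
    by (rule poly_eqI) (simp add: coeff_hcomp hcomp_add)
  show "hcomp p (c *\<^sub>C x) = c *\<^sub>C hcomp p x"
    by (rule poly_eqI) (simp add: coeff_hcomp coeff_scaleC hcomp_scaleC)
  show "hcomp p (hcomp q x) = (if p = q then hcomp p x else 0)"
    by (rule poly_eqI) (simp add: coeff_hcomp hcomp_hcomp)
  show "hcomp 0 x + hcomp 1 x = x"
    by (rule poly_eqI) (simp add: coeff_hcomp hcomp_decomp)
  show "lbr (x + y) z = lbr x z + lbr y z" by (rule lbr_poly_add_left)
  show "lbr x (y + z) = lbr x y + lbr x z" by (rule lbr_poly_add_right)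
  note simps = lbr_poly_add_left lbr_poly_add_right sc_add hc_add lbr_monom scaleC_monom
  show "lbr (c *\<^sub>C x) y = c *\<^sub>C lbr x y"
  proof (induction x rule: poly_monom_induct)
    case (monom a i)
    show ?case
      by (induction y rule: poly_monom_induct) (simp_all add: simps lbr_scaleC_left)
  qed (simp add: simps)
  show "lbr x (c *\<^sub>C y) = c *\<^sub>C lbr x y"
  proof (induction x rule: poly_monom_induct)
    case (monom a i)
    show ?case
      by (induction y rule: poly_monom_induct) (simp_all add: simps lbr_scaleC_right)
  qed (simp add: simps)
  have hc_monom: "hcomp p (monom a i) = monom (hcomp p a) i" for a :: 'a and p i
    by (rule poly_eqI) (simp add: coeff_hcomp)
  assume x: "hcomp p x = x" and y: "hcomp q y = y"
  show "hcomp (p + q) (lbr x y) = lbr x y"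
    using x
  proof (induction x rule: poly_homog_induct)
    case (monom a i)
    show ?case
      using y
    proof (induction y rule: poly_homog_induct)
      case (monom b j)
      show ?case
        using lbr_parity[OF \<open>hcomp p a = a\<close> \<open>hcomp q b = b\<close>] by (simp only: lbr_monom hc_monom)
    qed (simp add: simps)
  qed (simp add: simps)
  show "lbr x y = - (ksign (p * q) *\<^sub>C lbr y x)"
    using x
  proof (induction x rule: poly_homog_induct)
    case (monom a i)
    show ?case
      using y
    proof (induction y rule: poly_homog_induct)
      case (monom b j)
      show ?case
        using lbr_skew[OF \<open>hcomp p a = a\<close> \<open>hcomp q b = b\<close>]
        by (simp add: simps minus_monom add.commute)
    qed (simp add: simps)
  qed (simp add: simps)
  show "lbr x (lbr y z) = lbr (lbr x y) z + ksign (p * q) *\<^sub>C lbr y (lbr x z)"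
    using x
  proof (induction x rule: poly_homog_induct)
    case (monom a i)
    show ?case
      using y
    proof (induction y rule: poly_homog_induct)
      case (monom b j)
      show ?case
      proof (induction z rule: poly_monom_induct)
        case (monom d k)
        show ?case
          using lbr_jacobi[OF \<open>hcomp p a = a\<close> \<open>hcomp q b = b\<close>, of d]
          by (simp add: simps add_monom ac_simps)
      qed (simp add: simps)
    qed (simp add: simps)
  qed (simp add: simps)
qed

end


section \<open>Modules over Lie superalgebras\<close>

definition complex_ring :: "complex ring" where
  "complex_ring = \<lparr>carrier = UNIV, mult = (*), one = 1, zero = 0, add = (+)\<rparr>"

text \<open>The fields \<open>mult\<close> and \<open>one\<close> that modules inherit from the record of rings play no role
  and are left undefined in the constructions below.\<close>

record ('g, 'v) supermodule = "(complex, 'v) module" +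
  part :: "bit \<Rightarrow> 'v set"
  act :: "'g \<Rightarrow> 'v \<Rightarrow> 'v"

definition is_supermodule :: "('g::lie_superalgebra, 'v) supermodule \<Rightarrow> bool" where
  "is_supermodule M \<longleftrightarrow>
     Module.module complex_ring M \<and>
     (\<forall>p. submodule (part M p) complex_ring M) \<and>
     part M 0 \<inter> part M 1 = {\<zero>\<^bsub>M\<^esub>} \<and>
     (\<forall>v\<in>carrier M. \<exists>a\<in>part M 0. \<exists>b\<in>part M 1. v = a \<oplus>\<^bsub>M\<^esub> b) \<and>
     (\<forall>y. \<forall>v\<in>carrier M. act M y v \<in> carrier M) \<and>
     (\<forall>y. \<forall>v\<in>carrier M. \<forall>w\<in>carrier M. act M y (v \<oplus>\<^bsub>M\<^esub> w) = act M y v \<oplus>\<^bsub>M\<^esub> act M y w) \<and>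
     (\<forall>y c. \<forall>v\<in>carrier M. act M y (c \<odot>\<^bsub>M\<^esub> v) = c \<odot>\<^bsub>M\<^esub> act M y v) \<and>
     (\<forall>x y. \<forall>v\<in>carrier M. act M (x + y) v = act M x v \<oplus>\<^bsub>M\<^esub> act M y v) \<and>
     (\<forall>c y. \<forall>v\<in>carrier M. act M (c *\<^sub>C y) v = c \<odot>\<^bsub>M\<^esub> act M y v) \<and>
     (\<forall>p q y. hcomp p y = y \<longrightarrow> (\<forall>v\<in>part M q. act M y v \<in> part M (p + q))) \<and>
     (\<forall>p q x y. hcomp p x = x \<longrightarrow> hcomp q y = y \<longrightarrow> (\<forall>v\<in>carrier M.
        act M (lbr x y) v =
          act M x (act M y v) \<ominus>\<^bsub>M\<^esub> ksign (p * q) \<odot>\<^bsub>M\<^esub> act M y (act M x v)))"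

text \<open>Submodules of supermodules are required to be spanned by homogeneous elements.\<close>

definition is_subsupermodule :: "'v set \<Rightarrow> ('g::lie_superalgebra, 'v) supermodule \<Rightarrow> bool" where
  "is_subsupermodule H M \<longleftrightarrow>
     submodule H complex_ring M \<and>
     (\<forall>v\<in>H. \<exists>a\<in>part M 0 \<inter> H. \<exists>b\<in>part M 1 \<inter> H. v = a \<oplus>\<^bsub>M\<^esub> b) \<and>
     (\<forall>y. \<forall>v\<in>H. act M y v \<in> H)"

definition irreducible_supermodule :: "('g::lie_superalgebra, 'v) supermodule \<Rightarrow> bool" where
  "irreducible_supermodule M \<longleftrightarrow>
     is_supermodule M \<and> carrier M \<noteq> {\<zero>\<^bsub>M\<^esub>} \<and>
     (\<forall>H. is_subsupermodule H M \<longrightarrow> H = {\<zero>\<^bsub>M\<^esub>} \<or> H = carrier M)"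

text \<open>Isomorphisms are even, i.e. they preserve the parity.\<close>

definition supermodule_iso :: "('g, 'v) supermodule \<Rightarrow> ('g, 'w) supermodule \<Rightarrow> bool" where
  "supermodule_iso M N \<longleftrightarrow> (\<exists>\<phi>.
     bij_betw \<phi> (carrier M) (carrier N) \<and>
     (\<forall>v\<in>carrier M. \<forall>w\<in>carrier M. \<phi> (v \<oplus>\<^bsub>M\<^esub> w) = \<phi> v \<oplus>\<^bsub>N\<^esub> \<phi> w) \<and>
     (\<forall>c. \<forall>v\<in>carrier M. \<phi> (c \<odot>\<^bsub>M\<^esub> v) = c \<odot>\<^bsub>N\<^esub> \<phi> v) \<and>
     (\<forall>p. \<phi> ` part M p = part N p) \<and>
     (\<forall>y. \<forall>v\<in>carrier M. \<phi> (act M y v) = act N y (\<phi> v)))"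

definition pull_back :: "('h \<Rightarrow> 'g) \<Rightarrow> ('g, 'v) supermodule \<Rightarrow> ('h, 'v) supermodule" where
  "pull_back \<theta> M = \<lparr>carrier = carrier M, mult = undefined, one = undefined, zero = \<zero>\<^bsub>M\<^esub>,
     add = add M, smult = smult M, part = part M, act = (\<lambda>y. act M (\<theta> y))\<rparr>"


section \<open>Modules given by a generator and relations\<close>

subsection \<open>Free associative algebras\<close>

text \<open>Words under concatenation, so that the type \<open>'a word \<Rightarrow>\<^sub>0 complex\<close>, with the convolution
  product of \<^theory>\<open>HOL-Library.Poly_Mapping\<close>, is the free associative unital algebra on
  the set of all elements of \<^typ>\<open>'a\<close>.\<close>

datatype 'a word = Word (letters: "'a list")

instantiation word :: (type) monoid_add
begin

definition "0 = Word []"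

definition "v + w = Word (letters v @ letters w)"

instance
  by standard (auto simp: zero_word_def plus_word_def)

end

type_synonym 'a free_alg = "'a word \<Rightarrow>\<^sub>0 complex"

definition of_word :: "'a list \<Rightarrow> 'a free_alg" where
  "of_word ys = Poly_Mapping.single (Word ys) 1"

abbreviation gen :: "'a \<Rightarrow> 'a free_alg" where
  "gen y \<equiv> of_word [y]"

definition fa_scale :: "complex \<Rightarrow> 'a free_alg \<Rightarrow> 'a free_alg" where
  "fa_scale c x = Poly_Mapping.single 0 c * x"

interpretation free_alg: vector_space fa_scale
proof
  show "fa_scale 1 x = x" for x :: "'a free_alg"
    unfolding fa_scale_def by (simp flip: one_poly_mapping.abs_eq)
qed (simp_all add: fa_scale_def algebra_simps single_add mult_single flip: mult.assoc)

subsection \<open>The universal enveloping algebra and cyclic modules\<close>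

text \<open>\<open>U(\<gg>)\<close> is the quotient of the free algebra on the set \<open>\<gg>\<close> by the two-sided ideal
  generated by \<open>env_relations\<close>, which make \<open>gen\<close> linear and turn the bracket into the
  supercommutator.\<close>

definition env_relations :: "'g::lie_superalgebra free_alg set" where
  "env_relations =
     {gen (x + y) - gen x - gen y | x y. True} \<union>
     {gen (c *\<^sub>C x) - fa_scale c (gen x) | c x. True} \<union>
     {gen x * gen y - fa_scale (ksign (p * q)) (gen y * gen x) - gen (lbr x y) | x y p q.
        hcomp p x = x \<and> hcomp q y = y}"

text \<open>For a set \<open>R\<close> of relations, the cyclic \<open>\<gg>\<close>-module with even generator \<open>w\<close> and
  defining relations \<open>r . w = 0\<close>, \<open>r \<in> R\<close>, is the quotient of \<open>U(\<gg>)\<close> by the left ideal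
  generated by \<open>R\<close>, that is, the quotient of the free algebra by \<open>cyclic_ker R\<close>; here
  \<open>a . w\<close> is the coset of \<open>a\<close>.\<close>

definition cyclic_ker :: "'g::lie_superalgebra free_alg set \<Rightarrow> 'g free_alg set" where
  "cyclic_ker R = free_alg.span
     ({a * r * b | a r b. r \<in> env_relations} \<union> {a * r | a r. r \<in> R})"

definition fa_part :: "bit \<Rightarrow> 'g::lie_superalgebra free_alg set" where
  "fa_part p = free_alg.span
     {of_word ys | ys ps. list_all2 (\<lambda>y q. hcomp q y = y) ys ps \<and> sum_list ps = p}"

definition cyclic_module ::
    "'g::lie_superalgebra free_alg set \<Rightarrow> ('g, 'g free_alg set) supermodule" where
  "cyclic_module R = \<lparr>
     carrier = (\<lambda>a. a +o cyclic_ker R) ` UNIV,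
     mult = undefined, one = undefined,
     zero = cyclic_ker R,
     add = (+),
     smult = (\<lambda>c A. fa_scale c ` A + cyclic_ker R),
     part = (\<lambda>p. (\<lambda>a. a +o cyclic_ker R) ` fa_part p),
     act = (\<lambda>y A. (*) (gen y) ` A + cyclic_ker R)\<rparr>"


section \<open>Weyl modules for osp(1,2)[t]\<close>

definition weyl_relations :: "nat \<Rightarrow> osp12 poly free_alg set" where
  "weyl_relations n =
     {gen y | y. coeff y 0 = 0 \<and> (\<forall>i. coeff y i \<in> n_minus + cartan)} \<union>
     {gen (monom y 0) | y. y \<in> n_minus} \<union>
     {gen (monom osp_h 0) + fa_scale (of_nat n) 1} \<union>
     {gen (monom osp_e 0) ^ (n + 1)}"

definition weyl_module :: "nat \<Rightarrow> (osp12 poly, osp12 poly free_alg set) supermodule" where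
  "weyl_module n = cyclic_module (weyl_relations n)"

text \<open>\<open>\<gg>\<close> embedded into \<open>\<gg>[t]\<close> as \<open>\<gg> \<otimes> 1\<close>.\<close>

abbreviation const_current :: "'g::lie_superalgebra \<Rightarrow> 'g poly" where
  "const_current y \<equiv> monom y 0"


section \<open>Tensor products\<close>

text \<open>Finite-dimensional modules are taken in coordinates with respect to a basis of
  homogeneous vectors indexed by \<^typ>\<open>'b\<close>: the space is \<^typ>\<open>'b \<Rightarrow> complex\<close>, \<open>par b\<close> is the
  parity of the basis vector with index \<open>b\<close>, and \<open>\<rho>\<close> is the action.\<close>

definition fun_scale :: "complex \<Rightarrow> ('i \<Rightarrow> complex) \<Rightarrow> 'i \<Rightarrow> complex" where
  "fun_scale c u = (\<lambda>i. c * u i)"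

interpretation fun_space: vector_space fun_scale
  by standard (auto simp: fun_scale_def fun_eq_iff algebra_simps)

definition coord_module ::
    "('b \<Rightarrow> bit) \<Rightarrow> ('g \<Rightarrow> ('b \<Rightarrow> complex) \<Rightarrow> ('b \<Rightarrow> complex)) \<Rightarrow> ('g, 'b \<Rightarrow> complex) supermodule"
  where
  "coord_module par \<rho> = \<lparr>carrier = UNIV, mult = undefined, one = undefined, zero = 0,
     add = (+), smult = fun_scale,
     part = (\<lambda>p. {v. \<forall>b. par b \<noteq> p \<longrightarrow> v b = 0}), act = \<rho>\<rparr>"

text \<open>The tensor product of the modules \<open>coord_module (par i) (\<rho> i)\<close>, \<open>i < n\<close>, consists of
  the functions on multi-indices, i.e. on lists of length \<open>n\<close>. In \<open>tensor_act\<close>, the function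
  \<open>\<lambda>b. u (l[i := b])\<close> is the slice of \<open>u\<close> through \<open>l\<close> in direction \<open>i\<close>, so that the
  \<open>i\<close>-th summand is the action on the \<open>i\<close>-th factor; a homogeneous component of \<open>y\<close> picks
  up the Koszul sign of the factors to the left of the \<open>i\<close>-th one.\<close>

definition pure_tensor :: "nat \<Rightarrow> (nat \<Rightarrow> 'b \<Rightarrow> complex) \<Rightarrow> 'b list \<Rightarrow> complex" where
  "pure_tensor n v = (\<lambda>l. if length l = n then \<Prod>i<n. v i (l ! i) else 0)"

definition tensor_carrier :: "nat \<Rightarrow> ('b list \<Rightarrow> complex) set" where
  "tensor_carrier n = {u. \<forall>l. length l \<noteq> n \<longrightarrow> u l = 0}"

definition tensor_part :: "nat \<Rightarrow> (nat \<Rightarrow> 'b \<Rightarrow> bit) \<Rightarrow> bit \<Rightarrow> ('b list \<Rightarrow> complex) set" where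
  "tensor_part n par p =
     {u \<in> tensor_carrier n. \<forall>l. length l = n \<and> (\<Sum>i<n. par i (l ! i)) \<noteq> p \<longrightarrow> u l = 0}"

definition tensor_act ::
    "nat \<Rightarrow> (nat \<Rightarrow> 'b \<Rightarrow> bit) \<Rightarrow>
     (nat \<Rightarrow> 'g::lie_superalgebra \<Rightarrow> ('b \<Rightarrow> complex) \<Rightarrow> ('b \<Rightarrow> complex)) \<Rightarrow>
     'g \<Rightarrow> ('b list \<Rightarrow> complex) \<Rightarrow> 'b list \<Rightarrow> complex" where
  "tensor_act n par \<rho> y u = (\<lambda>l. if length l = n then
      \<Sum>i<n. \<Sum>q\<in>{0, 1}. ksign (q * (\<Sum>j<i. par j (l ! j))) *
        \<rho> i (hcomp q y) (\<lambda>b. u (l[i := b])) (l ! i)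
    else 0)"

definition tensor_module ::
    "nat \<Rightarrow> (nat \<Rightarrow> 'b \<Rightarrow> bit) \<Rightarrow>
     (nat \<Rightarrow> 'g::lie_superalgebra \<Rightarrow> ('b \<Rightarrow> complex) \<Rightarrow> ('b \<Rightarrow> complex)) \<Rightarrow>
     ('g, 'b list \<Rightarrow> complex) supermodule" where
  "tensor_module n par \<rho> = \<lparr>carrier = tensor_carrier n, mult = undefined, one = undefined,
     zero = 0, add = (+), smult = fun_scale,
     part = tensor_part n par, act = tensor_act n par \<rho>\<rparr>"

text \<open>The iterated sign rule
  \<open>y (v\<^sub>0 \<otimes> \<dots> \<otimes> v\<^sub>n\<^sub>-\<^sub>1) = \<Sum>\<^sub>i (-1)\<^bsup>|y| (|v\<^sub>0| + \<dots> + |v\<^sub>i\<^sub>-\<^sub>1|)\<^esup> v\<^sub>0 \<otimes> \<dots> \<otimes> y v\<^sub>i \<otimes> \<dots> \<otimes> v\<^sub>n\<^sub>-\<^sub>1\<close>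
  for homogeneous vectors:\<close>

lemma tensor_act_pure_tensor:
  fixes \<rho> :: "nat \<Rightarrow> 'g::lie_superalgebra \<Rightarrow> ('b \<Rightarrow> complex) \<Rightarrow> ('b \<Rightarrow> complex)"
  assumes scale: "\<And>i y c v. i < n \<Longrightarrow> \<rho> i y (fun_scale c v) = fun_scale c (\<rho> i y v)"
    and zero: "\<And>i v. i < n \<Longrightarrow> \<rho> i 0 v = 0"
    and v: "\<And>i. i < n \<Longrightarrow> v i \<in> part (coord_module (par i) (\<rho> i)) (p i)"
    and y: "hcomp q y = y"
  shows "tensor_act n par \<rho> y (pure_tensor n v) =
    (\<Sum>i<n. fun_scale (ksign (q * (\<Sum>j<i. p j))) (pure_tensor n (v(i := \<rho> i y (v i)))))"
proof
  fix l :: "'b list"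
  have sum_app: "(\<Sum>i\<in>A. f i) l = (\<Sum>i\<in>A. f i l)"
    for A :: "nat set" and f :: "nat \<Rightarrow> 'b list \<Rightarrow> complex"
    by (induction A rule: infinite_finite_induct) auto
  show "tensor_act n par \<rho> y (pure_tensor n v) l =
    (\<Sum>i<n. fun_scale (ksign (q * (\<Sum>j<i. p j))) (pure_tensor n (v(i := \<rho> i y (v i))))) l"
  proof (cases "length l = n")
    case False
    thus ?thesis by (simp add: sum_app tensor_act_def pure_tensor_def fun_scale_def)
  next
    case len: True
    have "(\<Sum>r\<in>{0, 1}. ksign (r * (\<Sum>j<i. par j (l ! j))) *
        \<rho> i (hcomp r y) (\<lambda>b. pure_tensor n v (l[i := b])) (l ! i)) =
      ksign (q * (\<Sum>j<i. p j)) * pure_tensor n (v(i := \<rho> i y (v i))) l" if i: "i < n" for i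
    proof -
      have hc: "hcomp r y = (if r = q then y else 0)" for r
        using hcomp_hcomp[of r q y] y by auto
      define C where "C = (\<Prod>j\<in>{..<n} - {i}. v j (l ! j))"
      have "(\<lambda>b. pure_tensor n v (l[i := b])) = fun_scale C (v i)"
      proof
        fix b
        have "(\<Prod>j<n. v j (l[i := b] ! j)) = v i b * (\<Prod>j\<in>{..<n} - {i}. v j (l[i := b] ! j))"
          using i len by (subst prod.remove[of _ i]) auto
        also have "(\<Prod>j\<in>{..<n} - {i}. v j (l[i := b] ! j)) = C"
          unfolding C_def by (intro prod.cong) auto
        finally show "pure_tensor n v (l[i := b]) = fun_scale C (v i) b"
          using len by (simp add: pure_tensor_def fun_scale_def)
      qed
      hence "(\<Sum>r\<in>{0, 1}. ksign (r * (\<Sum>j<i. par j (l ! j))) *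
          \<rho> i (hcomp r y) (\<lambda>b. pure_tensor n v (l[i := b])) (l ! i)) =
        (\<Sum>r\<in>{0, 1}. if r = q then
          ksign (q * (\<Sum>j<i. par j (l ! j))) * (C * \<rho> i y (v i) (l ! i)) else 0)"
        using i by (intro sum.cong) (simp_all only: hc scale zero, auto simp: fun_scale_def zero)
      also have "\<dots> = ksign (q * (\<Sum>j<i. par j (l ! j))) * (C * \<rho> i y (v i) (l ! i))"
        by (cases q) auto
      also have "\<dots> = ksign (q * (\<Sum>j<i. p j)) * (C * \<rho> i y (v i) (l ! i))"
      proof (cases "C = 0")
        case False
        have "par j (l ! j) = p j" if "j < i" for j
        proof -
          have "v j (l ! j) \<noteq> 0" using False that i by (auto simp: C_def)
          thus ?thesis using v[of j] that i by (auto simp: coord_module_def)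
        qed
        thus ?thesis by simp
      qed simp
      also have "C * \<rho> i y (v i) (l ! i) = pure_tensor n (v(i := \<rho> i y (v i))) l"
      proof -
        have "(\<Prod>j<n. (v(i := \<rho> i y (v i))) j (l ! j)) =
          \<rho> i y (v i) (l ! i) * (\<Prod>j\<in>{..<n} - {i}. (v(i := \<rho> i y (v i))) j (l ! j))"
          using i by (subst prod.remove[of _ i]) auto
        also have "(\<Prod>j\<in>{..<n} - {i}. (v(i := \<rho> i y (v i))) j (l ! j)) = C"
          unfolding C_def by (intro prod.cong) auto
        finally show ?thesis using len by (simp add: pure_tensor_def)
      qed
      finally show ?thesis .
    qed
    thus ?thesis
      using len by (simp add: sum_app tensor_act_def fun_scale_def del: sum.insert)
  qed
qed


section \<open>Graded tensor products\<close>

text \<open>The evaluation homomorphism \<open>\<gg>[t] \<rightarrow> \<gg>\<close> at \<open>z\<close>, along which \<open>V(z)\<close> is obtained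
  from \<open>V\<close>.\<close>

definition eval_current :: "complex \<Rightarrow> 'g::lie_superalgebra poly \<Rightarrow> 'g" where
  "eval_current z y = (\<Sum>k\<le>degree y. (z ^ k) *\<^sub>C coeff y k)"

text \<open>\<open>U(\<gg>[t])\<^sub>r\<close> is spanned by the products of elements \<open>y \<otimes> t\<^sup>k\<close> whose exponents \<open>k\<close>
  add up to \<open>r\<close>.\<close>

definition t_filtration ::
    "('g::lie_superalgebra poly, 'i \<Rightarrow> complex) supermodule \<Rightarrow> ('i \<Rightarrow> complex) \<Rightarrow> nat \<Rightarrow>
     ('i \<Rightarrow> complex) set" where
  "t_filtration M v s = fun_space.span
     {foldr (\<lambda>(y, k). act M (monom y k)) ys v | ys. (\<Sum>(y, k)\<leftarrow>ys. k) \<le> s}"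

definition filtration_below :: "(nat \<Rightarrow> 'v::zero set) \<Rightarrow> nat \<Rightarrow> 'v set" where
  "filtration_below F s = (case s of 0 \<Rightarrow> {0} | Suc r \<Rightarrow> F r)"

text \<open>An element of the associated graded space is a finitely supported family
  \<open>c s \<in> F\<^sub>s / F\<^sub>s\<^sub>-\<^sub>1\<close>. Since \<open>y \<otimes> t\<^sup>k\<close> maps \<open>F\<^sub>s / F\<^sub>s\<^sub>-\<^sub>1\<close> to \<open>F\<^sub>s\<^sub>+\<^sub>k / F\<^sub>s\<^sub>+\<^sub>k\<^sub>-\<^sub>1\<close>, the
  degree \<open>s\<close> component of \<open>y . c\<close> collects the contributions of \<open>coeff y k \<otimes> t\<^sup>k\<close> applied to
  \<open>c (s - k)\<close>.\<close>

definition assoc_graded ::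
    "('g::lie_superalgebra poly, 'i \<Rightarrow> complex) supermodule \<Rightarrow> ('i \<Rightarrow> complex) \<Rightarrow>
     ('g poly, nat \<Rightarrow> ('i \<Rightarrow> complex) set) supermodule" where
  "assoc_graded M v = (let F = t_filtration M v; B = filtration_below F;
     C = {c. (\<forall>s. \<exists>x\<in>F s. c s = x +o B s) \<and> finite {s. c s \<noteq> B s}} in
   \<lparr>carrier = C,
    mult = undefined, one = undefined,
    zero = B,
    add = (\<lambda>c d s. c s + d s),
    smult = (\<lambda>a c s. fun_scale a ` c s + B s),
    part = (\<lambda>p. {c \<in> C. \<forall>s. \<exists>x\<in>F s \<inter> part M p. c s = x +o B s}),
    act = (\<lambda>y c s. (\<Sum>k\<le>s. act M (monom (coeff y k) k) ` c (s - k)) + B s)\<rparr>)"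

text \<open>The graded tensor product of the evaluation modules \<open>V\<^sup>i(z\<^sub>i)\<close> with
  \<open>V\<^sup>i = coord_module (par i) (\<rho> i)\<close> and cyclic vectors \<open>v i\<close>, for \<open>i < n\<close>.\<close>

definition graded_tensor_product ::
    "nat \<Rightarrow> (nat \<Rightarrow> 'b \<Rightarrow> bit) \<Rightarrow>
     (nat \<Rightarrow> 'g::lie_superalgebra \<Rightarrow> ('b \<Rightarrow> complex) \<Rightarrow> ('b \<Rightarrow> complex)) \<Rightarrow>
     (nat \<Rightarrow> 'b \<Rightarrow> complex) \<Rightarrow> (nat \<Rightarrow> complex) \<Rightarrow>
     ('g poly, nat \<Rightarrow> ('b list \<Rightarrow> complex) set) supermodule" where
  "graded_tensor_product n par \<rho> v z =
     assoc_graded (tensor_module n par (\<lambda>i y. \<rho> i (eval_current (z i) y))) (pure_tensor n v)"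


section \<open>Lowest weight vectors\<close>

definition even_lowest_weight_vector ::
    "(osp12, 'v) supermodule \<Rightarrow> complex \<Rightarrow> 'v \<Rightarrow> bool" where
  "even_lowest_weight_vector M k v \<longleftrightarrow>
     v \<in> part M 0 \<and> v \<noteq> \<zero>\<^bsub>M\<^esub> \<and> (\<forall>y\<in>n_minus. act M y v = \<zero>\<^bsub>M\<^esub>) \<and>
     act M osp_h v = k \<odot>\<^bsub>M\<^esub> v"

end

(* The Weyl module maps onto the fusion product, because the generator of the latter satisfies the
   Weyl relations; by Lagrange interpolation the fusion product has dimension 3^n, so it suffices to
   bound the dimension of the Weyl module by 3^n. The bound comes from the subalgebra spanned by
   e_i, g+_i (i >= 0) and h_i, f_i, g-_i (i >= 1): the submodule generated by an extremal vector
   e_0^k w, g+_0 e_0^k w or f_1^k w is of the same kind as the original module, and so is the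
   quotient by it, which yields a recursion for the dimensions.

   The filtration of the tensor product consists of osp(1,2)-submodules and therefore splits by
   complete reducibility. Hence the graded module lives on the tensor product itself with the action
   of osp(1,2) unchanged, so one isomorphism gives both claims. *)

theory Submission
  imports Defs
begin

section \<open>A dimension recursion\<close>

text \<open>Why a smaller algebra: for the whole current algebra the recursion could not start,
  because \<open>f_0^n e_0^n w\<close> is a nonzero multiple of \<open>w\<close>, so that
  \<open>e_0^n w\<close> already generates everything. Without \<open>h_0\<close>,
  \<open>f_0\<close>, \<open>g^-_0\<close> an extremal vector generates a smaller submodule, and
  extremal vectors alternate between two kinds: annihilated by the \<open>h_i\<close>,
  \<open>f_i\<close>, \<open>g^-_i\<close>, or by the \<open>h_i\<close>, \<open>e_i\<close>,
  \<open>g^+_i\<close>. Both kinds must be followed at once. Nothing is lost by the restriction,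
  since a PBW argument shows that words in the \<open>e_i\<close> and \<open>g^+_i\<close> applied
  to \<open>w\<close> span the Weyl module, and these operators are kept. Operators act on whole
  types, so quotients need a substitute: the recursion works modulo a submodule, and the Weyl module
  is modelled by a projection along the kernel. The invariant complements are constructed without
  regard to parity. They respect it nevertheless, because on the tensor power the
  \<open>h\<close>-weight determines the parity.\<close>

locale current_sl2 = vector_space scale
  for scale :: "complex \<Rightarrow> 'v::ab_group_add \<Rightarrow> 'v" (infixr \<open>*s\<close> 75) +
  fixes E H F :: "nat \<Rightarrow> 'v \<Rightarrow> 'v"
  assumes E_add: "E i (x + y) = E i x + E i y"
    and E_scale: "E i (c *s x) = c *s E i x"
    and H_add: "H i (x + y) = H i x + H i y"
    and H_scale: "H i (c *s x) = c *s H i x"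
    and F_add: "F i (x + y) = F i x + F i y"
    and F_scale: "F i (c *s x) = c *s F i x"
    and EE: "E i (E j x) = E j (E i x)"
    and FF: "F i (F j x) = F j (F i x)"
    and HE: "H i (E j x) = E j (H i x) + 2 *s E (Suc (i + j)) x"
    and HF: "H i (F j x) = F j (H i x) - 2 *s F (Suc (i + j)) x"
    and EF: "E i (F j x) = F j (E i x) + H (i + j) x"
begin

lemma diff_cancel: "subspace K \<Longrightarrow> x - y \<in> K \<Longrightarrow> x \<in> K \<Longrightarrow> y \<in> K"
  using subspace_diff[of K x "x - y"] by simp

lemma scale_two: "2 *s x = x + x"
  using scale_left_distrib[of 1 1 x] by simp

lemma E_minus: "E i (- x) = - E i x"
  using E_scale[of i "-1" x] by simp

lemma F_minus: "F i (- x) = - F i x"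
  using F_scale[of i "-1" x] by simp

lemma E_diff: "E i (x - y) = E i x - E i y"
  using E_add[of i x "- y"] by (simp add: E_minus)

lemma F_diff: "F i (x - y) = F i x - F i y"
  using F_add[of i x "- y"] by (simp add: F_minus)

definition sl2_stable :: "'v set \<Rightarrow> bool" where
  "sl2_stable K \<longleftrightarrow> subspace K \<and> (\<forall>i. \<forall>x\<in>K. E i x \<in> K \<and> H i x \<in> K \<and> F i x \<in> K)"

text \<open>For stable \<open>K\<close>: modulo \<open>K\<close>, \<open>x\<close> is a combination
  of words of \<open>k\<close> letters \<open>E i\<close> with index sum \<open>d\<close>, applied
  to \<open>w\<close>. A relation with two counters is used because \<open>H j\<close> and
  \<open>F j\<close> change these counters in a controlled way.\<close>

inductive E_words :: "'v set \<Rightarrow> 'v \<Rightarrow> nat \<Rightarrow> nat \<Rightarrow> 'v \<Rightarrow> bool" for K w where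
  start: "E_words K w 0 0 w"
| in_K: "x \<in> K \<Longrightarrow> E_words K w k d x"
| letter: "E_words K w k d x \<Longrightarrow> E_words K w (Suc k) (i + d) (E i x)"
| plus: "E_words K w k d x \<Longrightarrow> E_words K w k d y \<Longrightarrow> E_words K w k d (x + y)"
| scaled: "E_words K w k d x \<Longrightarrow> E_words K w k d (c *s x)"

lemma E_words_diff: "E_words K w k d x \<Longrightarrow> E_words K w k d y \<Longrightarrow> E_words K w k d (x - y)"
  using E_words.plus[OF _ E_words.scaled, of K w k d x y "-1"] by simp

lemma E_words_power: "E_words K w k 0 ((E 0 ^^ k) w)"
proof (induction k)
  case (Suc k)
  show ?case using E_words.letter[OF Suc, of 0] by simp
qed (simp add: E_words.start)

section \<open>Vectors that all \<open>F i\<close> and \<open>H i\<close> send into a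
  submodule\<close>

context
  fixes K w
  assumes K: "sl2_stable K" and Fw: "\<And>i. F i w \<in> K" and Hw: "\<And>i. H i w \<in> K"
begin

lemma subspace_K: "subspace K" using K by (auto simp: sl2_stable_def)

lemma E_K: "x \<in> K \<Longrightarrow> E i x \<in> K" and F_K: "x \<in> K \<Longrightarrow> F i x \<in> K"
  and H_K: "x \<in> K \<Longrightarrow> H i x \<in> K"
  using K by (auto simp: sl2_stable_def)

text \<open>Each of the \<open>k + 1\<close> commutators of \<open>H i\<close> with
  \<open>E 0\<close> contributes \<open>2 E (Suc i)\<close>, which commutes with the other
  factors.\<close>

lemma H_E_power:
  "H i ((E 0 ^^ Suc k) w) - (2 * of_nat (Suc k)) *s E (Suc i) ((E 0 ^^ k) w) \<in> K"
proof (induction k)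
  case 0
  show ?case using E_K[OF Hw[of i], of 0] by (simp add: HE)
next
  case (Suc k)
  have "H i ((E 0 ^^ Suc (Suc k)) w) - (2 * of_nat (Suc (Suc k))) *s E (Suc i) ((E 0 ^^ Suc k) w)
    = E 0 (H i ((E 0 ^^ Suc k) w) - (2 * of_nat (Suc k)) *s E (Suc i) ((E 0 ^^ k) w))"
    by (simp add: HE E_diff E_scale E_add EE[of 0 "Suc i"] algebra_simps flip: scale_left_distrib)
  with E_K[OF Suc] show ?case by simp
qed

text \<open>Moving \<open>F i\<close> past one \<open>E 0\<close> costs a term \<open>H i\<close>,
  which \<open>H_E_power\<close> evaluates; the coefficient is the sum of \<open>2 * j\<close> over
  \<open>j\<close> from 0 to \<open>k + 1\<close>.\<close>

lemma F_E_power: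
  "F i ((E 0 ^^ Suc (Suc k)) w) + of_nat (Suc k * Suc (Suc k)) *s E (Suc i) ((E 0 ^^ k) w) \<in> K"
proof (induction k)
  case 0
  have FE: "F i (E 0 x) = E 0 (F i x) - H i x" for x
    using EF[of 0 i x] by simp
  have "F i (E 0 (E 0 w)) + 2 *s E (Suc i) w = E 0 (E 0 (F i w)) - 2 *s E 0 (H i w)"
    by (simp add: FE HE E_diff scale_two)
  thus ?case
    using E_K[OF E_K[OF Fw[of i]], of 0 0] E_K[OF Hw[of i], of 0] subspace_K
    by (simp add: subspace_diff subspace_scale)
next
  case (Suc k)
  define a where "a = (E 0 ^^ k) w"
  have "F i ((E 0 ^^ Suc (Suc (Suc k))) w)
      + of_nat (Suc (Suc k) * Suc (Suc (Suc k))) *s E (Suc i) ((E 0 ^^ Suc k) w)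
    = E 0 (F i ((E 0 ^^ Suc (Suc k)) w) + of_nat (Suc k * Suc (Suc k)) *s E (Suc i) ((E 0 ^^ k) w))
      - (H i ((E 0 ^^ Suc (Suc k)) w) - (2 * of_nat (Suc (Suc k))) *s E (Suc i) ((E 0 ^^ Suc k) w))"
    using EF[of 0 i "(E 0 ^^ Suc (Suc k)) w"] EE[of 0 "Suc i" a]
    by (simp add: E_add E_scale a_def[symmetric] algebra_simps)
      (simp add: algebra_simps flip: scale_left_distrib)
  thus ?case
    using E_K[OF Suc, of 0] H_E_power[of i "Suc k"] subspace_K by (simp only: subspace_diff)
qed

text \<open>The commutator with a letter \<open>E i\<close> is again a letter,
  \<open>2 E (Suc (j + i))\<close>: the length stays and the index sum grows by
  \<open>j + 1\<close>.\<close>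

lemma E_words_H: "E_words K w k d x \<Longrightarrow> E_words K w k (Suc (j + d)) (H j x)"
proof (induction rule: E_words.induct)
  case start
  show ?case by (rule E_words.in_K) (rule Hw)
next
  case (in_K x k d)
  thus ?case by (intro E_words.in_K H_K)
next
  case (letter k d x i)
  have "E_words K w (Suc k) (i + Suc (j + d)) (E i (H j x))"
    by (rule E_words.letter) (rule letter)
  moreover have "E_words K w (Suc k) (Suc (j + i) + d) (2 *s E (Suc (j + i)) x)"
    by (intro E_words.scaled E_words.letter letter)
  ultimately show ?case
    using E_words.plus by (simp add: HE add_ac)
qed (auto simp: H_add H_scale intro: E_words.intros)

text \<open>The commutator with a letter \<open>E i\<close> is an \<open>H (i + j)\<close>, which
  uses that letter up and then, by \<open>E_words_H\<close>, adds \<open>i + j + 1\<close> to the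
  index sum of the rest. A word without letters ends in \<open>K\<close>.\<close>

lemma E_words_F:
  "E_words K w k d x \<Longrightarrow>
    (case k of 0 \<Rightarrow> F j x \<in> K | Suc k' \<Rightarrow> E_words K w k' (Suc (j + d)) (F j x))"
proof (induction rule: E_words.induct)
  case start
  show ?case by (simp add: Fw)
next
  case (in_K x k d)
  thus ?case by (auto split: nat.split intro!: E_words.in_K F_K)
next
  case (letter k d x i)
  have eq: "F j (E i x) = E i (F j x) - H (i + j) x"
    using EF[of i j x] by (simp add: algebra_simps)
  have H: "E_words K w k (Suc (j + (i + d))) (H (i + j) x)"
    using E_words_H[OF letter.hyps, of "i + j"] by (simp add: add_ac)
  have "E_words K w k (Suc (j + (i + d))) (E i (F j x))"
  proof (cases k)
    case 0
    thus ?thesis using letter.IH by (auto intro!: E_words.in_K E_K)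
  next
    case (Suc k')
    thus ?thesis using E_words.letter[of K w k' "Suc (j + d)" "F j x" i] letter.IH
      by (simp add: add_ac)
  qed
  thus ?case using E_words_diff[OF _ H] by (simp add: eq)
next
  case (plus k d x y)
  thus ?case using subspace_K
    by (auto simp: F_add split: nat.splits intro: E_words.plus subspace_add)
next
  case (scaled k d x c)
  thus ?case using subspace_K
    by (auto simp: F_scale split: nat.splits intro: E_words.scaled subspace_scale)
qed

text \<open>Apart from elements of \<open>K\<close>, words without letters arise only from
  \<open>start\<close>, and that has index sum 0.\<close>

lemma E_words_0: "E_words K w k d x \<Longrightarrow> k = 0 \<Longrightarrow> d > 0 \<Longrightarrow> x \<in> K"
  by (induction rule: E_words.induct) (auto intro: subspace_K subspace_add subspace_scale)

lemma E_words_F_power: "m \<le> k \<Longrightarrow> E_words K w (k - m) m ((F 0 ^^ m) ((E 0 ^^ k) w))"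
proof (induction m)
  case 0
  show ?case by (simp add: E_words_power)
next
  case (Suc m)
  then obtain k' where k: "k - m = Suc k'" by (metis Suc_diff_Suc Suc_le_lessD)
  hence "k - Suc m = k'" by simp
  thus ?case using E_words_F[OF Suc.IH, of 0] Suc.prems k by simp
qed

text \<open>Each \<open>F 0\<close> uses up one letter and raises the index sum by one, so what
  remains is an empty word of index sum \<open>k > 0\<close>.\<close>

lemma F_power_E_power: "k > 0 \<Longrightarrow> (F 0 ^^ k) ((E 0 ^^ k) w) \<in> K"
  using E_words_0[OF E_words_F_power[of k k]] by simp

lemma F_power_Suc_E_power: "(F 0 ^^ Suc k) ((E 0 ^^ k) w) \<in> K"
  by (cases "k = 0") (auto simp: Fw intro!: F_K F_power_E_power)

lemma cancel_K: "c \<noteq> 0 \<Longrightarrow> c *s x \<in> K \<Longrightarrow> x \<in> K"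
  using subspace_scale[OF subspace_K, of "c *s x" "inverse c"] by simp

lemma E_Suc_E_power_of_E:
  assumes "(E 0 ^^ Suc k) w \<in> K"
  shows "E (Suc i) ((E 0 ^^ k) w) \<in> K"
proof -
  have "(2 * of_nat (Suc k)) *s E (Suc i) ((E 0 ^^ k) w) \<in> K"
    by (rule diff_cancel[OF subspace_K H_E_power H_K[OF assms]])
  thus ?thesis by (rule cancel_K[rotated]) (simp only: mult_eq_0_iff of_nat_eq_0_iff, simp)
qed

text \<open>\<open>F i\<close> removes two factors \<open>E 0\<close> and gives back one
  \<open>E (Suc i)\<close>, so it can be applied to a power two steps higher;
  \<open>E_Suc_E_power_of_E\<close> uses \<open>H i\<close> and one step.\<close>

lemma E_Suc_E_power_of_F:
  assumes "(E 0 ^^ Suc (Suc k)) w \<in> K"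
  shows "E (Suc i) ((E 0 ^^ k) w) \<in> K"
proof -
  have "of_nat (Suc k * Suc (Suc k)) *s E (Suc i) ((E 0 ^^ k) w) \<in> K"
    using F_K[OF assms, of i] F_E_power[of i k] subspace_K
      subspace_diff[of K _ "F i ((E 0 ^^ Suc (Suc k)) w)"] by (metis add_diff_cancel_left')
  thus ?thesis by (rule cancel_K[rotated]) (simp only: of_nat_eq_0_iff, simp)
qed

lemma H_E_power_in_K:
  assumes "(E 0 ^^ Suc (Suc k)) w \<in> K"
  shows "H i ((E 0 ^^ Suc k) w) \<in> K"
  using subspace_add[OF subspace_K H_E_power[of i k]
      subspace_scale[OF subspace_K E_Suc_E_power_of_F[OF assms, of i], of "2 * of_nat (Suc k)"]]
  by simp

end

end

text \<open>\<open>E i\<close> and \<open>P i\<close> stand for \<open>e\<^sub>i\<close> and \<open>g\<^sup>+\<^sub>i\<close>, but \<open>H i\<close>, \<open>F i\<close> and \<open>N i\<close> for \<open>h\<close>, \<open>f\<close> and \<open>g\<^sup>-\<close>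
  with index \<open>i + 1\<close>. With this shift, exchanging \<open>E\<close> and \<open>F\<close> and negating \<open>H\<close> is a symmetry of
  the even part.\<close>

locale current_osp = current_sl2 scale E H F
  for scale :: "complex \<Rightarrow> 'v::ab_group_add \<Rightarrow> 'v" (infixr \<open>*s\<close> 75) and E H F +
  fixes P N :: "nat \<Rightarrow> 'v \<Rightarrow> 'v"
  assumes P_add: "P i (x + y) = P i x + P i y"
    and P_scale: "P i (c *s x) = c *s P i x"
    and N_add: "N i (x + y) = N i x + N i y"
    and N_scale: "N i (c *s x) = c *s N i x"
    and EP: "E i (P j x) = P j (E i x)"
    and PP: "P i (P j x) + P j (P i x) = 2 *s E (i + j) x"
    and HP: "H i (P j x) = P j (H i x) + P (Suc (i + j)) x"
    and EN: "E i (N j x) = N j (E i x) - P (Suc (i + j)) x"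
    and PF: "P i (F j x) = F j (P i x) + N (i + j) x"
    and FN: "F i (N j x) = N j (F i x)"
    and NN: "N i (N j x) + N j (N i x) = - (2 *s F (Suc (i + j)) x)"
begin

text \<open>Turns each even statement about \<open>lower\<close> vectors into its mirror image for
  \<open>upper\<close> vectors.\<close>

sublocale swap: current_sl2 scale F "\<lambda>i x. - H i x" E
proof unfold_locales
  show "- H i (F j x) = F j (- H i x) + 2 *s F (Suc (i + j)) x" for i j x
    by (simp add: HF F_minus)
  show "- H i (E j x) = E j (- H i x) - 2 *s E (Suc (i + j)) x" for i j x
    by (simp add: HE E_minus)
  show "F i (E j x) = E j (F i x) + - H (i + j) x" for i j x
    using EF[of j i x] by (simp add: add.commute)
  show "E i (E j x) = E j (E i x)" for i j x
    by (rule EE)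
  show "F i (F j x) = F j (F i x)" for i j x
    by (rule FF)
qed (simp_all add: E_add E_scale F_add F_scale H_add H_scale)

definition osp_stable :: "'v set \<Rightarrow> bool" where
  "osp_stable K \<longleftrightarrow> sl2_stable K \<and> (\<forall>i. \<forall>x\<in>K. P i x \<in> K \<and> N i x \<in> K)"

lemma osp_stableD:
  assumes "osp_stable K"
  shows "subspace K" "sl2_stable K" "swap.sl2_stable K"
    "x \<in> K \<Longrightarrow> E i x \<in> K" "x \<in> K \<Longrightarrow> F i x \<in> K" "x \<in> K \<Longrightarrow> H i x \<in> K"
    "x \<in> K \<Longrightarrow> P i x \<in> K" "x \<in> K \<Longrightarrow> N i x \<in> K"
  using assms
  by (auto simp: osp_stable_def sl2_stable_def swap.sl2_stable_def intro: subspace_neg)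

text \<open>Extremality is stated modulo a submodule instead of in a quotient; passing to a further
  quotient then only enlarges \<open>K\<close>, see \<open>lower_mono\<close> and
  \<open>upper_mono\<close>.\<close>

definition lower :: "'v set \<Rightarrow> 'v \<Rightarrow> bool" where
  "lower K w \<longleftrightarrow> (\<forall>i. F i w \<in> K \<and> H i w \<in> K \<and> N i w \<in> K)"

definition upper :: "'v set \<Rightarrow> 'v \<Rightarrow> bool" where
  "upper K b \<longleftrightarrow> (\<forall>i. E i b \<in> K \<and> H i b \<in> K \<and> P i b \<in> K)"

text \<open>Odd counterpart of \<open>H_E_power\<close>: the commutator of \<open>N i\<close> with
  \<open>E 0\<close> is \<open>P (Suc i)\<close>, which commutes with \<open>E 0\<close>.\<close>

lemma N_E_power:
  assumes K: "osp_stable K" and w: "lower K w"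
  shows "N i ((E 0 ^^ Suc k) w) - of_nat (Suc k) *s P (Suc i) ((E 0 ^^ k) w) \<in> K"
proof (induction k)
  case 0
  show ?case using EN[of 0 i w] w osp_stableD(4)[OF K, of "N i w" 0] by (simp add: lower_def)
next
  case (Suc k)
  define a where "a = (E 0 ^^ k) w"
  have "N i ((E 0 ^^ Suc (Suc k)) w) - of_nat (Suc (Suc k)) *s P (Suc i) ((E 0 ^^ Suc k) w)
     = E 0 (N i ((E 0 ^^ Suc k) w) - of_nat (Suc k) *s P (Suc i) ((E 0 ^^ k) w))"
    using EN[of 0 i "E 0 a"] EP[of 0 "Suc i" a]
    by (simp add: E_diff E_add E_scale a_def[symmetric] scale_left_distrib scale_two)
  thus ?case using osp_stableD(4)[OF K Suc, of 0] by (simp only:)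
qed

lemma P_F_power:
  assumes K: "osp_stable K" and b: "upper K b"
  shows "P i ((F 0 ^^ Suc k) b) - of_nat (Suc k) *s N i ((F 0 ^^ k) b) \<in> K"
proof (induction k)
  case 0
  show ?case using PF[of i 0 b] b osp_stableD(5)[OF K, of "P i b" 0] by (simp add: upper_def)
next
  case (Suc k)
  define a where "a = (F 0 ^^ k) b"
  have "P i ((F 0 ^^ Suc (Suc k)) b) - of_nat (Suc (Suc k)) *s N i ((F 0 ^^ Suc k) b)
     = F 0 (P i ((F 0 ^^ Suc k) b) - of_nat (Suc k) *s N i ((F 0 ^^ k) b))"
    using PF[of i 0 "F 0 a"] FN[of 0 i a]
    by (simp add: F_diff F_add F_scale a_def[symmetric] scale_left_distrib scale_two)
  thus ?case using osp_stableD(5)[OF K Suc, of 0] by (simp only:)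
qed

text \<open>\<open>2 E i\<close> is the anticommutator of \<open>P i\<close> and
  \<open>P 0\<close>.\<close>

lemma E_in_K_of_P:
  assumes K: "osp_stable K" and "P i (P 0 x) \<in> K" "P i x \<in> K"
  shows "E i x \<in> K"
proof -
  have "2 *s E i x \<in> K"
    using PP[of i 0 x] subspace_add[OF osp_stableD(1)[OF K] assms(2) osp_stableD(7)[OF K assms(3), of 0]]
    by simp
  from subspace_scale[OF osp_stableD(1)[OF K] this, of "1/2"] show ?thesis by simp
qed

text \<open>An upper bound \<open>r\<close> for the dimension, modulo \<open>K\<close>, of the
  submodule generated by \<open>w\<close>, phrased without a quotient space.\<close>

definition spans :: "'v set \<Rightarrow> nat \<Rightarrow> 'v \<Rightarrow> bool" where
  "spans K r w \<longleftrightarrow>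
     (\<exists>S. finite S \<and> card S \<le> r \<and> osp_stable (span (K \<union> S)) \<and> w \<in> span (K \<union> S))"

text \<open>Subadditivity of dimension along a chain of submodules; \<open>K'\<close> is the
  intermediate one, obtained by adjoining the submodule of \<open>u\<close>.\<close>

lemma spans_trans:
  assumes u: "spans K r u"
    and w: "\<And>K'. osp_stable K' \<Longrightarrow> K \<subseteq> K' \<Longrightarrow> u \<in> K' \<Longrightarrow> spans K' s w"
  shows "spans K (r + s) w"
proof -
  obtain S where S: "finite S" "card S \<le> r" "osp_stable (span (K \<union> S))" "u \<in> span (K \<union> S)"
    using u by (auto simp: spans_def)
  have "K \<subseteq> span (K \<union> S)" using span_superset by blast
  then obtain T where T: "finite T" "card T \<le> s" "osp_stable (span (span (K \<union> S) \<union> T))"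
    "w \<in> span (span (K \<union> S) \<union> T)"
    using w[OF S(3) _ S(4)] by (auto simp: spans_def)
  have "span (span (K \<union> S) \<union> T) = span (K \<union> (S \<union> T))"
  proof (intro antisym span_minimal subspace_span)
    show "span (K \<union> S) \<union> T \<subseteq> span (K \<union> (S \<union> T))"
      using span_mono[of "K \<union> S" "K \<union> (S \<union> T)"] span_superset[of "K \<union> (S \<union> T)"] by blast
    show "K \<union> (S \<union> T) \<subseteq> span (span (K \<union> S) \<union> T)"
      using span_superset[of "K \<union> S"] span_superset[of "span (K \<union> S) \<union> T"] by blast
  qed
  moreover have "card (S \<union> T) \<le> r + s"
    using card_Un_le[of S T] S(2) T(2) by simp
  ultimately show ?thesis
    unfolding spans_def using S(1) T by (intro exI[of _ "S \<union> T"]) auto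
qed

lemma spans_one:
  assumes K: "osp_stable K"
    and "\<And>i. E i w \<in> K" "\<And>i. F i w \<in> K" "\<And>i. H i w \<in> K" "\<And>i. P i w \<in> K" "\<And>i. N i w \<in> K"
  shows "spans K 1 w"
proof -
  have sp: "span (K \<union> {w}) = {x + c *s w | x c. x \<in> K}"
    unfolding span_Un span_singleton span_eq_iff[THEN iffD2, OF osp_stableD(1)[OF K]] by blast
  have stable: "f x \<in> span (K \<union> {w})"
    if f: "\<And>x y. f (x + y) = f x + f y" "\<And>c x. f (c *s x) = c *s f x" "f w \<in> K"
      "\<And>x. x \<in> K \<Longrightarrow> f x \<in> K" and x: "x \<in> span (K \<union> {w})" for f x
  proof -
    obtain y c where "x = y + c *s w" "y \<in> K" using x sp by auto
    hence "f x \<in> K"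
      using f osp_stableD(1)[OF K] by (auto intro: subspace_add subspace_scale)
    thus ?thesis by (auto intro: span_base)
  qed
  have "E i x \<in> span (K \<union> {w}) \<and> H i x \<in> span (K \<union> {w}) \<and> F i x \<in> span (K \<union> {w})"
    "P i x \<in> span (K \<union> {w}) \<and> N i x \<in> span (K \<union> {w})"
    if x: "x \<in> span (K \<union> {w})" for i x
    using x stable[of "E i" x] stable[of "F i" x] stable[of "H i" x] stable[of "P i" x]
      stable[of "N i" x]
    by (simp_all add: E_add E_scale F_add F_scale H_add H_scale P_add P_scale N_add N_scale
        assms(2-) osp_stableD(4-)[OF K])
  hence "osp_stable (span (K \<union> {w}))"
    unfolding osp_stable_def sl2_stable_def by blast
  thus ?thesis
    unfolding spans_def by (intro exI[of _ "{w}"]) (auto intro: span_base)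
qed

text \<open>Base of the recursion: the commutators of the \<open>H j\<close> with \<open>P 0\<close>
  give all \<open>P i\<close>, whose anticommutators with \<open>P 0\<close> give all
  \<open>E i\<close>.\<close>

lemma spans_lower_0:
  assumes K: "osp_stable K" and w: "lower K w" and P0: "P 0 w \<in> K"
  shows "spans K 1 w"
proof -
  have P: "P i w \<in> K" for i
  proof (cases i)
    case (Suc j)
    have "P i w = H j (P 0 w) - P 0 (H j w)" using HP[of j 0 w] Suc by simp
    thus ?thesis
      using w osp_stableD[OF K] P0 by (auto simp: lower_def intro!: subspace_diff)
  qed (simp add: P0)
  show ?thesis
  proof (rule spans_one[OF K])
    fix i
    show "E i w \<in> K" by (rule E_in_K_of_P[OF K osp_stableD(7)[OF K P0] P])
  qed (use w P in \<open>auto simp: lower_def\<close>)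
qed

text \<open>Base for the other kind: the commutator of \<open>P i\<close> with \<open>F 0\<close> is
  \<open>N i\<close>, and the anticommutator of \<open>N 0\<close> and \<open>N j\<close> gives
  \<open>F (Suc j)\<close>.\<close>

lemma spans_upper_0:
  assumes K: "osp_stable K" and b: "upper K b" and F0: "F 0 b \<in> K"
  shows "spans K 1 b"
proof -
  note KD = osp_stableD[OF K]
  have N: "N i b \<in> K" for i
  proof -
    have "N i b = P i (F 0 b) - F 0 (P i b)" using PF[of i 0 b] by simp
    thus ?thesis using b KD F0 by (auto simp: upper_def intro!: subspace_diff)
  qed
  have F: "F i b \<in> K" for i
  proof (cases i)
    case (Suc j)
    have "- (2 *s F i b) \<in> K"
      using NN[of 0 j b] KD(8)[OF N] KD(1) Suc by (metis add_0 subspace_add)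
    from subspace_scale[OF KD(1) this, of "-1/2"] show ?thesis by simp
  qed (simp add: F0)
  show ?thesis by (rule spans_one[OF K]) (use b F N in \<open>auto simp: upper_def\<close>)
qed

text \<open>Since \<open>P 0\<close> squares to \<open>E 0\<close>, the next power of
  \<open>E 0\<close> lies in \<open>K\<close> as well. Applying \<open>N i\<close> to it gives the
  \<open>P (Suc j)\<close>, and anticommutators give the \<open>E i\<close>.\<close>

lemma upper_E_power:
  assumes K: "osp_stable K" and w: "lower K w" and E: "P 0 ((E 0 ^^ Suc k) w) \<in> K"
  shows "upper K ((E 0 ^^ Suc k) w)"
proof -
  note KD = osp_stableD[OF K]
  have wF: "\<And>i. F i w \<in> K" and wH: "\<And>i. H i w \<in> K" using w by (auto simp: lower_def)
  have "2 *s (E 0 ^^ Suc (Suc k)) w = P 0 (P 0 ((E 0 ^^ Suc k) w)) + P 0 (P 0 ((E 0 ^^ Suc k) w))"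
    using PP[of 0 0 "(E 0 ^^ Suc k) w"] by simp
  hence "2 *s (E 0 ^^ Suc (Suc k)) w \<in> K"
    using KD(1) KD(7)[OF E, of 0] by (simp only: subspace_add)
  from subspace_scale[OF KD(1) this, of "1/2"] have E': "(E 0 ^^ Suc (Suc k)) w \<in> K" by simp
  have P: "P i ((E 0 ^^ Suc k) w) \<in> K" for i
  proof (cases i)
    case (Suc j)
    have "of_nat (Suc (Suc k)) *s P i ((E 0 ^^ Suc k) w) \<in> K"
      unfolding Suc by (rule diff_cancel[OF KD(1) N_E_power[OF K w] KD(8)[OF E']])
    thus ?thesis by (rule cancel_K[OF KD(2) wF wH, rotated]) (rule of_nat_neq_0)
  qed (use E in simp)
  show ?thesis
    unfolding upper_def
    using P E_in_K_of_P[OF K KD(7)[OF P] P] H_E_power_in_K[OF KD(2) wF wH E'] by blast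
qed

lemma F_0_P_0: "(F 0 ^^ Suc k) (P 0 x) = P 0 ((F 0 ^^ Suc k) x) - of_nat (Suc k) *s N 0 ((F 0 ^^ k) x)"
proof (induction k)
  case 0
  show ?case using PF[of 0 0 x] by simp
next
  case (Suc k)
  define a where "a = (F 0 ^^ k) x"
  have "(F 0 ^^ Suc (Suc k)) (P 0 x) = F 0 (P 0 (F 0 a) - of_nat (Suc k) *s N 0 a)"
    using Suc by (simp add: a_def)
  thus ?case
    using PF[of 0 0 "F 0 a"] FN[of 0 0 a]
    by (simp add: F_diff F_add F_scale a_def[symmetric] scale_left_distrib scale_two algebra_simps)
qed

text \<open>Applying \<open>N j\<close> and \<open>H j\<close> to the hypothesis puts
  \<open>P (Suc j)\<close> and \<open>E (Suc j)\<close> of the top power into \<open>K\<close>; the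
  image under \<open>P 0\<close> is the part left over, and it is extremal.\<close>

lemma upper_P_E_power:
  assumes K: "osp_stable K" and w: "lower K w" and E: "(E 0 ^^ Suc k) w \<in> K"
  shows "upper K (P 0 ((E 0 ^^ k) w))"
proof -
  note KD = osp_stableD[OF K]
  have wF: "\<And>i. F i w \<in> K" and wH: "\<And>i. H i w \<in> K" using w by (auto simp: lower_def)
  define c where "c = P 0 ((E 0 ^^ k) w)"
  have P_Suc: "P (Suc j) ((E 0 ^^ k) w) \<in> K" for j
  proof -
    have "of_nat (Suc k) *s P (Suc j) ((E 0 ^^ k) w) \<in> K"
      by (rule diff_cancel[OF KD(1) N_E_power[OF K w] KD(8)[OF E]])
    thus ?thesis by (rule cancel_K[OF KD(2) wF wH, rotated]) (rule of_nat_neq_0)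
  qed
  have Ei: "E i ((E 0 ^^ k) w) \<in> K" for i
    by (cases i) (use E E_Suc_E_power_of_E[OF KD(2) wF wH E] in auto)
  have Pc: "P i c \<in> K" for i
  proof (cases i)
    case 0
    have "2 *s P 0 c \<in> K"
      using PP[of 0 0 "(E 0 ^^ k) w"] subspace_scale[OF KD(1) Ei[of 0], of 2]
      by (simp add: c_def scale_two)
    from subspace_scale[OF KD(1) this, of "1/2"] show ?thesis by (simp add: 0)
  next
    case (Suc j)
    have "P i c = 2 *s E i ((E 0 ^^ k) w) - P 0 (P i ((E 0 ^^ k) w))"
      using PP[of i 0 "(E 0 ^^ k) w"] by (simp add: c_def algebra_simps)
    thus ?thesis
      using KD(1) KD(7)[OF P_Suc[of j], of 0] Ei[of i] Suc
      by (auto intro: subspace_diff subspace_scale)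
  qed
  have Ec: "E i c \<in> K" for i
    by (rule E_in_K_of_P[OF K KD(7)[OF Pc] Pc])
  have Hc: "H i c \<in> K" for i
  proof -
    have "H i ((E 0 ^^ k) w) \<in> K"
      by (cases k) (use wH H_E_power_in_K[OF KD(2) wF wH] E in auto)
    hence "P 0 (H i ((E 0 ^^ k) w)) \<in> K" by (rule KD(7))
    thus ?thesis
      using HP[of i 0 "(E 0 ^^ k) w"] P_Suc[of i] KD(1) by (simp add: c_def subspace_add)
  qed
  show ?thesis using Pc Ec Hc by (simp add: upper_def c_def)
qed

text \<open>The even conditions are mirror images obtained from \<open>swap\<close>; the odd one
  follows by applying \<open>P i\<close> to the hypothesis and comparing with
  \<open>P_F_power\<close>.\<close>

lemma lower_F_power:
  assumes K: "osp_stable K" and b: "upper K b" and F: "(F 0 ^^ Suc (Suc k)) b \<in> K"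
  shows "lower K ((F 0 ^^ Suc k) b)"
proof -
  note KD = osp_stableD[OF K]
  have bE: "\<And>i. E i b \<in> K" and bH: "\<And>i. - H i b \<in> K"
    using b KD(1) by (auto simp: upper_def intro: subspace_neg)
  have "F i ((F 0 ^^ Suc k) b) \<in> K" for i
    by (cases i) (use F swap.E_Suc_E_power_of_E[OF KD(3) bE bH F] in auto)
  moreover have "H i ((F 0 ^^ Suc k) b) \<in> K" for i
    using swap.H_E_power_in_K[OF KD(3) bE bH F, of i] KD(1) subspace_neg by fastforce
  moreover have "N i ((F 0 ^^ Suc k) b) \<in> K" for i
  proof -
    have "of_nat (Suc (Suc k)) *s N i ((F 0 ^^ Suc k) b) \<in> K"
      by (rule diff_cancel[OF KD(1) P_F_power[OF K b] KD(7)[OF F]])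
    thus ?thesis by (rule swap.cancel_K[OF KD(3) bE bH, rotated]) (rule of_nat_neq_0)
  qed
  ultimately show ?thesis by (simp add: lower_def)
qed

lemma lower_mono: "lower K w \<Longrightarrow> K \<subseteq> K' \<Longrightarrow> lower K' w"
  by (auto simp: lower_def)

lemma upper_mono: "upper K w \<Longrightarrow> K \<subseteq> K' \<Longrightarrow> upper K' w"
  by (auto simp: upper_def)

text \<open>Let \<open>a n\<close> and \<open>b n\<close> be the bounds for the two claims, and
  \<open>c n\<close> the bound for a \<open>lower\<close> vector with only
  \<open>E 0 ^^ Suc n\<close> in \<open>K\<close>. Splitting off an extremal vector gives
  \<open>c n = b n + a n\<close>, \<open>a (n+1) = b n + c n\<close> and
  \<open>b (n+1) = c n + b n\<close>. With \<open>a 0 = b 0 = 1\<close> this means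
  \<open>a n = b n = 3^n\<close> and \<open>c n = 2 * 3^n\<close>.\<close>

lemma spans_lower_upper:
  assumes "osp_stable K"
  shows "(lower K w \<longrightarrow> P 0 ((E 0 ^^ n) w) \<in> K \<longrightarrow> spans K (3 ^ n) w) \<and>
    (upper K b \<longrightarrow> (F 0 ^^ Suc n) b \<in> K \<longrightarrow> spans K (3 ^ n) b)"
  using assms
proof (induction n arbitrary: K w b)
  case 0
  thus ?case using spans_lower_0 spans_upper_0 by auto
next
  case (Suc n)
  have lower_even: "spans K (3 ^ n) w"
    if "osp_stable K" "lower K w" "P 0 ((E 0 ^^ n) w) \<in> K" for K w
    using Suc.IH[OF that(1)] that(2,3) by blast
  have upper: "spans K (3 ^ n) b"
    if "osp_stable K" "upper K b" "(F 0 ^^ Suc n) b \<in> K" for K b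
    using Suc.IH[OF that(1)] that(2,3) by blast
  \<comment> \<open>The intermediate relation: modulo the extremal vector
    \<open>P 0 ((E 0 ^^ n) w)\<close> it becomes the first claim for \<open>n\<close>.\<close>
  have lower_odd: "spans K (3 ^ n + 3 ^ n) w"
    if K: "osp_stable K" and w: "lower K w" and E: "(E 0 ^^ Suc n) w \<in> K" for K w
  proof (rule spans_trans)
    note KD = osp_stableD[OF K]
    have wF: "\<And>i. F i w \<in> K" and wH: "\<And>i. H i w \<in> K" using w by (auto simp: lower_def)
    have F1: "P 0 ((F 0 ^^ Suc n) ((E 0 ^^ n) w)) \<in> K"
      using F_power_Suc_E_power[OF KD(2) wF wH] KD(7) by blast
    have F2: "N 0 ((F 0 ^^ n) ((E 0 ^^ n) w)) \<in> K"
    proof (cases "n = 0")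
      case True
      thus ?thesis using w by (simp add: lower_def)
    next
      case False
      thus ?thesis using F_power_E_power[OF KD(2) wF wH, of n] KD(8) by simp
    qed
    have "(F 0 ^^ Suc n) (P 0 ((E 0 ^^ n) w)) \<in> K"
      unfolding F_0_P_0 using F1 F2 KD(1) by (intro subspace_diff subspace_scale)
    thus "spans K (3 ^ n) (P 0 ((E 0 ^^ n) w))"
      by (intro upper K upper_P_E_power w E)
    show "spans K' (3 ^ n) w" if "osp_stable K'" "K \<subseteq> K'" "P 0 ((E 0 ^^ n) w) \<in> K'" for K'
      using that by (intro lower_even lower_mono[OF w])
  qed
  note K = Suc.prems
  note KD = osp_stableD[OF K]
  have pow: "(3::nat) ^ Suc n = 3 ^ n + (3 ^ n + 3 ^ n)" by simp
  show ?case
  proof (intro conjI impI)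
    assume w: "lower K w" and E: "P 0 ((E 0 ^^ Suc n) w) \<in> K"
    have wF: "\<And>i. F i w \<in> K" and wH: "\<And>i. H i w \<in> K" using w by (auto simp: lower_def)
    show "spans K (3 ^ Suc n) w"
      unfolding pow
    proof (rule spans_trans)
      \<comment> \<open>The top power is split off; modulo it, \<open>w\<close> satisfies the weaker
        relation of \<open>lower_odd\<close>.\<close>
      show "spans K (3 ^ n) ((E 0 ^^ Suc n) w)"
        by (rule upper[OF K upper_E_power[OF K w E] F_power_E_power[OF KD(2) wF wH]]) simp
    qed (use lower_odd lower_mono[OF w] in blast)
  next
    assume b: "upper K b" and F: "(F 0 ^^ Suc (Suc n)) b \<in> K"
    have bE: "\<And>i. E i b \<in> K" and bH: "\<And>i. - H i b \<in> K"
      using b KD(1) by (auto simp: upper_def intro: subspace_neg)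
    show "spans K (3 ^ Suc n) b"
      unfolding pow add.commute[of "3 ^ n" "3 ^ n + 3 ^ n"]
    proof (rule spans_trans)
      \<comment> \<open>Here the extremal vector is of the other kind, \<open>lower\<close>; modulo
        it, \<open>b\<close> satisfies the second claim for \<open>n\<close>.\<close>
      show "spans K (3 ^ n + 3 ^ n) ((F 0 ^^ Suc n) b)"
        by (rule lower_odd[OF K lower_F_power[OF K b F] swap.F_power_E_power[OF KD(3) bE bH]]) simp
    qed (use upper upper_mono[OF b] in blast)
  qed
qed

end

section \<open>Projections in place of quotient spaces\<close>

context vector_space
begin

text \<open>The image of \<open>\<pi>\<close> models the quotient by \<open>K\<close> inside the
  same type. A basis of \<open>K\<close> is extended to one of the space; \<open>\<pi>\<close> kills
  the former and fixes the added vectors.\<close>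

lemma exists_projection_along:
  assumes K: "subspace K"
  shows "\<exists>\<pi>. (\<forall>x y. \<pi> (x + y) = \<pi> x + \<pi> y) \<and> (\<forall>c x. \<pi> (scale c x) = scale c (\<pi> x)) \<and>
    (\<forall>x. \<pi> x = 0 \<longleftrightarrow> x \<in> K) \<and> (\<forall>x. x - \<pi> x \<in> K)"
proof -
  interpret pair: vector_space_pair scale scale ..
  obtain B where B: "B \<subseteq> K" "independent B" "K \<subseteq> span B"
    by (rule maximal_independent_subset[of K])
  obtain C where C: "B \<subseteq> C" "independent C" "UNIV \<subseteq> span C"
    by (rule maximal_independent_subset_extend[OF subset_UNIV B(2)])
  obtain \<pi> where \<pi>: "Vector_Spaces.linear scale scale \<pi>" "\<forall>x\<in>C. \<pi> x = (if x \<in> B then 0 else x)"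
    using pair.linear_independent_extend[OF C(2), of "\<lambda>x. if x \<in> B then 0 else x"] by blast
  have add: "\<pi> (x + y) = \<pi> x + \<pi> y" and sc: "\<pi> (scale c x) = scale c (\<pi> x)" for x y c
    using \<pi>(1) by (simp_all add: Vector_Spaces.linear_def module_hom_axioms_def module_hom_def)
  have diff: "x - \<pi> x \<in> K" for x
  proof -
    have "x \<in> span C" using C(3) by blast
    thus ?thesis
    proof (induction rule: span_induct_alt)
      case base
      show ?case using sc[of 0 0] K by (simp add: subspace_0)
    next
      case (step c x y)
      have "x - \<pi> x \<in> K" using \<pi>(2) step(1) B(1) K by (auto simp: subspace_0)
      hence "scale c (x - \<pi> x) + (y - \<pi> y) \<in> K"
        using step(2) K by (intro subspace_add subspace_scale)
      thus ?case by (simp add: add sc algebra_simps)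
    qed
  qed
  have "\<pi> x = 0" if "x \<in> K" for x
  proof -
    have "x \<in> span B" using that B(3) by blast
    thus ?thesis
    proof (induction rule: span_induct_alt)
      case base
      show ?case using sc[of 0 0] by simp
    next
      case (step c x y)
      thus ?case using \<pi>(2) C(1) by (auto simp: add sc)
    qed
  qed
  hence "\<pi> x = 0 \<longleftrightarrow> x \<in> K" for x using diff[of x] by auto
  thus ?thesis using add sc diff by blast
qed

end

section \<open>The free algebra and cyclic modules\<close>

lemma of_word_append: "of_word (xs @ ys) = of_word xs * of_word ys"
  by (simp add: of_word_def mult_single plus_word_def)

lemma gen_mult_of_word: "gen y * of_word ys = of_word (y # ys)"
  by (simp flip: of_word_append)

lemma of_word_Nil: "of_word [] = 1"
  by (simp add: of_word_def flip: zero_word_def)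

lemma poly_mapping_single_induct [case_names single sum]:
  fixes a :: "'a \<Rightarrow>\<^sub>0 'b::comm_monoid_add"
  assumes single: "\<And>k c. P (Poly_Mapping.single k c)" and add: "\<And>a b. P a \<Longrightarrow> P b \<Longrightarrow> P (a + b)"
  shows "P a"
proof -
  have "P (\<Sum>k\<in>A. Poly_Mapping.single k (Poly_Mapping.lookup a k))" for A
    by (induction A rule: infinite_finite_induct) (use single[of undefined 0] in \<open>auto intro: assms\<close>)
  moreover have decomp: "(\<Sum>k\<in>Poly_Mapping.keys a. Poly_Mapping.single k (Poly_Mapping.lookup a k)) = a"
    by (rule poly_mapping_eqI) (auto simp: lookup_sum lookup_single when_def in_keys_iff)
  ultimately show ?thesis
    by metis
qed

lemma single_zero_mult_commute: "Poly_Mapping.single 0 (c::complex) * a = a * Poly_Mapping.single (0::'a word) c"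
  by (induction a rule: poly_mapping_single_induct) (auto simp: mult_single algebra_simps)

lemma fa_scale_mult_left: "fa_scale c a * b = fa_scale c (a * b)"
  by (simp add: fa_scale_def mult.assoc)

lemma fa_scale_mult_right: "a * fa_scale c b = fa_scale c (a * b)"
  unfolding fa_scale_def by (metis single_zero_mult_commute mult.assoc)

lemma fa_scale_of_word: "fa_scale c (of_word ys) = Poly_Mapping.single (Word ys) c"
  by (simp add: fa_scale_def of_word_def mult_single)

lemma free_alg_induct [case_names zero word add]:
  assumes "P 0" and "\<And>c ys a. P a \<Longrightarrow> P (fa_scale c (of_word ys) + a)"
  shows "P a"
proof -
  have "a \<in> free_alg.span (range of_word)"
  proof (induction a rule: poly_mapping_single_induct)
    case (single k c)
    obtain ys where "k = Word ys" by (cases k)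
    moreover have "fa_scale c (of_word ys) \<in> free_alg.span (range of_word)"
      by (intro free_alg.span_scale free_alg.span_base) simp
    ultimately show ?case by (simp add: fa_scale_of_word)
  next
    case (sum a b)
    thus ?case by (intro free_alg.span_add)
  qed
  thus ?thesis
    by (induction rule: free_alg.span_induct_alt) (use assms in auto)
qed

lemma subspace_cyclic_ker: "free_alg.subspace (cyclic_ker R)"
  unfolding cyclic_ker_def by (rule free_alg.subspace_span)

lemma cyclic_ker_left_mult:
  assumes "x \<in> cyclic_ker R"
  shows "a * x \<in> cyclic_ker R"
  using assms unfolding cyclic_ker_def
proof (induction rule: free_alg.span_induct_alt)
  case base
  show ?case by (simp add: free_alg.span_zero)
next
  case (step c x y)
  have "a * x \<in> {a * r * b |a r b. r \<in> env_relations} \<union> {a * r |a r. r \<in> R}"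
    using step(1) by (elim UnE CollectE exE conjE; simp only: mult.assoc[symmetric]) blast+
  hence "fa_scale c (a * x) + a * y \<in>
      free_alg.span ({a * r * b |a r b. r \<in> env_relations} \<union> {a * r |a r. r \<in> R})"
    by (rule free_alg.span_add[OF free_alg.span_scale[OF free_alg.span_base] step(2)])
  thus ?case by (simp add: distrib_left fa_scale_mult_right)
qed

lemma cyclic_ker_env: "r \<in> env_relations \<Longrightarrow> r * b \<in> cyclic_ker R"
  unfolding cyclic_ker_def
  by (rule free_alg.span_base, rule UnI1) (metis (mono_tags, lifting) mem_Collect_eq mult_1_left)

lemma cyclic_ker_relation: "r \<in> R \<Longrightarrow> r \<in> cyclic_ker R"
  unfolding cyclic_ker_def
  by (rule free_alg.span_base, rule UnI2) (metis (mono_tags, lifting) mem_Collect_eq mult_1_left)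

lemma gen_mult_fa_part:
  assumes "hcomp p y = y" "a \<in> fa_part q"
  shows "gen y * a \<in> fa_part (p + q)"
  using assms(2) unfolding fa_part_def
proof (induction rule: free_alg.span_induct_alt)
  case base
  show ?case by (simp add: free_alg.span_zero)
next
  case (step c x z)
  obtain ys ps where "x = of_word ys" "list_all2 (\<lambda>y q. hcomp q y = y) ys ps" "sum_list ps = q"
    using step(1) by auto
  hence "gen y * x = of_word (y # ys)" "list_all2 (\<lambda>y q. hcomp q y = y) (y # ys) (p # ps)"
    "sum_list (p # ps) = p + q"
    using assms(1) by (simp_all add: gen_mult_of_word)
  hence "gen y * x \<in> {of_word ys |ys ps. list_all2 (\<lambda>y q. hcomp q y = y) ys ps \<and> sum_list ps = p + q}"
    by blast
  hence "fa_scale c (gen y * x) + gen y * z \<in> free_alg.span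
      {of_word ys |ys ps. list_all2 (\<lambda>y q. hcomp q y = y) ys ps \<and> sum_list ps = p + q}"
    by (rule free_alg.span_add[OF free_alg.span_scale[OF free_alg.span_base] step(2)])
  thus ?case by (simp only: distrib_left fa_scale_mult_right)
qed

lemma subspace_fa_part: "free_alg.subspace (fa_part p)"
  unfolding fa_part_def by (rule free_alg.subspace_span)

text \<open>Letters may be inhomogeneous elements of the superalgebra, so the two parts span only
  modulo the relations: each letter is replaced by the sum of its homogeneous components.\<close>

lemma fa_homogeneous_decomp:
  "\<exists>a0\<in>fa_part 0. \<exists>a1\<in>fa_part 1. a - a0 - a1 \<in> cyclic_ker R"
proof -
  note K = subspace_cyclic_ker[of R]
  note sub = free_alg.subspace_add free_alg.subspace_scale free_alg.subspace_0
  have word_decomp: "\<exists>a0\<in>fa_part 0. \<exists>a1\<in>fa_part 1. of_word ys - a0 - a1 \<in> cyclic_ker R" for ys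
  proof (induction ys)
    case Nil
    have "of_word [] \<in> fa_part 0"
      unfolding fa_part_def by (intro free_alg.span_base) force
    thus ?case by (intro bexI[of _ "of_word []"] bexI[of _ 0]) (auto simp: sub K subspace_fa_part)
  next
    case (Cons y ys)
    then obtain a0 a1 where a: "a0 \<in> fa_part 0" "a1 \<in> fa_part 1"
      and k: "of_word ys - a0 - a1 \<in> cyclic_ker R" by blast
    define y0 y1 where "y0 = hcomp 0 y" and "y1 = hcomp 1 y"
    have y: "hcomp 0 y0 = y0" "hcomp 1 y1 = y1" "y0 + y1 = y"
      by (simp_all add: y0_def y1_def hcomp_hcomp hcomp_decomp)
    have "gen (y0 + y1) - gen y0 - gen y1 \<in> env_relations"
      unfolding env_relations_def by blast
    \<comment> \<open>Expanded, this is the longer word minus the four products of a component of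
      \<open>y\<close> with \<open>a0\<close> or \<open>a1\<close>.\<close>
    hence "(gen y - gen y0 - gen y1) * (a0 + a1) + gen y * (of_word ys - a0 - a1) \<in> cyclic_ker R"
      by (intro free_alg.subspace_add[OF K] cyclic_ker_env cyclic_ker_left_mult[OF k]) (simp only: y)
    moreover have "gen y0 * a0 + gen y1 * a1 \<in> fa_part 0"
      using gen_mult_fa_part[OF y(1) a(1)] gen_mult_fa_part[OF y(2) a(2)]
      by (intro free_alg.subspace_add subspace_fa_part) simp_all
    moreover have "gen y0 * a1 + gen y1 * a0 \<in> fa_part 1"
      using gen_mult_fa_part[OF y(1) a(2)] gen_mult_fa_part[OF y(2) a(1)]
      by (intro free_alg.subspace_add subspace_fa_part) simp_all
    ultimately show ?case
      by (intro bexI[of _ "gen y0 * a0 + gen y1 * a1"] bexI[of _ "gen y0 * a1 + gen y1 * a0"])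
        (auto simp: algebra_simps gen_mult_of_word[of y ys, symmetric])
  qed
  show ?thesis
  proof (induction a rule: free_alg_induct)
    case zero
    show ?case by (intro bexI[of _ 0]) (auto simp: sub K subspace_fa_part)
  next
    case (word c ys a)
    obtain a0 a1 where a: "a0 \<in> fa_part 0" "a1 \<in> fa_part 1" "a - a0 - a1 \<in> cyclic_ker R"
      using word by blast
    obtain b0 b1 where b: "b0 \<in> fa_part 0" "b1 \<in> fa_part 1" "of_word ys - b0 - b1 \<in> cyclic_ker R"
      using word_decomp[of ys] by blast
    have "fa_scale c (of_word ys - b0 - b1) + (a - a0 - a1) \<in> cyclic_ker R"
      using a b by (intro free_alg.subspace_add[OF K] free_alg.subspace_scale[OF K])
    thus ?case
      using a b subspace_fa_part
      by (intro bexI[of _ "fa_scale c b0 + a0"] bexI[of _ "fa_scale c b1 + a1"])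
        (auto simp: algebra_simps free_alg.scale_right_diff_distrib
          intro!: free_alg.subspace_add free_alg.subspace_scale)
  qed
qed

section \<open>Representations\<close>

text \<open>Only the operator identities of a module, on a whole type; carriers and parities of
  vectors are treated separately.\<close>

locale super_rep = vector_space scale
  for scale :: "complex \<Rightarrow> 'v::ab_group_add \<Rightarrow> 'v" (infixr \<open>*s\<close> 75) +
  fixes op :: "'g::lie_superalgebra \<Rightarrow> 'v \<Rightarrow> 'v"
  assumes op_add_right: "op y (u + v) = op y u + op y v"
    and op_scale_right: "op y (c *s u) = c *s op y u"
    and op_add_left: "op (x + y) u = op x u + op y u"
    and op_scale_left: "op (c *\<^sub>C y) u = c *s op y u"
    and op_lbr: "hcomp p x = x \<Longrightarrow> hcomp q y = y \<Longrightarrow>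
      op (lbr x y) u = op x (op y u) - ksign (p * q) *s op y (op x u)"
begin

lemma op_zero_right [simp]: "op y 0 = 0"
  using op_scale_right[of y 0 0] by simp

lemma op_zero_left [simp]: "op 0 u = 0"
  using op_scale_left[of 0 0 u] by simp

lemma op_minus_left: "op (- y) u = - op y u"
  using op_add_left[of y "- y" u] by (simp add: eq_neg_iff_add_eq_0 add.commute)

lemma op_minus_right: "op y (- u) = - op y u"
  using op_scale_right[of y "-1" u] by simp

lemma foldr_op_zero [simp]: "foldr op ys 0 = 0"
  by (induction ys) auto

definition word_act :: "'g free_alg \<Rightarrow> 'v \<Rightarrow> 'v" where
  "word_act a u = (\<Sum>w\<in>Poly_Mapping.keys a. Poly_Mapping.lookup a w *s foldr op (letters w) u)"

lemma word_act_eq: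
  assumes "finite A" "Poly_Mapping.keys a \<subseteq> A"
  shows "word_act a u = (\<Sum>w\<in>A. Poly_Mapping.lookup a w *s foldr op (letters w) u)"
  unfolding word_act_def using assms
  by (intro sum.mono_neutral_left) (auto simp: in_keys_iff)

lemma word_act_add: "word_act (a + b) u = word_act a u + word_act b u"
proof -
  define A where "A = Poly_Mapping.keys a \<union> Poly_Mapping.keys b"
  have "finite A" "Poly_Mapping.keys (a + b) \<subseteq> A" "Poly_Mapping.keys a \<subseteq> A" "Poly_Mapping.keys b \<subseteq> A"
    using Poly_Mapping.keys_add[of a b] by (auto simp: A_def)
  thus ?thesis
    by (simp add: word_act_eq[of A] lookup_add scale_left_distrib sum.distrib)
qed

lemma word_act_single: "word_act (Poly_Mapping.single (Word ys) c) u = c *s foldr op ys u"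
  by (subst word_act_eq[of "{Word ys}"]) auto

lemma word_act_of_word: "word_act (of_word ys) u = foldr op ys u"
  by (simp add: of_word_def word_act_single)

lemma word_act_zero [simp]: "word_act 0 u = 0"
  by (simp add: word_act_def)

lemma word_act_minus: "word_act (- a) u = - word_act a u"
  using word_act_add[of a "- a" u] by (simp add: eq_neg_iff_add_eq_0 add.commute)

lemma word_act_diff: "word_act (a - b) u = word_act a u - word_act b u"
  using word_act_add[of a "- b" u] by (simp add: word_act_minus)

lemma foldr_op_add: "foldr op ys (u + v) = foldr op ys u + foldr op ys v"
  by (induction ys) (auto simp: op_add_right)

lemma foldr_op_scale: "foldr op ys (c *s u) = c *s foldr op ys u"
  by (induction ys) (auto simp: op_scale_right)

lemma word_act_zero_right [simp]: "word_act a 0 = 0"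
  by (simp add: word_act_def)

lemma word_act_scaled_word_mult:
  "word_act (fa_scale c (of_word ys) * b) u = c *s foldr op ys (word_act b u)"
proof (induction b rule: free_alg_induct)
  case (word d zs b)
  have "fa_scale c (of_word ys) * (fa_scale d (of_word zs) + b) =
    Poly_Mapping.single (Word (ys @ zs)) (c * d) + fa_scale c (of_word ys) * b"
    by (simp add: distrib_left fa_scale_of_word mult_single plus_word_def)
  thus ?case
    using word[unfolded fa_scale_of_word]
    by (simp add: word_act_add word_act_single fa_scale_of_word foldr_op_add foldr_op_scale
        scale_right_distrib)
qed simp

lemma word_act_mult: "word_act (a * b) u = word_act a (word_act b u)"
proof (induction a rule: free_alg_induct)
  case (word c ys a)
  thus ?case
    by (simp add: distrib_right word_act_add word_act_scaled_word_mult)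
      (simp add: fa_scale_of_word word_act_single)
qed simp

lemma word_act_scale: "word_act (fa_scale c a) u = c *s word_act a u"
  using word_act_scaled_word_mult[of c "[]" a u] by (simp add: of_word_Nil fa_scale_mult_left)

lemma word_act_one [simp]: "word_act 1 u = u"
  using word_act_of_word[of "[]" u] by (simp add: of_word_Nil)

lemma word_act_env:
  assumes "r \<in> env_relations"
  shows "word_act r u = 0"
  using assms unfolding env_relations_def
  by (auto simp: word_act_diff word_act_scale word_act_mult word_act_of_word op_add_left op_scale_left
      op_lbr)

text \<open>The universal property: a vector satisfying the relations receives a map from the cyclic
  module.\<close>

lemma word_act_cyclic_ker:
  assumes R: "\<And>r. r \<in> R \<Longrightarrow> word_act r v = 0" and a: "a \<in> cyclic_ker R"
  shows "word_act a v = 0"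
  using a unfolding cyclic_ker_def
  by (induction rule: free_alg.span_induct_alt)
    (auto simp: word_act_add word_act_scale word_act_mult word_act_env R)

end

section \<open>Representations of the current algebra\<close>

lemma hcomp_monom: "hcomp p (monom (a::'a::lie_superalgebra) i) = monom (hcomp p a) i"
  by (rule poly_eqI) (simp add: coeff_hcomp)

lemma osp12_parity:
  "hcomp 0 osp_e = osp_e" "hcomp 0 osp_h = osp_h" "hcomp 0 osp_f = osp_f"
  "hcomp 1 osp_gp = osp_gp" "hcomp 1 osp_gm = osp_gm"
  by (simp_all add: osp12_defs osp12_basis_defs)

lemma osp12_expand:
  "x = co_e x *\<^sub>C osp_e + co_h x *\<^sub>C osp_h + co_f x *\<^sub>C osp_f + co_gp x *\<^sub>C osp_gp + co_gm x *\<^sub>C osp_gm"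
  by (cases x) (simp add: osp12_defs osp12_basis_defs)

lemma n_minusI [intro, simp]: "osp_f \<in> n_minus" "osp_gm \<in> n_minus"
  unfolding n_minus_def
  by (auto simp: osp12_defs osp12_basis_defs intro: exI[of _ 1] exI[of _ 0])

locale osp_current_rep = super_rep scale op
  for scale :: "complex \<Rightarrow> 'v::ab_group_add \<Rightarrow> 'v" (infixr \<open>*s\<close> 75)
    and op :: "osp12 poly \<Rightarrow> 'v \<Rightarrow> 'v"
begin

lemma op_monom_lbr:
  assumes "hcomp p a = a" "hcomp q b = b"
  shows "op (monom a i) (op (monom b j) u) =
    ksign (p * q) *s op (monom b j) (op (monom a i) u) + op (monom (lbr a b) (i + j)) u"
  using op_lbr[of p "monom a i" q "monom b j" u] assms by (simp add: lbr_monom hcomp_monom)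

lemma op_monom_scaleC: "op (monom (c *\<^sub>C a) i) u = c *s op (monom a i) u"
  by (simp add: op_scale_left flip: scaleC_monom)

lemma op_monom_uminus: "op (monom (- a) i) u = - op (monom a i) u"
  by (simp add: op_minus_left flip: minus_monom)

lemma osp12_brackets': "lbr osp_e osp_e = 0" "lbr osp_f osp_f = 0" "lbr osp_gm osp_f = 0"
    "lbr osp_gm osp_e = osp_gp" "lbr osp_gp osp_f = osp_gm"
  by (simp_all add: osp12_defs osp12_basis_defs)

text \<open>Restriction to the subalgebra without \<open>h\<close>, \<open>f\<close>,
  \<open>g^-\<close> in degree 0; this is the origin of the shifted indices.\<close>

sublocale iw: current_osp scale "\<lambda>i. op (monom osp_e i)" "\<lambda>i. op (monom osp_h (Suc i))"
  "\<lambda>i. op (monom osp_f (Suc i))" "\<lambda>i. op (monom osp_gp i)" "\<lambda>i. op (monom osp_gm (Suc i))"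
proof unfold_locales
  note s = osp12_brackets osp12_brackets' op_monom_scaleC op_monom_uminus ksign_def scale_minus_left
  fix i j :: nat and x
  show "op (monom osp_e i) (op (monom osp_e j) x) = op (monom osp_e j) (op (monom osp_e i) x)"
    using op_monom_lbr[OF osp12_parity(1,1)] by (simp add: s)
  show "op (monom osp_f (Suc i)) (op (monom osp_f (Suc j)) x) =
    op (monom osp_f (Suc j)) (op (monom osp_f (Suc i)) x)"
    using op_monom_lbr[OF osp12_parity(3,3)] by (simp add: s)
  show "op (monom osp_h (Suc i)) (op (monom osp_e j) x) =
    op (monom osp_e j) (op (monom osp_h (Suc i)) x) + 2 *s op (monom osp_e (Suc (i + j))) x"
    using op_monom_lbr[OF osp12_parity(2,1), of "Suc i" j x] by (simp add: s)
  show "op (monom osp_h (Suc i)) (op (monom osp_f (Suc j)) x) =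
    op (monom osp_f (Suc j)) (op (monom osp_h (Suc i)) x) - 2 *s op (monom osp_f (Suc (Suc (i + j)))) x"
    using op_monom_lbr[OF osp12_parity(2,3), of "Suc i" "Suc j" x] by (simp add: s)
  show "op (monom osp_e i) (op (monom osp_f (Suc j)) x) =
    op (monom osp_f (Suc j)) (op (monom osp_e i) x) + op (monom osp_h (Suc (i + j))) x"
    using op_monom_lbr[OF osp12_parity(1,3), of i "Suc j" x] by (simp add: s)
  show "op (monom osp_e i) (op (monom osp_gp j) x) = op (monom osp_gp j) (op (monom osp_e i) x)"
    using op_monom_lbr[OF osp12_parity(1,4), of i j x] by (simp add: s)
  show "op (monom osp_gp i) (op (monom osp_gp j) x) + op (monom osp_gp j) (op (monom osp_gp i) x) =
    2 *s op (monom osp_e (i + j)) x"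
    using op_monom_lbr[OF osp12_parity(4,4), of i j x] by (simp add: s)
  show "op (monom osp_h (Suc i)) (op (monom osp_gp j) x) =
    op (monom osp_gp j) (op (monom osp_h (Suc i)) x) + op (monom osp_gp (Suc (i + j))) x"
    using op_monom_lbr[OF osp12_parity(2,4), of "Suc i" j x] by (simp add: s)
  show "op (monom osp_e i) (op (monom osp_gm (Suc j)) x) =
    op (monom osp_gm (Suc j)) (op (monom osp_e i) x) - op (monom osp_gp (Suc (i + j))) x"
    using op_monom_lbr[OF osp12_parity(1,5), of i "Suc j" x] by (simp add: s)
  show "op (monom osp_gp i) (op (monom osp_f (Suc j)) x) =
    op (monom osp_f (Suc j)) (op (monom osp_gp i) x) + op (monom osp_gm (Suc (i + j))) x"
    using op_monom_lbr[OF osp12_parity(4,3), of i "Suc j" x] by (simp add: s)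
  show "op (monom osp_f (Suc i)) (op (monom osp_gm (Suc j)) x) =
    op (monom osp_gm (Suc j)) (op (monom osp_f (Suc i)) x)"
    using op_monom_lbr[OF osp12_parity(3,5), of "Suc i" "Suc j" x] by (simp add: s)
  show "op (monom osp_gm (Suc i)) (op (monom osp_gm (Suc j)) x) +
      op (monom osp_gm (Suc j)) (op (monom osp_gm (Suc i)) x) =
    - (2 *s op (monom osp_f (Suc (Suc (i + j)))) x)"
    using op_monom_lbr[OF osp12_parity(5,5), of "Suc i" "Suc j" x] by (simp add: s)
qed (simp_all add: op_add_right op_scale_right)

text \<open>Sharpens the last Weyl relation: together with \<open>e_0^(n+1) w = 0\<close> it forces
  \<open>g^+_0 e_0^n w = 0\<close>. Without this the recursion would only give the bound
  \<open>2 * 3^n\<close>.\<close>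

lemma gm_e_power:
  assumes "op (monom osp_gm 0) w = 0"
  shows "op (monom osp_gm 0) ((op (monom osp_e 0) ^^ Suc k) w) =
    of_nat (Suc k) *s op (monom osp_gp 0) ((op (monom osp_e 0) ^^ k) w)"
proof (induction k)
  case 0
  show ?case
    using op_monom_lbr[OF osp12_parity(5,1), of 0 0 w] assms by (simp add: osp12_brackets' ksign_def)
next
  case (Suc k)
  define a where "a = (op (monom osp_e 0) ^^ k) w"
  have "op (monom osp_gm 0) (op (monom osp_e 0) (op (monom osp_e 0) a)) =
    op (monom osp_e 0) (op (monom osp_gm 0) (op (monom osp_e 0) a)) + op (monom osp_gp 0) (op (monom osp_e 0) a)"
    using op_monom_lbr[OF osp12_parity(5,1), of 0 0 "op (monom osp_e 0) a"]
    by (simp add: osp12_brackets' ksign_def)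
  thus ?case
    using Suc iw.EP[of 0 0 a]
    by (simp add: a_def[symmetric] op_add_right op_scale_right scale_left_distrib iw.scale_two)
qed

definition n_plus_words :: "'v \<Rightarrow> 'v set" where
  "n_plus_words w =
    span {foldr op ys w |ys. set ys \<subseteq> range (monom osp_e) \<union> range (monom osp_gp)}"

lemma op_n_plus_words:
  assumes "x \<in> range (monom osp_e) \<union> range (monom osp_gp)" and "u \<in> n_plus_words w"
  shows "op x u \<in> n_plus_words w"
  using assms(2) unfolding n_plus_words_def
proof (induction rule: span_induct_alt)
  case base
  show ?case by (simp add: span_zero)
next
  case (step c u v)
  obtain ys where "u = foldr op ys w" "set ys \<subseteq> range (monom osp_e) \<union> range (monom osp_gp)"
    using step(1) by auto
  hence "op x u = foldr op (x # ys) w" "set (x # ys) \<subseteq> range (monom osp_e) \<union> range (monom osp_gp)"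
    using assms(1) by auto
  hence "op x u \<in> {foldr op ys w |ys. set ys \<subseteq> range (monom osp_e) \<union> range (monom osp_gp)}"
    by blast
  from span_add[OF span_scale[OF span_base[OF this]] step(2)] show ?case
    by (simp only: op_add_right op_scale_right)
qed

text \<open>A PBW argument: a generator outside \<open>\<nn>\<^sup>+[t]\<close> is moved to the right of the word.\<close>

lemma op_n_plus_word:
  assumes w: "\<And>y. op y w \<in> n_plus_words w"
  shows "set ys \<subseteq> range (monom osp_e) \<union> range (monom osp_gp) \<Longrightarrow>
    op y (foldr op ys w) \<in> n_plus_words w"
proof (induction ys arbitrary: y)
  case Nil
  show ?case by (simp add: w)
next
  case (Cons x ys)
  define u where "u = foldr op ys w"
  have IH: "op y u \<in> n_plus_words w" for y
    using Cons by (simp add: u_def)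
  have sub: "subspace (n_plus_words w)"
    by (simp add: n_plus_words_def)
  have x: "x \<in> range (monom osp_e) \<union> range (monom osp_gp)" using Cons.prems by simp
  then obtain q where q: "hcomp q x = x"
    by (auto simp: hcomp_monom osp12_parity) (metis hcomp_monom osp12_parity)+
  have homog: "op z (op x u) \<in> n_plus_words w" if z: "hcomp p z = z" for p z
  proof -
    have "op z (op x u) = op (lbr z x) u + ksign (p * q) *s op x (op z u)"
      using op_lbr[OF z q, of u] by simp
    thus ?thesis
      using op_n_plus_words[OF x IH[of z]] IH[of "lbr z x"] sub
      by (simp add: subspace_add subspace_scale)
  qed
  \<comment> \<open>The supercommutation rule is available for homogeneous elements only, so
    \<open>y\<close> is split by parity.\<close>
  have "op y (op x u) = op (hcomp 0 y) (op x u) + op (hcomp 1 y) (op x u)"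
    by (simp add: hcomp_decomp flip: op_add_left)
  moreover have "op (hcomp p y) (op x u) \<in> n_plus_words w" for p
    by (rule homog[of p]) (simp add: hcomp_hcomp)
  ultimately show ?case using sub by (simp add: u_def subspace_add)
qed

lemma word_act_n_plus_words:
  assumes w: "\<And>y. op y w \<in> n_plus_words w"
  shows "word_act a w \<in> n_plus_words w"
proof -
  have sub: "subspace (n_plus_words w)"
    by (simp add: n_plus_words_def)
  have stable: "op y u \<in> n_plus_words w" if "u \<in> n_plus_words w" for y u
    using that unfolding n_plus_words_def
  proof (induction rule: span_induct_alt)
    case base
    show ?case by (simp add: span_zero)
  next
    case (step c u v)
    then obtain ys where "u = foldr op ys w" "set ys \<subseteq> range (monom osp_e) \<union> range (monom osp_gp)"
      by auto
    hence "op y u \<in> n_plus_words w" using op_n_plus_word[OF w] by simp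
    thus ?case
      using step(2) unfolding op_add_right op_scale_right n_plus_words_def
      by (intro span_add span_scale)
  qed
  have "w \<in> n_plus_words w"
    unfolding n_plus_words_def by (rule span_base) (intro CollectI exI[of _ "[]"], simp)
  hence "foldr op ys w \<in> n_plus_words w" for ys
    by (induction ys) (auto intro: stable)
  thus ?thesis
    unfolding word_act_def by (intro subspace_sum[OF sub] subspace_scale[OF sub])
qed

lemma word_act_gen: "word_act (gen y) u = op y u"
  by (simp add: word_act_of_word)

lemma word_act_gen_power: "word_act (gen y ^ k) u = (op y ^^ k) u"
  by (induction k) (simp_all add: word_act_mult word_act_gen)

text \<open>The recursion controls only a module over the subalgebra. It contains all words in the
  \<open>e_i\<close> and \<open>g^+_i\<close> applied to \<open>w\<close>, and by PBW these span
  everything that \<open>w\<close> generates.\<close>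

lemma weyl_span:
  assumes rel: "\<And>r. r \<in> weyl_relations n \<Longrightarrow> word_act r w = 0"
  shows "\<exists>S. finite S \<and> card S \<le> 3 ^ n \<and> (\<forall>a. word_act a w \<in> span S)"
proof -
  have in_sum: "a \<in> n_minus \<Longrightarrow> a \<in> n_minus + cartan" "c *\<^sub>C osp_h \<in> n_minus + cartan" "0 \<in> n_minus + cartan" for a c
  proof -
    have z: "0 \<in> n_minus" "0 \<in> cartan"
      unfolding n_minus_def cartan_def by (auto simp: osp12_defs osp12_basis_defs intro!: exI[of _ 0])
    show "a \<in> n_minus \<Longrightarrow> a \<in> n_minus + cartan" using z set_plus_intro[of a n_minus 0 cartan] by simp
    show "c *\<^sub>C osp_h \<in> n_minus + cartan"
      using z set_plus_intro[of 0 n_minus "c *\<^sub>C osp_h" cartan] by (auto simp: cartan_def)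
    show "0 \<in> n_minus + cartan" using z set_plus_intro[of 0 n_minus 0 cartan] by simp
  qed
  have pos: "op (monom a (Suc i)) w = 0" if "a \<in> n_minus + cartan" for a i
  proof -
    have "gen (monom a (Suc i)) \<in> weyl_relations n"
      unfolding weyl_relations_def using that in_sum(3)
      by (intro UnI1 CollectI exI[of _ "monom a (Suc i)"]) simp
    thus ?thesis using rel by (metis word_act_gen)
  qed
  have zero: "op (monom a 0) w = 0" if "a \<in> n_minus" for a
    using rel[of "gen (monom a 0)"] that by (auto simp: weyl_relations_def word_act_gen)
  have h0: "op (monom osp_h 0) w = - (of_nat n *s w)"
    using rel[of "gen (monom osp_h 0) + fa_scale (of_nat n) 1"]
    by (auto simp: weyl_relations_def word_act_gen word_act_add word_act_scale eq_neg_iff_add_eq_0)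
  have e0: "(op (monom osp_e 0) ^^ Suc n) w = 0"
  proof -
    have "gen (monom osp_e 0) ^ (n + 1) \<in> weyl_relations n" by (simp add: weyl_relations_def)
    from rel[OF this] show ?thesis by (simp only: word_act_gen_power Suc_eq_plus1)
  qed
  have h_pos: "op (monom osp_h (Suc i)) w = 0" for i
    using pos[OF in_sum(2)[of 1]] by (simp add: scaleC_one)
  have stable0: "iw.osp_stable {0}"
    unfolding iw.osp_stable_def iw.sl2_stable_def by simp
  have lower: "iw.lower {0} w"
    unfolding iw.lower_def by (simp add: pos in_sum h_pos)
  have "of_nat (Suc n) *s op (monom osp_gp 0) ((op (monom osp_e 0) ^^ n) w) = 0"
    using gm_e_power[OF zero[OF n_minusI(2)], of n] by (simp only: e0 op_zero_right)
  hence "op (monom osp_gp 0) ((op (monom osp_e 0) ^^ n) w) = 0"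
    by (simp only: scale_eq_0_iff of_nat_neq_0 simp_thms)
  hence "iw.spans {0} (3 ^ n) w"
    using iw.spans_lower_upper[OF stable0, of w n] lower by simp
  then obtain S where S: "finite S" "card S \<le> 3 ^ n" "iw.osp_stable (span ({0} \<union> S))"
    "w \<in> span ({0} \<union> S)"
    unfolding iw.spans_def by blast
  have sp: "span ({0} \<union> S) = span S" by (simp add: span_insert_0)
  have "foldr op ys w \<in> span S" if "set ys \<subseteq> range (monom osp_e) \<union> range (monom osp_gp)" for ys
    using that
  proof (induction ys)
    case (Cons y ys)
    thus ?case using iw.osp_stableD(4,7)[OF S(3)] unfolding sp by auto
  qed (use S(4) sp in simp)
  hence sub: "n_plus_words w \<subseteq> span S"
    unfolding n_plus_words_def by (intro span_minimal) auto
  have spW: "subspace (n_plus_words w)" by (simp add: n_plus_words_def)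
  have wW: "w \<in> n_plus_words w"
    unfolding n_plus_words_def by (rule span_base) (intro CollectI exI[of _ "[]"], simp)
  \<comment> \<open>The start of the PBW argument: by the relations, every current outside the
    positive part sends \<open>w\<close> to a multiple of \<open>w\<close>.\<close>
  have "op y w \<in> n_plus_words w" for y
  proof (induction y rule: poly_monom_induct)
    case (monom a i)
    have "monom a i = co_e a *\<^sub>C monom osp_e i + co_h a *\<^sub>C monom osp_h i + co_f a *\<^sub>C monom osp_f i
        + co_gp a *\<^sub>C monom osp_gp i + co_gm a *\<^sub>C monom osp_gm i"
      by (simp add: scaleC_monom add_monom flip: osp12_expand)
    moreover have "op (monom osp_h i) w \<in> n_plus_words w"
      by (cases i) (auto simp: h_pos h0 intro!: subspace_0 subspace_neg subspace_scale spW wW)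
    moreover have "op (monom osp_f i) w = 0" "op (monom osp_gm i) w = 0"
      by (cases i; simp add: pos zero in_sum)+
    moreover have "op (monom osp_e i) w \<in> n_plus_words w" "op (monom osp_gp i) w \<in> n_plus_words w"
      by (auto intro: op_n_plus_words wW)
    ultimately show ?case
      by (simp add: op_add_left op_scale_left subspace_add subspace_scale spW)
  next
    case (add x y)
    thus ?case by (simp add: op_add_left subspace_add spW)
  qed
  from word_act_n_plus_words[OF this] sub S(1,2) show ?thesis by blast
qed

end

section \<open>The bound for the Weyl module\<close>

text \<open>The quotient is not a type of its own, so \<open>weyl_span\<close> is applied to a
  representation on the whole free algebra, with \<open>\<pi> 1\<close> as the generator.\<close>

lemma weyl_module_span:
  "\<exists>S. finite S \<and> card S \<le> 3 ^ n \<and>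
    (\<forall>a. \<exists>b\<in>free_alg.span S. a - b \<in> cyclic_ker (weyl_relations n))"
proof -
  define K where "K = cyclic_ker (weyl_relations n)"
  have K: "free_alg.subspace K" unfolding K_def by (rule subspace_cyclic_ker)
  obtain \<pi> :: "osp12 poly free_alg \<Rightarrow> _" where add: "\<pi> (x + y) = \<pi> x + \<pi> y"
    and scale: "\<pi> (fa_scale c x) = fa_scale c (\<pi> x)"
    and ker: "\<pi> x = 0 \<longleftrightarrow> x \<in> K" and proj: "x - \<pi> x \<in> K" for x y c
    using free_alg.exists_projection_along[OF K] by blast
  have minus: "\<pi> (- x) = - \<pi> x" for x using scale[of "-1" x] by simp
  have eqI: "\<pi> x = \<pi> y" if "x - y \<in> K" for x y
    using that ker[of "x - y"] add[of x "- y"] by (simp add: minus)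
  have mult: "\<pi> (a * \<pi> x) = \<pi> (a * x)" for a x
  proof (rule eqI)
    have "a * (x - \<pi> x) \<in> K" using proj[of x] cyclic_ker_left_mult by (auto simp: K_def)
    from free_alg.subspace_neg[OF K this] show "a * \<pi> x - a * x \<in> K"
      by (simp add: algebra_simps)
  qed
  have env: "\<pi> (r * x) = 0" if "r \<in> env_relations" for r x
    using cyclic_ker_env[OF that] ker by (auto simp: K_def)
  \<comment> \<open>Left multiplication in the quotient, expressed through the representatives that
    \<open>\<pi>\<close> selects.\<close>
  define op where "op = (\<lambda>y x. \<pi> (gen y * x))"
  interpret osp_current_rep fa_scale op
  proof unfold_locales
    fix x y :: "osp12 poly" and c u v
    show "op y (u + v) = op y u + op y v"
      by (simp add: op_def distrib_left add)
    show "op y (fa_scale c u) = fa_scale c (op y u)"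
      by (simp add: op_def fa_scale_mult_right scale)
    have "gen (x + y) - gen x - gen y \<in> env_relations" unfolding env_relations_def by blast
    from env[OF this, of u] have "\<pi> (gen (x + y) * u + (- (gen x * u + gen y * u))) = 0"
      by (simp add: algebra_simps)
    thus "op (x + y) u = op x u + op y u"
      by (simp only: add minus op_def) (simp add: algebra_simps)
    have "gen (c *\<^sub>C y) - fa_scale c (gen y) \<in> env_relations" unfolding env_relations_def by blast
    from env[OF this, of u] have "\<pi> (gen (c *\<^sub>C y) * u + (- fa_scale c (gen y * u))) = 0"
      by (simp add: algebra_simps fa_scale_mult_left)
    thus "op (c *\<^sub>C y) u = fa_scale c (op y u)"
      by (simp only: add minus scale op_def) simp
    show "op (lbr x y) u = op x (op y u) - fa_scale (ksign (p * q)) (op y (op x u))"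
      if "hcomp p x = x" "hcomp q y = y" for p q
    proof -
      have "gen x * gen y - fa_scale (ksign (p * q)) (gen y * gen x) - gen (lbr x y) \<in> env_relations"
        unfolding env_relations_def using that by blast
      from env[OF this, of u] have "\<pi> (gen x * (gen y * u) +
          (- (fa_scale (ksign (p * q)) (gen y * (gen x * u)) + gen (lbr x y) * u))) = 0"
        by (simp add: algebra_simps fa_scale_mult_left)
      thus ?thesis
        by (simp only: add minus scale op_def mult) (simp add: algebra_simps)
    qed
  qed
  have word: "word_act a (\<pi> x) = \<pi> (a * x)" for a x
  proof (induction a rule: free_alg_induct)
    case (word c ys a)
    have "foldr op ys (\<pi> x) = \<pi> (of_word ys * x)"
    proof (induction ys)
      case (Cons y ys)
      thus ?case by (simp add: op_def mult mult.assoc gen_mult_of_word[of y ys, symmetric])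
    qed (simp add: of_word_Nil)
    thus ?case using word
      by (simp add: word_act_add word_act_scale word_act_of_word distrib_right add scale fa_scale_mult_left)
  qed (use scale[of 0 0] in simp)
  have "word_act r (\<pi> 1) = 0" if "r \<in> weyl_relations n" for r
    using cyclic_ker_relation[OF that] ker[of r] by (simp add: word K_def)
  from weyl_span[OF this] obtain S where "finite S" "card S \<le> 3 ^ n" "\<And>a. \<pi> a \<in> free_alg.span S"
    by (auto simp: word)
  thus ?thesis using proj unfolding K_def by blast
qed

text \<open>The image of \<open>A\<close> under a projection along \<open>B\<close> is a complement;
  it stays inside \<open>A\<close> because \<open>B\<close> does.\<close>

lemma (in vector_space) exists_complement:
  assumes A: "subspace A" and B: "subspace B" and BA: "B \<subseteq> A"
  shows "\<exists>Q. subspace Q \<and> Q \<subseteq> A \<and> B \<inter> Q = {0} \<and> (\<forall>a\<in>A. \<exists>b\<in>B. \<exists>q\<in>Q. a = b + q)"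
proof -
  obtain \<pi> where add: "\<pi> (x + y) = \<pi> x + \<pi> y" and sc: "\<pi> (scale c x) = scale c (\<pi> x)"
    and ker: "\<pi> x = 0 \<longleftrightarrow> x \<in> B" and proj: "x - \<pi> x \<in> B" for x y c
    using exists_projection_along[OF B] by blast
  have idem: "\<pi> (\<pi> x) = \<pi> x" for x
    using ker[of "x - \<pi> x"] proj[of x] add[of "x - \<pi> x" "\<pi> x"] by simp
  have sub: "subspace (\<pi> ` A)"
  proof (rule subspaceI)
    show "0 \<in> \<pi> ` A" using ker[of 0] subspace_0[OF A] subspace_0[OF B] by (metis imageI)
  next
    fix x y assume "x \<in> \<pi> ` A" "y \<in> \<pi> ` A"
    then obtain a b where "x = \<pi> a" "y = \<pi> b" "a \<in> A" "b \<in> A" by auto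
    thus "x + y \<in> \<pi> ` A" using subspace_add[OF A] by (simp flip: add)
  next
    fix c x assume "x \<in> \<pi> ` A"
    then obtain a where "x = \<pi> a" "a \<in> A" by auto
    thus "scale c x \<in> \<pi> ` A" using subspace_scale[OF A] by (simp flip: sc)
  qed
  have "\<pi> a \<in> A" if "a \<in> A" for a
    using subspace_diff[OF A that, of "a - \<pi> a"] proj[of a] BA by auto
  moreover have "x = 0" if "x \<in> B" "x \<in> \<pi> ` A" for x
    using that idem ker by (metis imageE)
  moreover have "\<exists>b\<in>B. \<exists>q\<in>\<pi> ` A. a = b + q" if "a \<in> A" for a
    using that proj[of a] by (intro bexI[of _ "a - \<pi> a"] bexI[of _ "\<pi> a"]) auto
  ultimately show ?thesis
    using sub subspace_0[OF sub] subspace_0[OF B] by (intro exI[of _ "\<pi> ` A"]) blast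
qed

section \<open>Complete reducibility\<close>

text \<open>\<open>G\<close> and \<open>H\<close> stand for \<open>g^+\<close> and
  \<open>g^-\<close>. They generate osp(1,2), so stability under these two operators is all that
  complete reducibility has to ensure.\<close>

locale osp_weight_module = vector_space scale
  for scale :: "complex \<Rightarrow> 'v::ab_group_add \<Rightarrow> 'v" (infixr \<open>*s\<close> 75) +
  fixes M :: "'v set" and G H h :: "'v \<Rightarrow> 'v" and r :: nat
  assumes subM: "subspace M"
    and G_add: "G (x + y) = G x + G y" and G_scale: "G (c *s x) = c *s G x"
    and H_add: "H (x + y) = H x + H y" and H_scale: "H (c *s x) = c *s H x"
    and G_M: "x \<in> M \<Longrightarrow> G x \<in> M" and H_M: "x \<in> M \<Longrightarrow> H x \<in> M"
    and h_eq: "h x = G (H x) + H (G x)"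
    and h_G: "h (G x) = G (h x) + G x" and h_H: "h (H x) = H (h x) - H x"
    and weights: "M \<subseteq> span {x \<in> M. \<exists>j::int. \<bar>j\<bar> \<le> int r \<and> h x = of_int j *s x}"
begin

lemma G_0 [simp]: "G 0 = 0" using G_scale[of 0 0] by simp
lemma H_0 [simp]: "H 0 = 0" using H_scale[of 0 0] by simp
lemma h_add: "h (x + y) = h x + h y" by (simp add: h_eq G_add H_add)
lemma h_scale: "h (c *s x) = c *s h x" by (simp add: h_eq G_scale H_scale scale_right_distrib)
lemma h_0 [simp]: "h 0 = 0" by (simp add: h_eq)
lemma G_diff: "G (x - y) = G x - G y" using G_add[of "x - y" y] by simp
lemma H_diff: "H (x - y) = H x - H y" using H_add[of "x - y" y] by simp
lemma h_sum: "h (\<Sum>i\<in>A. x i) = (\<Sum>i\<in>A. h (x i))"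
  by (induction A rule: infinite_finite_induct) (auto simp: h_add)

text \<open>Applying \<open>h - k\<close> to the sum removes the component of weight
  \<open>k\<close> and multiplies the others by nonzero scalars, which shortens the sum.\<close>

lemma weight_components:
  fixes J :: "int set"
  assumes "finite J" and N: "subspace N" and hN: "\<And>x. x \<in> N \<Longrightarrow> h x \<in> N"
  shows "\<lbrakk>\<And>j. j \<in> J \<Longrightarrow> h (x j) = of_int j *s x j; (\<Sum>j\<in>J. x j) \<in> N; j \<in> J\<rbrakk> \<Longrightarrow> x j \<in> N"
  using assms(1)
proof (induction J arbitrary: x j rule: finite_induct)
  case (insert k J)
  define y where "y = (\<Sum>j\<in>insert k J. x j)"
  have y: "y \<in> N" using insert.prems by (simp add: y_def)
  have "h y - of_int k *s y = (\<Sum>j\<in>J. of_int (j - k) *s x j)"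
    using insert by (simp add: y_def h_add h_sum scale_right_distrib scale_sum_right sum_subtractf
        scale_left_diff_distrib)
  moreover have "h y - of_int k *s y \<in> N" using N hN[OF y] y by (simp add: subspace_diff subspace_scale)
  ultimately have sum: "(\<Sum>j\<in>J. of_int (j - k) *s x j) \<in> N" by simp
  have "of_int (j - k) *s x j \<in> N" if "j \<in> J" for j
  proof (rule insert.IH[of "\<lambda>j. of_int (j - k) *s x j", OF _ sum that])
    fix i assume "i \<in> J"
    thus "h (of_int (i - k) *s x i) = of_int i *s of_int (i - k) *s x i"
      by (simp only: h_scale insert.prems(1)[OF insertI2] scale_left_commute)
  qed
  hence J: "x j \<in> N" if "j \<in> J" for j
    using that insert.hyps subspace_scale[OF N, of "of_int (j - k) *s x j" "inverse (of_int (j - k))"]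
    by (cases "j = k") auto
  have "x k = y - (\<Sum>j\<in>J. x j)" using insert.hyps by (simp add: y_def)
  hence "x k \<in> N" using y J N by (auto intro: subspace_diff subspace_sum)
  thus ?case using J insert.prems(3) by auto
qed simp

section \<open>Weight spaces\<close>

definition wt :: "int \<Rightarrow> 'v set" where
  "wt j = {x \<in> M. h x = of_int j *s x}"

lemma subspace_wt: "subspace (wt j)"
  by (rule subspaceI)
    (auto simp: wt_def h_add h_scale scale_right_distrib mult.commute
      intro: subspace_0 subspace_add subspace_scale subM)

text \<open>\<open>P\<close> carries a second property along with the weight. It is trivial in
  \<open>wt_decomp\<close>; for the tensor product it will be the parity.\<close>

lemma span_wt_decomp:
  assumes P: "\<And>j. subspace (P j)" and X: "\<And>x. x \<in> X \<Longrightarrow> \<exists>j. \<bar>j\<bar> \<le> int r \<and> x \<in> wt j \<inter> P j"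
    and x: "x \<in> span X"
  shows "\<exists>xs. (\<forall>j. xs j \<in> wt j \<inter> P j) \<and> x = (\<Sum>j\<in>{- int r..int r}. xs j)"
  using x
proof (induction rule: span_induct_alt)
  case base
  show ?case by (intro exI[of _ "\<lambda>_. 0"]) (auto intro: subspace_0 subspace_wt P)
next
  case (step c x y)
  then obtain j xs where j: "\<bar>j\<bar> \<le> int r" "x \<in> wt j \<inter> P j"
    and xs: "\<And>j. xs j \<in> wt j \<inter> P j" "y = (\<Sum>j\<in>{- int r..int r}. xs j)"
    using X by blast
  have "(\<Sum>i\<in>{- int r..int r}. if i = j then c *s x else 0) = c *s x"
    using j by (subst sum.delta) auto
  moreover have "(if i = j then c *s x else 0) + xs i \<in> wt i \<inter> P i" for i
    using xs(1)[of i] j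
    by (intro subspace_add[OF subspace_inter[OF subspace_wt P]])
      (auto intro: subspace_0[OF subspace_wt] subspace_0[OF P] subspace_scale[OF subspace_wt]
        subspace_scale[OF P])
  ultimately show ?case
    using xs(2) by (intro exI[of _ "\<lambda>i. (if i = j then c *s x else 0) + xs i"]) (simp add: sum.distrib)
qed

lemma wt_decomp:
  assumes "x \<in> M"
  shows "\<exists>xs. (\<forall>j. xs j \<in> wt j) \<and> x = (\<Sum>j\<in>{- int r..int r}. xs j)"
proof -
  have "x \<in> span {x \<in> M. \<exists>j::int. \<bar>j\<bar> \<le> int r \<and> h x = of_int j *s x}" using assms weights by blast
  from span_wt_decomp[where P = "\<lambda>_. UNIV", OF _ _ this] show ?thesis
    by (auto simp: wt_def)
qed

lemma wt_unique:
  assumes x: "x \<in> wt j" and xs: "\<And>i. xs i \<in> wt i" and eq: "x = (\<Sum>i\<in>{- int r..int r}. xs i)"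
  shows "x = (if \<bar>j\<bar> \<le> int r then xs j else 0)"
proof -
  \<comment> \<open>The weight \<open>j\<close> may lie outside the bounds, hence the inserted
    index.\<close>
  define J where "J = insert j {- int r..int r}"
  define y where "y = (\<lambda>i. (if i \<in> {- int r..int r} then xs i else 0) - (if i = j then x else 0))"
  have "(\<Sum>i\<in>J. y i) = (\<Sum>i\<in>J. if i \<in> {- int r..int r} then xs i else 0) - x"
    by (simp add: y_def sum_subtractf J_def)
  also have "(\<Sum>i\<in>J. if i \<in> {- int r..int r} then xs i else 0) = x"
    unfolding eq by (intro sum.mono_neutral_cong_right) (auto simp: J_def)
  finally have "(\<Sum>i\<in>J. y i) \<in> {0}" by simp
  moreover have "y i \<in> wt i" for i
    using x xs by (auto simp: y_def intro!: subspace_diff subspace_neg subspace_wt subspace_0)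
  ultimately have "y j \<in> {0}"
    by (intro weight_components[where J = J and x = y]) (auto simp: J_def wt_def)
  thus ?thesis by (auto simp: y_def split: if_splits)
qed

lemma wt_bounded: "x \<in> wt j \<Longrightarrow> \<bar>j\<bar> > int r \<Longrightarrow> x = 0"
  using wt_decomp[of x] wt_unique[of x j] by (auto simp: wt_def)

lemma G_wt: "x \<in> wt j \<Longrightarrow> G x \<in> wt (j + 1)"
  by (auto simp: wt_def h_G G_M G_scale scale_left_distrib)

lemma H_wt: "x \<in> wt j \<Longrightarrow> H x \<in> wt (j - 1)"
  by (auto simp: wt_def h_H H_M H_scale scale_left_diff_distrib)

lemma G_power_wt: "x \<in> wt j \<Longrightarrow> (G ^^ k) x \<in> wt (j + int k)"
  by (induction k) (auto dest: G_wt simp: algebra_simps)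

lemma H_power_wt: "x \<in> wt j \<Longrightarrow> (H ^^ k) x \<in> wt (j - int k)"
  by (induction k) (auto dest: H_wt simp: algebra_simps)

text \<open>The coefficient in \<open>H (G^k u) = cf j k * G^(k-1) u\<close> for \<open>u\<close> of
  weight \<open>j\<close> with \<open>G (H u) = 0\<close>; closed form of the recursion in
  \<open>cf_Suc\<close>, starting from 0.\<close>

definition cf :: "int \<Rightarrow> nat \<Rightarrow> int" where
  "cf j k = (if even k then int (k div 2) else j + int (k div 2))"

lemma cf_Suc: "cf j (Suc k) = j + int k - cf j k"
  by (auto simp: cf_def elim!: evenE oddE)

lemma H_G_power:
  assumes u: "u \<in> wt j" and "G (H u) = 0"
  shows "H ((G ^^ Suc k) u) = of_int (cf j (Suc k)) *s (G ^^ k) u"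
proof (induction k)
  case 0
  show ?case using h_eq[of u] assms by (simp add: wt_def cf_def)
next
  case (Suc k)
  have "H ((G ^^ Suc (Suc k)) u) = h ((G ^^ Suc k) u) - G (H ((G ^^ Suc k) u))"
    using h_eq[of "(G ^^ Suc k) u"] by simp
  also have "h ((G ^^ Suc k) u) = of_int (j + int (Suc k)) *s (G ^^ Suc k) u"
    using G_power_wt[OF u, of "Suc k"] by (simp add: wt_def)
  also have "G (H ((G ^^ Suc k) u)) = of_int (cf j (Suc k)) *s (G ^^ Suc k) u"
    unfolding Suc by (simp add: G_scale)
  finally show ?case
    unfolding cf_Suc[of j "Suc k"] by (simp only: of_int_diff scale_left_diff_distrib)
qed

text \<open>Exchanging \<open>G\<close> and \<open>H\<close> reverses the weights, which accounts
  for both signs in \<open>- cf (- j)\<close>.\<close>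

lemma G_H_power:
  assumes u: "u \<in> wt j" and "H (G u) = 0"
  shows "G ((H ^^ Suc k) u) = of_int (- cf (- j) (Suc k)) *s (H ^^ k) u"
proof (induction k)
  case 0
  show ?case using h_eq[of u] assms by (simp add: wt_def cf_def)
next
  case (Suc k)
  have "G ((H ^^ Suc (Suc k)) u) = h ((H ^^ Suc k) u) - H (G ((H ^^ Suc k) u))"
    using h_eq[of "(H ^^ Suc k) u"] by simp
  also have "h ((H ^^ Suc k) u) = of_int (j - int (Suc k)) *s (H ^^ Suc k) u"
    using H_power_wt[OF u, of "Suc k"] by (simp add: wt_def)
  also have "H (G ((H ^^ Suc k) u)) = of_int (- cf (- j) (Suc k)) *s (H ^^ Suc k) u"
    unfolding Suc by (simp only: H_scale funpow.simps o_apply)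
  also have "of_int (j - int (Suc k)) *s (H ^^ Suc k) u - \<dots> =
      of_int (- cf (- j) (Suc (Suc k))) *s (H ^^ Suc k) u"
    unfolding cf_Suc[of "- j" "Suc k"] scale_left_diff_distrib[symmetric] of_int_diff[symmetric]
    by (rule arg_cong[of _ _ "\<lambda>c. of_int c *s _"]) simp
  finally show ?case .
qed

lemma cf_pos: "j > 0 \<Longrightarrow> cf j (Suc k) > 0"
  by (auto simp: cf_def elim!: oddE)

text \<open>A vector violating either of the next two lemmas would generate an infinite chain of
  nonzero weight vectors.\<close>

lemma G_H_inj:
  assumes u: "u \<in> wt j" and j: "j > 0" and GH: "G (H u) = 0"
  shows "u = 0"
proof -
  have "(G ^^ (Suc (r + k))) u = 0" for k
    by (rule wt_bounded[OF G_power_wt[OF u]]) (use j in simp)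
  moreover have "(G ^^ k) u = 0" if "(G ^^ Suc k) u = 0" for k
    using H_G_power[OF u GH, of k] that cf_pos[OF j, of k] by simp
  hence "(G ^^ k) u = 0 \<Longrightarrow> u = 0" for k
    by (induction k) auto
  ultimately show ?thesis by blast
qed

lemma H_G_inj:
  assumes u: "u \<in> wt j" and j: "j < 0" and HG: "H (G u) = 0"
  shows "u = 0"
proof -
  have "(H ^^ (Suc (r + k))) u = 0" for k
    by (rule wt_bounded[OF H_power_wt[OF u]]) (use j in simp)
  moreover have "(H ^^ k) u = 0" if "(H ^^ Suc k) u = 0" for k
    using G_H_power[OF u HG, of k] that cf_pos[of "- j" k] j by simp
  hence "(H ^^ k) u = 0 \<Longrightarrow> u = 0" for k
    by (induction k) auto
  ultimately show ?thesis by blast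
qed

section \<open>Lowest weight vectors and their strings\<close>

definition prim :: "nat \<Rightarrow> 'v set" where
  "prim m = {x \<in> wt (- int m). H x = 0}"

lemma subspace_prim: "subspace (prim m)"
  using subspace_wt[of "- int m"]
  by (auto simp: prim_def subspace_def H_add H_scale)

lemma H_G_power_prim:
  "q \<in> prim m \<Longrightarrow> H ((G ^^ Suc k) q) = of_int (cf (- int m) (Suc k)) *s (G ^^ k) q"
  by (rule H_G_power) (auto simp: prim_def)

text \<open>Along the string of a lowest weight vector of weight \<open>-m\<close>, \<open>H\<close>
  can annihilate the successor of \<open>G^k q\<close> only when \<open>k = 2 * m\<close>, that is,
  at weight \<open>m\<close>.\<close>

lemma cf_prim_eq_0: "cf (- int m) (Suc k) = 0 \<Longrightarrow> k = 2 * m"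
  by (auto simp: cf_def elim!: evenE oddE split: if_splits)

text \<open>The coefficient \<open>cf (-m) (2m + 1)\<close> is zero, so \<open>H\<close> annihilates
  this vector; as its weight \<open>m + 1\<close> is positive, \<open>G_H_inj\<close>
  applies.\<close>

lemma G_power_prim_top:
  assumes "q \<in> prim m"
  shows "(G ^^ Suc (2 * m)) q = 0"
proof (rule G_H_inj)
  show "(G ^^ Suc (2 * m)) q \<in> wt (int m + 1)"
    using G_power_wt[of q "- int m" "Suc (2 * m)"] assms by (simp add: prim_def add.commute)
  show "G (H ((G ^^ Suc (2 * m)) q)) = 0"
    using H_G_power_prim[OF assms, of "2 * m"] by (simp add: cf_def)
qed simp

text \<open>For lowest weight vectors \<open>q\<close> of weight \<open>-m\<close>,
  \<open>(G ^^ k) q\<close> has weight \<open>k - m\<close>; this is the weight \<open>j\<close>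
  part of the submodule \<open>all_strings Q\<close>.\<close>

definition strings :: "(nat \<Rightarrow> 'v set) \<Rightarrow> int \<Rightarrow> 'v set" where
  "strings Q j = span {(G ^^ k) q |k m q. q \<in> Q m \<and> int k = int m + j}"

definition all_strings :: "(nat \<Rightarrow> 'v set) \<Rightarrow> 'v set" where
  "all_strings Q = span {(G ^^ k) q |k m q. q \<in> Q m}"

lemma subspace_strings: "subspace (strings Q j)" and subspace_all_strings: "subspace (all_strings Q)"
  by (simp_all add: strings_def all_strings_def)

lemma strings_subset: "strings Q j \<subseteq> all_strings Q"
  unfolding strings_def all_strings_def by (rule span_mono) blast

lemma strings_induct [consumes 1, case_names zero step]:
  assumes "x \<in> strings Q j" and "P 0"
    and "\<And>c k m q y. q \<in> Q m \<Longrightarrow> int k = int m + j \<Longrightarrow> P y \<Longrightarrow> P (c *s (G ^^ k) q + y)"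
  shows "P x"
  using assms(1) unfolding strings_def
  by (induction rule: span_induct_alt) (use assms in auto)

lemma all_strings_induct [consumes 1, case_names zero step]:
  assumes "x \<in> all_strings Q" and "P 0"
    and "\<And>c k m q y. q \<in> Q m \<Longrightarrow> P y \<Longrightarrow> P (c *s (G ^^ k) q + y)"
  shows "P x"
  using assms(1) unfolding all_strings_def
  by (induction rule: span_induct_alt) (use assms in auto)

lemma string_in_strings: "q \<in> Q m \<Longrightarrow> int k = int m + j \<Longrightarrow> (G ^^ k) q \<in> strings Q j"
  unfolding strings_def by (rule span_base) blast

lemma G_strings: "x \<in> strings Q j \<Longrightarrow> G x \<in> strings Q (j + 1)"
proof (induction rule: strings_induct)
  case (step c k m q y)
  have "(G ^^ Suc k) q \<in> strings Q (j + 1)"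
    using step by (intro string_in_strings) auto
  thus ?case
    using step by (simp add: G_add G_scale subspace_add subspace_scale subspace_strings)
qed (simp add: subspace_0 subspace_strings)

lemma string_all: "q \<in> Q m \<Longrightarrow> (G ^^ k) q \<in> all_strings Q"
  unfolding all_strings_def by (rule span_base) blast

lemma G_all_strings: "x \<in> all_strings Q \<Longrightarrow> G x \<in> all_strings Q"
proof (induction rule: all_strings_induct)
  case (step c k m q y)
  thus ?case
    using string_all[of q Q m "Suc k"]
    by (simp add: G_add G_scale subspace_add subspace_scale subspace_all_strings)
qed (simp add: subspace_0 subspace_all_strings)

context
  fixes Q
  assumes Q_prim: "\<And>m. Q m \<subseteq> prim m" and Q_sub: "\<And>m. subspace (Q m)"
begin

lemma strings_wt: "strings Q j \<subseteq> wt j"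
proof
  fix x assume "x \<in> strings Q j"
  thus "x \<in> wt j"
  proof (induction rule: strings_induct)
    case (step c k m q y)
    have "(G ^^ k) q \<in> wt j"
      using G_power_wt[of q "- int m" k] Q_prim[of m] step(1,2) by (auto simp: prim_def)
    thus ?case using step by (simp add: subspace_add subspace_scale subspace_wt)
  qed (simp add: subspace_0 subspace_wt)
qed

lemma H_all_strings: "x \<in> all_strings Q \<Longrightarrow> H x \<in> all_strings Q"
proof (induction rule: all_strings_induct)
  case (step c k m q y)
  have "H ((G ^^ k) q) \<in> all_strings Q"
  proof (cases k)
    case 0
    moreover have "H q = 0" using step(1) Q_prim[of m] by (auto simp: prim_def)
    ultimately show ?thesis by (simp add: subspace_0 subspace_all_strings)
  next
    case (Suc l)
    have "q \<in> prim m" using step(1) Q_prim by blast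
    from H_G_power_prim[OF this, of l] string_all[of q Q m l, OF step(1)] show ?thesis
      by (simp only: Suc subspace_scale subspace_all_strings)
  qed
  thus ?case
    using step by (simp add: H_add H_scale subspace_add subspace_scale subspace_all_strings)
qed (simp add: subspace_0 subspace_all_strings)

lemma all_strings_M: "all_strings Q \<subseteq> M"
proof
  fix x assume "x \<in> all_strings Q"
  thus "x \<in> M"
  proof (induction rule: all_strings_induct)
    case (step c k m q y)
    have "(G ^^ k) q \<in> M"
      using G_power_wt[of q "- int m" k] Q_prim[of m] step(1) by (auto simp: prim_def wt_def)
    thus ?case using step by (simp add: subspace_add subspace_scale subM)
  qed (simp add: subspace_0 subM)
qed

lemma all_strings_wt:
  assumes "x \<in> all_strings Q" "x \<in> wt j"
  shows "x \<in> strings Q j"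
proof -
  have "\<exists>xs. (\<forall>j. xs j \<in> strings Q j) \<and> x = (\<Sum>j\<in>{- int r..int r}. xs j)"
    using assms(1)
  proof (induction rule: all_strings_induct)
    case zero
    show ?case by (intro exI[of _ "\<lambda>_. 0"]) (auto intro: subspace_0 subspace_strings)
  next
    case (step c k m q y)
    then obtain xs where xs: "\<And>j. xs j \<in> strings Q j" "y = (\<Sum>j\<in>{- int r..int r}. xs j)" by auto
    define j where "j = int k - int m"
    define x where "x = (G ^^ k) q"
    have x: "x \<in> strings Q j"
      unfolding x_def j_def using step(1) by (intro string_in_strings) auto
    have "(\<Sum>i\<in>{- int r..int r}. if i = j then c *s x else 0) = c *s x"
      using wt_bounded[of x j] x strings_wt[of j] by (subst sum.delta) auto
    thus ?case
      unfolding x_def[symmetric] using xs x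
      by (intro exI[of _ "\<lambda>i. (if i = j then c *s x else 0) + xs i"])
        (auto simp: sum.distrib intro!: subspace_strings subspace_add subspace_scale)
  qed
  then obtain xs where xs: "\<And>j. xs j \<in> strings Q j" "x = (\<Sum>j\<in>{- int r..int r}. xs j)" by auto
  have "x = (if \<bar>j\<bar> \<le> int r then xs j else 0)"
    using xs strings_wt by (intro wt_unique[OF assms(2)]) blast+
  thus ?thesis using xs(1)[of j] by (auto split: if_splits intro: subspace_0 subspace_strings)
qed

text \<open>In a string, every vector except its start is \<open>G\<close> of the preceding
  one.\<close>

lemma strings_lowest:
  assumes "x \<in> strings Q (- int i)"
  shows "\<exists>q\<in>Q i. \<exists>y\<in>strings Q (- int i - 1). x = q + G y"
  using assms
proof (induction rule: strings_induct)
  case zero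
  show ?case
    by (intro bexI[of _ 0]) (auto intro: subspace_0 subspace_strings Q_sub)
next
  case (step c k m q y)
  then obtain p z where p: "p \<in> Q i" "z \<in> strings Q (- int i - 1)" "y = p + G z" by blast
  show ?case
  proof (cases k)
    case 0
    hence "q \<in> Q i" using step(1,2) by simp
    thus ?thesis
      using p 0 Q_sub[of i] by (intro bexI[of _ "c *s q + p"] bexI[of _ z])
        (auto simp: add.assoc subspace_add subspace_scale)
  next
    case (Suc l)
    have "(G ^^ l) q \<in> strings Q (- int i - 1)"
      using step(1,2) Suc by (intro string_in_strings) auto
    thus ?thesis
      using p Suc by (intro bexI[of _ p] bexI[of _ "c *s (G ^^ l) q + z"])
        (auto simp: G_add G_scale algebra_simps subspace_strings intro!: subspace_add subspace_scale)
  qed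
qed

end

lemmas prim_strings_wt = strings_wt[of prim, OF order_refl subspace_prim]

text \<open>Induction from the lowest weights upwards. In negative weight \<open>H G\<close> is
  invertible on strings, so some \<open>z\<close> there has \<open>H (G z) = H x\<close>, and then
  \<open>x - G z\<close> is a lowest weight vector.\<close>

lemma wt_neg_strings: "x \<in> wt (- int i) \<Longrightarrow> x \<in> strings prim (- int i)"
proof (induction "Suc r - i" arbitrary: i x)
  case 0
  hence "x = 0" by (intro wt_bounded[of x "- int i"]) auto
  thus ?case by (simp add: subspace_0 subspace_strings)
next
  case (Suc d)
  have "H x \<in> wt (- int (Suc i))" using H_wt[OF Suc.prems] by (simp only: of_nat_Suc minus_add_distrib add.commute[of "- 1"] diff_conv_add_uminus add.commute[of 1])
  hence "H x \<in> strings prim (- int (Suc i))" using Suc.hyps(2) by (intro Suc.hyps(1)) auto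
  hence "\<exists>z\<in>strings prim (- int (Suc i)). H (G z) = H x"
  proof (induction rule: strings_induct)
    case zero
    show ?case by (intro bexI[of _ 0]) (auto intro: subspace_0 subspace_strings)
  next
    case (step c k m q y)
    then obtain z where z: "z \<in> strings prim (- int (Suc i))" "H (G z) = y" by blast
    have q: "(G ^^ k) q \<in> strings prim (- int (Suc i))"
      using step(1,2) by (intro string_in_strings)
    \<comment> \<open>The coefficient could vanish only for \<open>k = 2 * m\<close>, hence in
      weight \<open>m\<close>, whereas the weight here is negative.\<close>
    have nz: "cf (- int m) (Suc k) \<noteq> 0" using cf_prim_eq_0[of m k] step(2) by auto
    define e where "e = of_int (cf (- int m) (Suc k)) * (1::complex)"
    have "H (G ((G ^^ k) q)) = e *s (G ^^ k) q" "e \<noteq> 0"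
      using H_G_power_prim[OF step(1), of k] nz by (simp_all add: e_def)
    thus ?case
      using z q
      by (intro bexI[of _ "(c / e) *s (G ^^ k) q + z"])
        (auto simp: G_add G_scale H_add H_scale subspace_strings intro!: subspace_add subspace_scale)
  qed
  then obtain z where z: "z \<in> strings prim (- int (Suc i))" "H (G z) = H x" by blast
  have Gz: "G z \<in> strings prim (- int i)" using G_strings[OF z(1)] by simp
  hence "x - G z \<in> prim i"
    using z(2) Suc.prems prim_strings_wt[of "- int i"]
    by (auto simp: prim_def H_diff intro!: subspace_diff subspace_wt)
  hence "x - G z \<in> strings prim (- int i)"
    using string_in_strings[of "x - G z" prim i 0 "- int i"] by simp
  from subspace_add[OF subspace_strings this Gz] show ?case by simp
qed

text \<open>At the top of a string \<open>H G\<close> is no longer invertible, so only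
  \<open>G (H (G z)) = G (H x)\<close> is arranged; \<open>G_H_inj\<close> still gives
  \<open>x = G z\<close>.\<close>

lemma wt_pos_strings: "x \<in> wt (int j) \<Longrightarrow> x \<in> strings prim (int j)"
proof (induction j arbitrary: x)
  case 0
  thus ?case using wt_neg_strings[of x 0] by simp
next
  case (Suc j)
  have "H x \<in> wt (int j)" using H_wt[OF Suc.prems] by simp
  hence "H x \<in> strings prim (int j)" by (rule Suc.IH)
  hence "\<exists>z\<in>strings prim (int j). G (H (G z)) = G (H x)"
  proof (induction rule: strings_induct)
    case zero
    show ?case by (intro bexI[of _ 0]) (auto intro: subspace_0 subspace_strings)
  next
    case (step c k m q y)
    then obtain z where z: "z \<in> strings prim (int j)" "G (H (G z)) = G y" by blast
    have q: "(G ^^ k) q \<in> strings prim (int j)"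
      using step(1,2) by (intro string_in_strings)
    define e where "e = of_int (cf (- int m) (Suc k)) * (1::complex)"
    have e: "H (G ((G ^^ k) q)) = e *s (G ^^ k) q"
      using H_G_power_prim[OF step(1), of k] by (simp add: e_def)
    show ?case
    proof (cases "e = 0")
      case True
      \<comment> \<open>\<open>G\<close> kills the top of the string, so this term contributes
        nothing to the equation and \<open>z\<close> can be kept.\<close>
      hence "k = 2 * m" using cf_prim_eq_0[of m k] by (simp add: e_def)
      hence "G ((G ^^ k) q) = 0" using G_power_prim_top[OF step(1)] by simp
      thus ?thesis using z by (intro bexI[of _ z]) (auto simp: G_add G_scale)
    next
      case False
      thus ?thesis
        using z q e
        by (intro bexI[of _ "(c / e) *s (G ^^ k) q + z"])
          (auto simp: G_add G_scale H_add H_scale subspace_strings intro!: subspace_add subspace_scale)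
    qed
  qed
  then obtain z where z: "z \<in> strings prim (int j)" "G (H (G z)) = G (H x)" by blast
  have Gz: "G z \<in> strings prim (int (Suc j))" using G_strings[OF z(1)] by (simp add: add.commute)
  have "x - G z \<in> wt (int (Suc j))"
    using Suc.prems Gz prim_strings_wt[of "int (Suc j)"] by (auto intro!: subspace_diff subspace_wt)
  hence "x - G z = 0" by (rule G_H_inj) (simp_all add: H_diff G_diff z)
  thus ?case using Gz by simp
qed

lemma wt_strings: "wt j \<subseteq> strings prim j"
  using wt_pos_strings[of _ "nat j"] wt_neg_strings[of _ "nat (- j)"] by (cases "j \<ge> 0") auto

lemma M_all_strings: "M \<subseteq> all_strings prim"
proof
  fix x assume "x \<in> M"
  then obtain xs where xs: "\<And>j. xs j \<in> wt j" "x = (\<Sum>j\<in>{- int r..int r}. xs j)"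
    using wt_decomp by blast
  hence "xs j \<in> all_strings prim" for j
    using wt_strings strings_subset by blast
  thus "x \<in> all_strings prim"
    unfolding xs(2) by (intro subspace_sum subspace_all_strings)
qed

text \<open>Everything is generated by lowest weight vectors, so it suffices to choose complements
  of \<open>N\<close> among those of each weight and to let \<open>C\<close> be the strings they
  generate.\<close>

theorem exists_stable_complement:
  assumes N: "subspace N" and NM: "N \<subseteq> M" and GN: "\<And>x. x \<in> N \<Longrightarrow> G x \<in> N" and HN: "\<And>x. x \<in> N \<Longrightarrow> H x \<in> N"
  shows "\<exists>C. subspace C \<and> C \<subseteq> M \<and> (\<forall>x\<in>C. G x \<in> C) \<and> (\<forall>x\<in>C. H x \<in> C) \<and> N \<inter> C = {0} \<and>
    (\<forall>x\<in>M. \<exists>y\<in>N. \<exists>z\<in>C. x = y + z)"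
proof -
  have "\<exists>Q. subspace Q \<and> Q \<subseteq> prim m \<and> (N \<inter> prim m) \<inter> Q = {0} \<and>
      (\<forall>a\<in>prim m. \<exists>b\<in>N \<inter> prim m. \<exists>q\<in>Q. a = b + q)" for m
    by (intro exists_complement subspace_prim subspace_inter N) auto
  then obtain Q where Q: "\<And>m. subspace (Q m)" "\<And>m. Q m \<subseteq> prim m" "\<And>m. N \<inter> prim m \<inter> Q m = {0}"
    "\<And>m a. a \<in> prim m \<Longrightarrow> \<exists>b\<in>N \<inter> prim m. \<exists>q\<in>Q m. a = b + q"
    by metis
  define C where "C = all_strings Q"
  note CH = H_all_strings[of Q, OF Q(2,1), folded C_def]
  have C: "subspace C" unfolding C_def by (rule subspace_all_strings)
  have CG: "G x \<in> C" if "x \<in> C" for x using G_all_strings that by (simp add: C_def)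
  have CM: "C \<subseteq> M" unfolding C_def by (rule all_strings_M[OF Q(2,1)])
  \<comment> \<open>Induction on the weight: \<open>H x\<close> vanishes already. In positive weight
    \<open>G_H_inj\<close> finishes; otherwise \<open>x\<close> turns out to be a chosen lowest
    weight vector lying in \<open>N\<close>.\<close>
  have wt0: "x = 0" if "x \<in> N" "x \<in> C" "x \<in> wt j" for x j
    using that
  proof (induction "nat (j + int r + 1)" arbitrary: x j)
    case 0
    thus ?case by (intro wt_bounded[of x j]) auto
  next
    case (Suc d)
    have "H x = 0"
      using Suc.prems Suc.hyps(2) by (intro Suc.hyps(1)[of "j - 1"] HN CH H_wt) auto
    show ?case
    proof (cases "j > 0")
      case True
      thus ?thesis using G_H_inj[OF Suc.prems(3)] \<open>H x = 0\<close> by simp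
    next
      case False
      define i where "i = nat (- j)"
      have j: "j = - int i" using False by (simp add: i_def)
      have "x \<in> strings Q (- int i)"
        using all_strings_wt[OF Q(2,1)] Suc.prems by (auto simp: C_def j)
      then obtain q y where q: "q \<in> Q i" "y \<in> strings Q (- int i - 1)" "x = q + G y"
        using strings_lowest[OF Q(2,1)] by blast
      have "H q = 0" using q(1) Q(2) by (auto simp: prim_def)
      hence "H (G y) = 0" using \<open>H x = 0\<close> q(3) by (simp add: H_add)
      moreover have "y \<in> wt (- int i - 1)" using strings_wt[OF Q(2,1)] q(2) by blast
      ultimately have "y = 0" by (intro H_G_inj[of y "- int i - 1"]) auto
      hence "x \<in> N \<inter> prim i \<inter> Q i" using q Suc.prems(1) Q(2)[of i] by auto
      thus ?thesis using Q(3) by blast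
    qed
  qed
  have "x = 0" if x: "x \<in> N" "x \<in> C" for x
  proof -
    obtain xs where xs: "\<And>j. xs j \<in> wt j" "x = (\<Sum>j\<in>{- int r..int r}. xs j)"
      using wt_decomp[of x] x NM by blast
    have "xs j \<in> N \<inter> C" if "j \<in> {- int r..int r}" for j
    proof (rule weight_components[where J = "{- int r..int r}" and x = xs])
      show "subspace (N \<inter> C)" by (intro subspace_inter N C)
      show "h y \<in> N \<inter> C" if "y \<in> N \<inter> C" for y
        using that by (auto simp: h_eq intro!: subspace_add N C GN HN CG CH)
    qed (use xs x that in \<open>auto simp: wt_def\<close>)
    hence "xs j = 0" if "j \<in> {- int r..int r}" for j using wt0 xs(1) that by blast
    thus ?thesis by (simp add: xs(2))
  qed
  moreover have "\<exists>y\<in>N. \<exists>z\<in>C. x = y + z" if x: "x \<in> M" for x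
  proof -
    have "x \<in> all_strings prim" using x M_all_strings by blast
    thus ?thesis
    proof (induction rule: all_strings_induct)
      case zero
      show ?case using subspace_0[OF N] subspace_0[OF C] by (metis add_0)
    next
      case (step c k m q x)
      then obtain y z where y: "y \<in> N" "z \<in> C" "x = y + z" by blast
      obtain b p where b: "b \<in> N" "p \<in> Q m" "q = b + p" using Q(4)[OF step(1)] by blast
      have "(G ^^ k) q = (G ^^ k) b + (G ^^ k) p"
        unfolding b(3) by (induction k) (auto simp: G_add)
      moreover have "(G ^^ k) b \<in> N" by (induction k) (auto intro: b GN)
      moreover have "(G ^^ k) p \<in> C" unfolding C_def by (rule string_all[of p Q m, OF b(2)])
      ultimately show ?case
        using y by (intro bexI[of _ "c *s (G ^^ k) b + y"] bexI[of _ "c *s (G ^^ k) p + z"])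
          (auto simp: algebra_simps intro!: subspace_add[OF N] subspace_add[OF C]
            subspace_scale[OF N] subspace_scale[OF C])
    qed
  qed
  ultimately show ?thesis
    using C CM CG CH subspace_0[OF C] subspace_0[OF N] by (intro exI[of _ C]) blast
qed

end

section \<open>The fundamental representation\<close>

lemma ksign_add: "ksign (p + q) = ksign p * ksign q"
  by (cases p; cases q) (auto simp: ksign_def)

lemma ksign_square: "ksign p * ksign p = 1"
  by (auto simp: ksign_def)

lemma ksign_0 [simp]: "ksign 0 = 1"
  by (simp add: ksign_def)

abbreviation homog :: "('b \<Rightarrow> bit) \<Rightarrow> bit \<Rightarrow> ('b \<Rightarrow> complex) set" where
  "homog par p \<equiv> {v. \<forall>b. par b \<noteq> p \<longrightarrow> v b = 0}"

lemma coord_module_super_rep: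
  assumes "is_supermodule (coord_module par \<rho>)"
  shows "super_rep fun_scale \<rho>"
    and "hcomp p y = y \<Longrightarrow> v \<in> homog par q \<Longrightarrow> \<rho> y v \<in> homog par (p + q)"
proof -
  let ?M = "coord_module par \<rho>"
  have M: "Module.module complex_ring ?M" using assms by (simp add: is_supermodule_def)
  then interpret M: abelian_group ?M by (simp add: Module.module_def)
  have minus: "u \<ominus>\<^bsub>?M\<^esub> w = u - w" for u w
  proof -
    have "\<ominus>\<^bsub>?M\<^esub> w = - w" by (rule M.minus_equality) (simp_all add: coord_module_def)
    thus ?thesis by (simp add: M.minus_eq) (simp add: coord_module_def)
  qed
  show "super_rep fun_scale \<rho>"
    using assms[unfolded is_supermodule_def]
    by unfold_locales (auto simp: minus, auto simp: coord_module_def)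
  show "hcomp p y = y \<Longrightarrow> v \<in> homog par q \<Longrightarrow> \<rho> y v \<in> homog par (p + q)"
    using assms[unfolded is_supermodule_def] unfolding coord_module_def by simp
qed

lemma coord_subsupermodule:
  assumes sm: "is_supermodule (coord_module par \<rho>)"
    and hom: "\<And>u. u \<in> X \<Longrightarrow> \<exists>p. u \<in> homog par p"
    and act: "\<And>y u. u \<in> X \<Longrightarrow> \<rho> y u \<in> fun_space.span X"
  shows "is_subsupermodule (fun_space.span X) (coord_module par \<rho>)"
proof -
  let ?M = "coord_module par \<rho>"
  interpret super_rep fun_scale \<rho> by (rule coord_module_super_rep[OF sm])
  have M: "Module.module complex_ring ?M" using sm by (simp add: is_supermodule_def)
  have minus: "\<ominus>\<^bsub>?M\<^esub> w = - w" for w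
  proof -
    interpret M: abelian_group ?M using M by (simp add: Module.module_def)
    show ?thesis by (rule M.minus_equality) (simp_all add: coord_module_def)
  qed
  have hsub: "fun_space.subspace (homog par p)" for p
    by (rule fun_space.subspaceI) (auto simp: fun_scale_def)
  have "\<exists>a\<in>homog par 0 \<inter> fun_space.span X. \<exists>b\<in>homog par 1 \<inter> fun_space.span X. v = a + b"
    if "v \<in> fun_space.span X" for v
    using that
  proof (induction rule: fun_space.span_induct_alt)
    case base
    show ?case by (intro bexI[of _ 0]) (auto intro: fun_space.span_zero)
  next
    case (step c u v)
    then obtain a b where ab: "a \<in> homog par 0" "a \<in> fun_space.span X" "b \<in> homog par 1"
      "b \<in> fun_space.span X" "v = a + b" by blast
    have u: "fun_scale c u \<in> fun_space.span X"
      using step by (intro fun_space.span_scale fun_space.span_base)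
    obtain p where "u \<in> homog par p" using hom step(1) by blast
    hence p: "fun_scale c u \<in> homog par p" by (rule fun_space.subspace_scale[OF hsub])
    show ?case
    proof (cases p)
      case zero
      hence "fun_scale c u + a \<in> homog par 0" using p ab by (intro fun_space.subspace_add[OF hsub]) auto
      thus ?thesis using ab u
        by (intro bexI[of _ "fun_scale c u + a"] bexI[of _ b] IntI fun_space.span_add) (auto simp: add.assoc)
    next
      case one
      hence "fun_scale c u + b \<in> homog par 1" using p ab by (intro fun_space.subspace_add[OF hsub]) auto
      thus ?thesis using ab u
        by (intro bexI[of _ a] bexI[of _ "fun_scale c u + b"] IntI fun_space.span_add)
          (auto simp: algebra_simps)
    qed
  qed
  moreover have "\<rho> y u \<in> fun_space.span X" if "u \<in> fun_space.span X" for y u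
    using that
  proof (induction rule: fun_space.span_induct_alt)
    case base
    show ?case by (simp only: op_zero_right fun_space.span_zero)
  next
    case (step c u v)
    have "\<rho> y (fun_scale c u + v) \<in> fun_space.span X"
      using step act by (simp add: op_add_right op_scale_right fun_space.span_add fun_space.span_scale)
    thus ?case .
  qed
  moreover have "submodule (fun_space.span X) complex_ring ?M"
    by (rule module.submoduleI[OF M], unfold minus)
      (auto simp: coord_module_def intro: fun_space.span_zero fun_space.span_neg fun_space.span_add
        fun_space.span_scale)
  ultimately show ?thesis
    unfolding is_subsupermodule_def by (simp add: coord_module_def)
qed

lemma irreducible_span:
  assumes irr: "irreducible_supermodule (coord_module par \<rho>)"
    and hom: "\<And>u. u \<in> X \<Longrightarrow> \<exists>p. u \<in> homog par p"
    and act: "\<And>y u. u \<in> X \<Longrightarrow> \<rho> y u \<in> fun_space.span X"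
  shows "fun_space.span X = {0} \<or> fun_space.span X = UNIV"
proof -
  have "is_supermodule (coord_module par \<rho>)" using irr by (simp add: irreducible_supermodule_def)
  from coord_subsupermodule[OF this hom act] irr show ?thesis
    unfolding irreducible_supermodule_def by (auto simp: coord_module_def)
qed

locale osp_rep = super_rep scale op
  for scale :: "complex \<Rightarrow> 'v::ab_group_add \<Rightarrow> 'v" (infixr \<open>*s\<close> 75)
    and op :: "osp12 \<Rightarrow> 'v \<Rightarrow> 'v"
begin

lemma op_e: "op osp_e u = op osp_gp (op osp_gp u)"
proof -
  have "2 *s op osp_e u = 2 *s op osp_gp (op osp_gp u)"
    using op_lbr[OF osp12_parity(4,4), of u] scale_left_distrib[of 1 1 "op osp_gp (op osp_gp u)"]
    by (simp add: osp12_brackets op_scale_left ksign_def)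
  thus ?thesis by (subst (asm) scale_cancel_left) simp
qed

lemma op_f: "op osp_f u = - op osp_gm (op osp_gm u)"
proof -
  have "(-2) *s op osp_f u = (-2) *s (- op osp_gm (op osp_gm u))"
    using op_lbr[OF osp12_parity(5,5), of u] scale_left_distrib[of 1 1 "op osp_gm (op osp_gm u)"]
    by (simp add: osp12_brackets op_scale_left ksign_def)
  thus ?thesis by (subst (asm) scale_cancel_left) simp
qed

lemma op_h: "op osp_h u = op osp_gp (op osp_gm u) + op osp_gm (op osp_gp u)"
  using op_lbr[OF osp12_parity(4,5), of u] by (simp add: osp12_brackets ksign_def)

lemma op_h_gp: "op osp_h (op osp_gp u) = op osp_gp (op osp_h u) + op osp_gp u"
  using op_lbr[OF osp12_parity(2,4), of u] by (simp add: osp12_brackets ksign_def algebra_simps)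

lemma op_h_gm: "op osp_h (op osp_gm u) = op osp_gm (op osp_h u) - op osp_gm u"
  using op_lbr[OF osp12_parity(2,5), of u]
  by (simp add: osp12_brackets ksign_def op_minus_left algebra_simps)

lemma op_expand: "op y u = co_e y *s op osp_e u + co_h y *s op osp_h u + co_f y *s op osp_f u +
    co_gp y *s op osp_gp u + co_gm y *s op osp_gm u"
  by (subst osp12_expand[of y]) (simp only: op_add_left op_scale_left)

text \<open>\<open>g^+\<close> and \<open>g^-\<close> generate osp(1,2).\<close>

lemma op_stable:
  assumes "subspace N" and gp: "\<And>u. u \<in> N \<Longrightarrow> op osp_gp u \<in> N"
    and gm: "\<And>u. u \<in> N \<Longrightarrow> op osp_gm u \<in> N" and u: "u \<in> N"
  shows "op y u \<in> N"
  unfolding op_expand[of y u] unfolding op_e op_f op_h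
  using assms by (intro subspace_add subspace_scale subspace_neg) auto

end

text \<open>The module \<open>V\<close> as the \<open>g^+\<close>-string of its lowest weight
  vector. The sequence \<open>x\<close> is infinite, so that \<open>gp_x\<close> and
  \<open>h_x\<close> hold without a bound on \<open>k\<close>.\<close>

locale osp_fundamental = osp_rep fun_scale \<rho>
  for \<rho> :: "osp12 \<Rightarrow> ('b::finite \<Rightarrow> complex) \<Rightarrow> 'b \<Rightarrow> complex" +
  fixes par :: "'b \<Rightarrow> bit" and x :: "nat \<Rightarrow> 'b \<Rightarrow> complex"
  assumes par_op: "hcomp p y = y \<Longrightarrow> v \<in> homog par q \<Longrightarrow> \<rho> y v \<in> homog par (p + q)"
    and x_homog: "x k \<in> homog par (of_nat k)"
    and h_x: "\<rho> osp_h (x k) = fun_scale (of_nat k - 1) (x k)"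
    and gm_x0: "\<rho> osp_gm (x 0) = 0"
    and gp_x: "\<rho> osp_gp (x k) = x (Suc k)"
    and span_x: "fun_space.span (x ` {..<3}) = UNIV"

text \<open>Computing \<open>g^- x_k\<close> gives \<open>g^- x_3 = 0\<close>, so
  \<open>x_3, x_4, ...\<close> span a submodule. It misses \<open>x_0\<close>, hence is zero by
  irreducibility, while all \<open>x_k\<close> together span \<open>V\<close>.\<close>

lemma three_dim_fundamental:
  fixes \<rho> :: "osp12 \<Rightarrow> ('b::finite \<Rightarrow> complex) \<Rightarrow> 'b \<Rightarrow> complex"
  assumes irr: "irreducible_supermodule (coord_module par \<rho>)"
    and low: "even_lowest_weight_vector (coord_module par \<rho>) (-1) v"
  shows "osp_fundamental \<rho> par (\<lambda>k. (\<rho> osp_gp ^^ k) v)"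
proof -
  have sm: "is_supermodule (coord_module par \<rho>)" using irr by (simp add: irreducible_supermodule_def)
  interpret super_rep fun_scale \<rho> by (rule coord_module_super_rep[OF sm])
  interpret osp_rep fun_scale \<rho> ..
  note par_op = coord_module_super_rep(2)[OF sm]
  define x where "x = (\<lambda>k. (\<rho> osp_gp ^^ k) v)"
  have v: "v \<in> homog par 0" "v \<noteq> 0" "\<rho> osp_gm v = 0" "\<rho> osp_h v = fun_scale (-1) v"
    using low by (auto simp: even_lowest_weight_vector_def coord_module_def)
  have gp: "\<rho> osp_gp (x k) = x (Suc k)" for k by (simp add: x_def)
  have hom: "x k \<in> homog par (of_nat k)" for k
  proof (induction k)
    case 0
    show ?case using v(1) by (simp add: x_def)
  next
    case (Suc k)
    show ?case using par_op[OF osp12_parity(4) Suc] gp by simp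
  qed
  have h: "\<rho> osp_h (x k) = fun_scale (of_nat k - 1) (x k)" for k
  proof (induction k)
    case 0
    show ?case using v(4) by (simp add: x_def)
  next
    case (Suc k)
    have "\<rho> osp_h (x (Suc k)) = \<rho> osp_gp (fun_scale (of_nat k - 1) (x k)) + x (Suc k)"
      using op_h_gp[of "x k"] by (simp add: Suc gp)
    also have "\<dots> = fun_scale (of_nat k - 1) (x (Suc k)) + fun_scale 1 (x (Suc k))"
      by (simp add: op_scale_right gp)
    also have "\<dots> = fun_scale (of_nat (Suc k) - 1) (x (Suc k))"
      by (subst fun_space.scale_left_distrib[symmetric]) simp
    finally show ?case .
  qed
  have gm_0: "\<rho> osp_gm (x 0) = 0" using v(3) by (simp add: x_def)
  \<comment> \<open>This is \<open>h = g^+ g^- + g^- g^+\<close> applied to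
    \<open>x k\<close>.\<close>
  have gm: "\<rho> osp_gm (x (Suc k)) = fun_scale (of_nat k - 1) (x k) - \<rho> osp_gp (\<rho> osp_gm (x k))" for k
    using op_h[of "x k"] by (simp add: h gp algebra_simps)
  have gm_1: "\<rho> osp_gm (x 1) = - x 0" using gm[of 0] by (simp add: gm_0)
  have gm_2: "\<rho> osp_gm (x 2) = x 1"
    using gm[of 1] gm_1 by (simp add: op_minus_right gp numeral_2_eq_2)
  have gm_3: "\<rho> osp_gm (x 3) = 0"
    using gm[of 2] gm_2 by (simp add: gp numeral_2_eq_2 numeral_3_eq_3)
  have gm_mult: "\<exists>c. \<rho> osp_gm (x (Suc k)) = fun_scale c (x k)" for k
  proof (induction k)
    case 0
    show ?case using gm_1 by (intro exI[of _ "-1"]) simp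
  next
    case (Suc k)
    then obtain c where "\<rho> osp_gm (x (Suc k)) = fun_scale c (x k)" by blast
    thus ?case
      by (intro exI[of _ "of_nat (Suc k) - 1 - c"])
        (simp add: gm[of "Suc k"] op_scale_right gp fun_space.scale_left_diff_distrib)
  qed
  \<comment> \<open>The two values of \<open>r\<close> are those used below; in both cases
    \<open>g^- x_r = 0\<close>, so that the span is stable under \<open>g^-\<close>.\<close>
  have act: "\<rho> y u \<in> fun_space.span (x ` {r..})" if u: "u \<in> x ` {r..}" and r: "r = 0 \<or> r = 3" for y u r
  proof (rule op_stable)
    fix w assume "w \<in> fun_space.span (x ` {r..})"
    hence "\<rho> osp_gp w \<in> fun_space.span (x ` {r..}) \<and> \<rho> osp_gm w \<in> fun_space.span (x ` {r..})"
    proof (induction rule: fun_space.span_induct_alt)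
      case base
      show ?case by (simp only: op_zero_right fun_space.span_zero simp_thms)
    next
      case (step c w z)
      then obtain k where k: "w = x k" "k \<ge> r" by auto
      have "\<rho> osp_gp w \<in> fun_space.span (x ` {r..})"
        using k by (auto simp: gp intro!: fun_space.span_base)
      moreover have "\<rho> osp_gm w \<in> fun_space.span (x ` {r..})"
      proof (cases "k = r")
        case True
        thus ?thesis using r k gm_0 gm_3 by (auto intro: fun_space.span_zero)
      next
        case False
        then obtain l where l: "k = Suc l" "l \<ge> r" using k(2) by (cases k) auto
        obtain c where c: "\<rho> osp_gm (x (Suc l)) = fun_scale c (x l)" using gm_mult by blast
        show ?thesis unfolding k(1) l(1) c
          by (rule fun_space.span_scale[OF fun_space.span_base]) (use l in simp)
      qed
      ultimately have "\<rho> osp_gp (fun_scale c w + z) \<in> fun_space.span (x ` {r..}) \<and>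
          \<rho> osp_gm (fun_scale c w + z) \<in> fun_space.span (x ` {r..})"
        using step(2) by (simp add: op_add_right op_scale_right fun_space.span_add fun_space.span_scale)
      thus ?case .
    qed
    thus "\<rho> osp_gp w \<in> fun_space.span (x ` {r..})" "\<rho> osp_gm w \<in> fun_space.span (x ` {r..})" by auto
  qed (use u in \<open>auto intro: fun_space.span_base\<close>)
  have span0: "fun_space.span (x ` {0..}) = UNIV"
  proof -
    have "x 0 \<in> fun_space.span (x ` {0..})" by (intro fun_space.span_base) simp
    hence "fun_space.span (x ` {0..}) \<noteq> {0}" using v(2) by (auto simp: x_def)
    thus ?thesis using irreducible_span[OF irr, of "x ` {0..}"] hom act by blast
  qed
  have x3: "x 3 = 0"
  proof -
    \<comment> \<open>\<open>h + 1\<close> is injective on the span of \<open>x 3, x 4, \<dots>\<close>, whereas it annihilates \<open>x 0\<close>.\<close>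
    have "\<exists>J c. finite J \<and> J \<subseteq> {3..} \<and> u = (\<Sum>k\<in>J. fun_scale (c k) (x k))"
      if "u \<in> fun_space.span (x ` {3..})" for u
    proof -
      obtain t r where tr: "finite t" "t \<subseteq> x ` {3..}" "u = (\<Sum>a\<in>t. fun_scale (r a) a)"
        using \<open>u \<in> fun_space.span (x ` {3..})\<close> unfolding fun_space.span_explicit by blast
      obtain J where "J \<subseteq> {3..}" "inj_on x J" "t = x ` J"
        using tr(2) unfolding subset_image_inj by blast
      hence J: "J \<subseteq> {3..}" "finite J" "t = x ` J" "inj_on x J"
        using tr(1) by (auto dest: finite_imageD)
      hence "u = (\<Sum>k\<in>J. fun_scale (r (x k)) (x k))" using tr(3) by (simp add: sum.reindex)
      thus ?thesis using J(1,2) by (intro exI[of _ J] exI[of _ "\<lambda>k. r (x k)"] conjI)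
    qed
    note expl = this
    \<comment> \<open>Eigenvectors of \<open>h\<close> with distinct eigenvalues are independent;
      the eigenvalue of index \<open>m\<close> is eliminated by \<open>h - (m - 1)\<close>.\<close>
    have eig: "(\<forall>k\<in>J. w k = 0)"
      if "finite J" "\<And>k. k \<in> J \<Longrightarrow> \<rho> osp_h (w k) = fun_scale (of_nat k - 1) (w k)" "(\<Sum>k\<in>J. w k) = 0"
      for J :: "nat set" and w
      using that
    proof (induction J arbitrary: w rule: finite_induct)
      case (insert m J)
      have hsum: "\<rho> osp_h (\<Sum>k\<in>A. w k) = (\<Sum>k\<in>A. \<rho> osp_h (w k))" for A
        by (induction A rule: infinite_finite_induct) (simp_all add: op_add_right del: plus_fun_apply zero_fun_apply)
      have u: "\<rho> osp_h (w k) - fun_scale (of_nat m - 1) (w k) = fun_scale (of_nat k - of_nat m) (w k)"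
        if "k \<in> insert m J" for k
        by (simp only: insert.prems(1)[OF that] fun_space.scale_left_diff_distrib[symmetric]) simp
      have "(\<Sum>k\<in>J. fun_scale (of_nat k - of_nat m) (w k)) =
          (\<Sum>k\<in>insert m J. fun_scale (of_nat k - of_nat m) (w k))"
        by (subst sum.insert[OF insert.hyps]) simp
      also have "\<dots> = (\<Sum>k\<in>insert m J. \<rho> osp_h (w k) - fun_scale (of_nat m - 1) (w k))"
        by (rule sum.cong[OF refl u[symmetric]])
      also have "\<dots> = \<rho> osp_h (\<Sum>k\<in>insert m J. w k) - fun_scale (of_nat m - 1) (\<Sum>k\<in>insert m J. w k)"
        by (simp only: hsum fun_space.scale_sum_right sum_subtractf)
      also have "\<dots> = 0" using insert.prems(2) by (simp only: op_zero_right fun_space.scale_zero_right diff_0_right)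
      finally have "\<forall>k\<in>J. fun_scale (of_nat k - of_nat m) (w k) = 0"
        using insert.prems(1)
        by (intro insert.IH[of "\<lambda>k. fun_scale (of_nat k - of_nat m) (w k)"])
          (simp_all only: op_scale_right fun_space.scale_left_commute insert_iff simp_thms)
      hence J: "\<forall>k\<in>J. w k = 0" using insert.hyps(2) by auto
      thus ?case using insert.prems(2) insert.hyps by (simp del: plus_fun_apply zero_fun_apply)
    qed simp
    have "x 0 \<notin> fun_space.span (x ` {3..})"
    proof
      assume "x 0 \<in> fun_space.span (x ` {3..})"
      then obtain J c where J: "finite J" "J \<subseteq> {3..}" "x 0 = (\<Sum>k\<in>J. fun_scale (c k) (x k))"
        using expl by blast
      define w where "w = (\<lambda>k. if k = 0 then - x 0 else fun_scale (c k) (x k))"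
      have "0 \<notin> J" using J(2) by auto
      hence "(\<Sum>k\<in>J. w k) = (\<Sum>k\<in>J. fun_scale (c k) (x k))"
        by (intro sum.cong) (auto simp: w_def)
      hence "(\<Sum>k\<in>insert 0 J. w k) = 0"
        using J \<open>0 \<notin> J\<close> by (simp add: w_def)
      moreover have "\<rho> osp_h (w k) = fun_scale (of_nat k - 1) (w k)" for k
        by (simp add: w_def h op_minus_right op_scale_right mult.commute)
      ultimately have "w 0 = 0" using eig[of "insert 0 J" w] J(1) by blast
      thus False using v(2) by (simp add: w_def x_def)
    qed
    hence "fun_space.span (x ` {3..}) = {0}"
      using irreducible_span[OF irr, of "x ` {3..}"] hom act by blast
    moreover have "x 3 \<in> fun_space.span (x ` {3..})" by (intro fun_space.span_base) auto
    ultimately show ?thesis by blast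
  qed
  have xk: "x k = 0" if "k \<ge> 3" for k
    using that
  proof (induction k rule: dec_induct)
    case (step k)
    have "x (Suc k) = 0" by (simp only: gp[symmetric] step.IH op_zero_right)
    thus ?case .
  qed (rule x3)
  have "x k \<in> fun_space.span (x ` {..<3})" for k
    by (cases "k < 3") (auto simp: xk intro: fun_space.span_base fun_space.span_zero)
  hence "fun_space.span (x ` {0..}) \<subseteq> fun_space.span (x ` {..<3})"
    by (intro fun_space.span_minimal) auto
  hence "fun_space.span (x ` {..<3}) = UNIV" using span0 by auto
  thus ?thesis
    using par_op hom h gm_0 gp by unfold_locales (simp_all add: x_def)
qed

section \<open>Tensor products of evaluation modules\<close>

lemma eval_current_eq:
  assumes "degree y \<le> N"
  shows "eval_current z y = (\<Sum>k\<le>N. (z ^ k) *\<^sub>C coeff y k)"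
  unfolding eval_current_def using assms
  by (intro sum.mono_neutral_left) (auto simp: coeff_eq_0 not_le)

lemma eval_current_add: "eval_current z (x + y) = eval_current z x + eval_current z y"
proof -
  define N where "N = max (degree x) (degree y)"
  have "degree (x + y) \<le> N" "degree x \<le> N" "degree y \<le> N"
    by (auto simp: N_def degree_add_le_max)
  thus ?thesis by (simp add: eval_current_eq[of _ N] scaleC_add_right sum.distrib)
qed

lemma eval_current_monom: "eval_current z (monom a k) = (z ^ k) *\<^sub>C a"
proof -
  have "eval_current z (monom a k) = (\<Sum>j\<le>k. (z ^ j) *\<^sub>C coeff (monom a k) j)"
    by (rule eval_current_eq) (simp add: degree_monom_le)
  also have "\<dots> = (\<Sum>j\<le>k. if j = k then (z ^ k) *\<^sub>C a else 0)"
    by (intro sum.cong) auto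
  finally show ?thesis by simp
qed

lemma eval_current_scaleC: "eval_current z (c *\<^sub>C y) = c *\<^sub>C eval_current z y"
  by (induction y rule: poly_monom_induct)
    (simp_all add: scaleC_monom eval_current_monom scaleC_scaleC mult.commute scaleC_add_right
      eval_current_add)

lemma eval_current_hcomp: "eval_current z (hcomp p y) = hcomp p (eval_current z y)"
  by (induction y rule: poly_monom_induct)
    (simp_all add: hcomp_monom eval_current_monom hcomp_scaleC hcomp_add eval_current_add)

lemma eval_current_lbr: "eval_current z (lbr x y) = lbr (eval_current z x) (eval_current z y)"
proof (induction x rule: poly_monom_induct)
  case (monom a i)
  show ?case
    by (induction y rule: poly_monom_induct)
      (simp_all add: lbr_monom eval_current_monom lbr_scaleC_left lbr_scaleC_right scaleC_scaleC
        power_add lbr_add_right eval_current_add mult.commute)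
qed (simp add: lbr_add_left eval_current_add)

lemma pure_tensor_upd:
  assumes "i < n"
  shows "pure_tensor n (v(i := u)) l =
    (if length l = n then u (l ! i) * (\<Prod>j\<in>{..<n} - {i}. v j (l ! j)) else 0)"
proof -
  have "(\<Prod>j<n. (v(i := u)) j (l ! j)) = u (l ! i) * (\<Prod>j\<in>{..<n} - {i}. (v(i := u)) j (l ! j))"
    using assms by (subst prod.remove[of _ i]) auto
  also have "(\<Prod>j\<in>{..<n} - {i}. (v(i := u)) j (l ! j)) = (\<Prod>j\<in>{..<n} - {i}. v j (l ! j))"
    by (intro prod.cong) auto
  finally show ?thesis by (simp add: pure_tensor_def)
qed

lemma pure_tensor_upd_add:
  "i < n \<Longrightarrow> pure_tensor n (v(i := a + b)) = pure_tensor n (v(i := a)) + pure_tensor n (v(i := b))"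
  by (rule ext) (simp add: pure_tensor_upd algebra_simps)

lemma pure_tensor_upd_scale:
  "i < n \<Longrightarrow> pure_tensor n (v(i := fun_scale c a)) = fun_scale c (pure_tensor n (v(i := a)))"
  by (rule ext) (simp add: pure_tensor_upd fun_scale_def)

lemma pure_tensor_upd_diff:
  "i < n \<Longrightarrow> pure_tensor n (v(i := a - b)) = pure_tensor n (v(i := a)) - pure_tensor n (v(i := b))"
  by (rule ext) (simp add: pure_tensor_upd algebra_simps)

lemma pure_tensor_upd_zero: "i < n \<Longrightarrow> pure_tensor n (v(i := 0)) = 0"
  by (rule ext) (simp add: pure_tensor_upd)

lemma pure_tensor_cong: "(\<And>i. i < n \<Longrightarrow> v i = w i) \<Longrightarrow> pure_tensor n v = pure_tensor n w"
  unfolding pure_tensor_def by (intro ext) (auto intro!: prod.cong)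

lemma pure_tensor_carrier: "pure_tensor n v \<in> tensor_carrier n"
  by (simp add: pure_tensor_def tensor_carrier_def)

lemma subspace_tensor_carrier: "fun_space.subspace (tensor_carrier n)"
  by (rule fun_space.subspaceI) (auto simp: tensor_carrier_def fun_scale_def)

lemma subspace_tensor_part: "fun_space.subspace (tensor_part n par p)"
  by (rule fun_space.subspaceI) (auto simp: tensor_part_def tensor_carrier_def fun_scale_def)

lemma pure_tensor_part:
  assumes "\<And>i. i < n \<Longrightarrow> v i \<in> homog par (p i)"
  shows "pure_tensor n v \<in> tensor_part n (\<lambda>_. par) (\<Sum>i<n. p i)"
proof -
  have "pure_tensor n v l = 0" if "length l = n" "(\<Sum>i<n. par (l ! i)) \<noteq> (\<Sum>i<n. p i)" for l
  proof (rule ccontr)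
    assume nz: "pure_tensor n v l \<noteq> 0"
    have "par (l ! i) = p i" if "i < n" for i
      using nz assms[OF that] that \<open>length l = n\<close> by (auto simp: pure_tensor_def)
    thus False using that(2) by simp
  qed
  thus ?thesis by (simp add: tensor_part_def pure_tensor_carrier)
qed

section \<open>Unit tensors\<close>

definition unit_vec :: "'b \<Rightarrow> 'b \<Rightarrow> complex" where
  "unit_vec b = (\<lambda>c. if c = b then 1 else 0)"

abbreviation unit_tensor :: "'b list \<Rightarrow> 'b list \<Rightarrow> complex" where
  "unit_tensor l \<equiv> pure_tensor (length l) (\<lambda>i. unit_vec (l ! i))"

lemma unit_tensor_eq: "unit_tensor l = (\<lambda>k. if k = l then 1 else 0)"
proof
  fix k :: "'a list"
  show "unit_tensor l k = (if k = l then 1 else 0)"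
  proof (cases "length k = length l \<and> k \<noteq> l")
    case True
    then obtain i where "i < length l" "k ! i \<noteq> l ! i" by (metis nth_equalityI)
    thus ?thesis using True by (auto simp: pure_tensor_def unit_vec_def)
  qed (auto simp: pure_tensor_def unit_vec_def)
qed

lemma finite_lists_of_length: "finite {l :: 'b::finite list. length l = n}"
  using finite_lists_length_eq[of "UNIV :: 'b set" n] by simp

lemma sum_fun_apply: "(\<Sum>i\<in>A. f i) l = (\<Sum>i\<in>A. f i l :: complex)"
  by (induction A rule: infinite_finite_induct) auto

lemma tensor_expand:
  assumes "u \<in> tensor_carrier n"
  shows "u = (\<Sum>l | length l = n. fun_scale (u l) (unit_tensor (l :: 'b::finite list)))"
proof
  fix k
  have "(\<Sum>l | length l = n. fun_scale (u l) (unit_tensor l)) k =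
      (\<Sum>l | length l = n. if l = k then u k else 0)"
    unfolding sum_fun_apply by (intro sum.cong) (auto simp: unit_tensor_eq fun_scale_def)
  also have "\<dots> = u k"
    using assms by (subst sum.delta[OF finite_lists_of_length]) (auto simp: tensor_carrier_def)
  finally show "u k = (\<Sum>l | length l = n. fun_scale (u l) (unit_tensor l)) k" ..
qed

lemma tensor_part_span:
  fixes par :: "'b::finite \<Rightarrow> bit"
  assumes u: "u \<in> tensor_part n (\<lambda>_. par) p"
  shows "u \<in> fun_space.span {unit_tensor l |l. length l = n \<and> (\<Sum>i<n. par (l ! i)) = p}" (is "_ \<in> ?S")
proof -
  have "fun_scale (u l) (unit_tensor l) \<in> ?S" if "length l = n" for l
  proof (cases "(\<Sum>i<n. par (l ! i)) = p")
    case True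
    show ?thesis
      by (rule fun_space.span_scale[OF fun_space.span_base]) (use True that in blast)
  next
    case False
    hence "u l = 0" using u that by (simp add: tensor_part_def)
    thus ?thesis by (simp only: fun_space.scale_zero_left fun_space.span_zero)
  qed
  hence "(\<Sum>l | length l = n. fun_scale (u l) (unit_tensor l)) \<in> ?S"
    by (intro fun_space.span_sum) auto
  thus ?thesis using tensor_expand[of u n] u by (simp add: tensor_part_def)
qed

lemma tensor_part_disjoint:
  assumes "u \<in> tensor_part n par 0" "u \<in> tensor_part n par 1"
  shows "u = 0"
proof
  fix l
  show "u l = 0 l"
    using assms by (cases "\<Sum>i<n. par i (l ! i)"; cases "length l = n")
      (auto simp: tensor_part_def tensor_carrier_def)
qed

section \<open>The action of currents on the tensor product\<close>

context osp_fundamental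
begin

definition T :: "nat \<Rightarrow> (nat \<Rightarrow> complex) \<Rightarrow> osp12 poly \<Rightarrow> ('b list \<Rightarrow> complex) \<Rightarrow> 'b list \<Rightarrow> complex" where
  "T n z = tensor_act n (\<lambda>_. par) (\<lambda>i y. \<rho> (eval_current (z i) y))"

lemma T_carrier: "T n z y u \<in> tensor_carrier n"
  by (simp add: T_def tensor_act_def tensor_carrier_def)

lemma T_pure:
  assumes v: "\<And>i. i < n \<Longrightarrow> v i \<in> homog par (p i)" and y: "hcomp q y = y"
  shows "T n z y (pure_tensor n v) =
    (\<Sum>i<n. fun_scale (ksign (q * (\<Sum>j<i. p j)))
      (pure_tensor n (v(i := \<rho> (eval_current (z i) y) (v i)))))"
  unfolding T_def
proof (rule tensor_act_pure_tensor[OF _ _ _ y])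
  show "\<rho> (eval_current (z i) 0) w = 0" for i w
    using eval_current_monom[of "z i" "0 :: osp12" 0] by simp
  show "v i \<in> part (coord_module par (\<lambda>y. \<rho> (eval_current (z i) y))) (p i)" if "i < n" for i
    using v[OF that] by (simp add: coord_module_def)
qed (rule op_scale_right)

lemma T_add_right: "T n z y (u + w) = T n z y u + T n z y w"
proof
  fix l
  have "(\<lambda>b. (u + w) (l[i := b])) = (\<lambda>b. u (l[i := b])) + (\<lambda>b. w (l[i := b]))" for i
    by (rule ext) simp
  thus "T n z y (u + w) l = (T n z y u + T n z y w) l"
    by (simp add: T_def tensor_act_def op_add_right sum.distrib algebra_simps)
qed

lemma T_scale_right: "T n z y (fun_scale c u) = fun_scale c (T n z y u)"
proof
  fix l
  have "(\<lambda>b. fun_scale c u (l[i := b])) = fun_scale c (\<lambda>b. u (l[i := b]))" for i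
    by (rule ext) (simp add: fun_scale_def)
  thus "T n z y (fun_scale c u) l = fun_scale c (T n z y u) l"
    by (simp add: T_def tensor_act_def op_scale_right)
      (simp add: fun_scale_def sum_distrib_left algebra_simps)
qed

lemma T_add_left: "T n z (s + y) u = T n z s u + T n z y u"
  by (rule ext) (simp add: T_def tensor_act_def hcomp_add eval_current_add op_add_left sum.distrib
      algebra_simps)

lemma T_scale_left: "T n z (c *\<^sub>C y) u = fun_scale c (T n z y u)"
  by (rule ext) (simp add: T_def tensor_act_def hcomp_scaleC eval_current_scaleC op_scale_left,
      simp add: fun_scale_def sum_distrib_left algebra_simps)

lemma T_zero_right: "T n z y 0 = 0"
  using T_scale_right[of n z y 0 0] by simp

lemma T_sum_right: "T n z y (\<Sum>i\<in>A. f i) = (\<Sum>i\<in>A. T n z y (f i))"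
  by (induction A rule: infinite_finite_induct)
    (simp_all add: T_add_right T_zero_right del: plus_fun_apply zero_fun_apply)

text \<open>Allows identities that hold on tensors to be extended to the whole function type, on
  which representations are modelled.\<close>

lemma T_restrict:
  assumes "\<And>l. length l = n \<Longrightarrow> u l = w l"
  shows "T n z y u = T n z y w"
proof
  fix l
  have "(\<lambda>b. u (l[i := b])) = (\<lambda>b. w (l[i := b]))" if "length l = n" for i
    using assms that by auto
  thus "T n z y u l = T n z y w l" by (simp add: T_def tensor_act_def)
qed

text \<open>Acting on factor \<open>i\<close> changes its parity by \<open>q\<close>. The second
  operator passes that factor only when it acts on a later one, hence the extra sign for
  \<open>i < k\<close>.\<close>

lemma T_pure_twice:
  assumes v: "\<And>i. i < n \<Longrightarrow> v i \<in> homog par (p i)" and s: "hcomp r s = s" and y: "hcomp q y = y"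
  shows "T n z s (T n z y (pure_tensor n v)) =
    (\<Sum>i<n. \<Sum>k<n. fun_scale (ksign (q * (\<Sum>j<i. p j)) * (ksign (r * (\<Sum>j<k. p j)) *
        (if i < k then ksign (r * q) else 1)))
      (pure_tensor n ((v(i := \<rho> (eval_current (z i) y) (v i)))
        (k := \<rho> (eval_current (z k) s) ((v(i := \<rho> (eval_current (z i) y) (v i))) k)))))"
proof -
  have S: "(\<Sum>j<k. (p(i := q + p i)) j) = (\<Sum>j<k. p j) + (if i < k then q else 0)" for i k
  proof -
    have "(\<Sum>j<k. (p(i := q + p i)) j) = (\<Sum>j<k. p j + (if j = i then q else 0))"
      by (intro sum.cong) (auto simp: add.commute)
    also have "\<dots> = (\<Sum>j<k. p j) + (\<Sum>j<k. if j = i then q else 0)" by (rule sum.distrib)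
    finally show ?thesis by (simp only: sum.delta finite_lessThan lessThan_iff)
  qed
  have sgn: "ksign (r * (\<Sum>j<k. (p(i := q + p i)) j)) =
      ksign (r * (\<Sum>j<k. p j)) * (if i < k then ksign (r * q) else 1)" for i k
    unfolding S distrib_left ksign_add
    by (cases "i < k") (simp_all only: if_True if_False mult_zero_right ksign_0)
  have step: "T n z s (pure_tensor n (v(i := \<rho> (eval_current (z i) y) (v i)))) =
    (\<Sum>k<n. fun_scale (ksign (r * (\<Sum>j<k. p j)) * (if i < k then ksign (r * q) else 1))
      (pure_tensor n ((v(i := \<rho> (eval_current (z i) y) (v i)))
        (k := \<rho> (eval_current (z k) s) ((v(i := \<rho> (eval_current (z i) y) (v i))) k)))))"
    if i: "i < n" for i
  proof -
    have "hcomp q (eval_current (z i) y) = eval_current (z i) y"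
      by (simp add: y flip: eval_current_hcomp)
    hence "\<rho> (eval_current (z i) y) (v i) \<in> homog par (q + p i)" by (rule par_op[OF _ v[OF i]])
    hence "(v(i := \<rho> (eval_current (z i) y) (v i))) j \<in> homog par ((p(i := q + p i)) j)" if "j < n" for j
      using v[OF that] by (cases "j = i") simp_all
    from T_pure[where z = z, OF this s] show ?thesis by (simp only: sgn)
  qed
  have "T n z y (pure_tensor n v) = (\<Sum>i<n. fun_scale (ksign (q * (\<Sum>j<i. p j)))
      (pure_tensor n (v(i := \<rho> (eval_current (z i) y) (v i)))))"
    by (rule T_pure[OF v y])
  thus ?thesis
    apply (simp only: T_sum_right T_scale_right)
    by (rule sum.cong[OF refl]) (simp_all only: step lessThan_iff fun_space.scale_sum_right fun_space.scale_scale)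
qed

text \<open>Operators on different factors supercommute, so the off-diagonal terms of the double
  sums cancel; each diagonal term is the bracket relation in a single factor.\<close>

lemma T_lbr_pure:
  assumes v: "\<And>i. i < n \<Longrightarrow> v i \<in> homog par (p i)" and s: "hcomp r s = s" and y: "hcomp q y = y"
  shows "T n z (lbr s y) (pure_tensor n v) =
    T n z s (T n z y (pure_tensor n v)) - fun_scale (ksign (r * q)) (T n z y (T n z s (pure_tensor n v)))"
proof -
  define X Y where "X = (\<lambda>i. \<rho> (eval_current (z i) s))" and "Y = (\<lambda>i. \<rho> (eval_current (z i) y))"
  define A where "A = (\<lambda>i k. fun_scale (ksign (q * (\<Sum>j<i. p j)) * (ksign (r * (\<Sum>j<k. p j)) *
        (if i < k then ksign (r * q) else 1)))
      (pure_tensor n ((v(i := Y i (v i)))(k := X k ((v(i := Y i (v i))) k)))))"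
  define B where "B = (\<lambda>i k. fun_scale (ksign (r * (\<Sum>j<i. p j)) * (ksign (q * (\<Sum>j<k. p j)) *
        (if i < k then ksign (q * r) else 1)))
      (pure_tensor n ((v(i := X i (v i)))(k := Y k ((v(i := X i (v i))) k)))))"
  define D where "D = (\<lambda>i. fun_scale (ksign ((r + q) * (\<Sum>j<i. p j)))
    (pure_tensor n (v(i := \<rho> (eval_current (z i) (lbr s y)) (v i)))))"
  have sign_swap: "a * (b * (if i < k then c else 1)) = c * (b * (a * (if k < i then c else 1)))"
    if "c * c = 1" "i \<noteq> k" for a b c :: complex and i k :: nat
    using that by (cases "i < k") (auto simp: algebra_simps)
  have AB: "A i k - fun_scale (ksign (r * q)) (B k i) = (if i = k then D i else 0)"
    if ik: "i < n" "k < n" for i k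
  proof (cases "i = k")
    case False
    have "(v(i := Y i (v i)))(k := X k (v k)) = (v(k := X k (v k)))(i := Y i (v i))"
      using False by (rule fun_upd_twist[symmetric, OF not_sym])
    moreover have "ksign (q * (\<Sum>j<i. p j)) * (ksign (r * (\<Sum>j<k. p j)) * (if i < k then ksign (r * q) else 1)) =
      ksign (r * q) * (ksign (r * (\<Sum>j<k. p j)) * (ksign (q * (\<Sum>j<i. p j)) *
        (if k < i then ksign (q * r) else 1)))"
      unfolding mult.commute[of q r] by (rule sign_swap[OF ksign_square False])
    ultimately show ?thesis using False by (simp add: A_def B_def)
  next
    case True
    have hom: "hcomp r (eval_current (z i) s) = eval_current (z i) s"
      "hcomp q (eval_current (z i) y) = eval_current (z i) y"
      by (simp_all add: s y flip: eval_current_hcomp)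
    have eq: "\<rho> (eval_current (z i) (lbr s y)) (v i) = X i (Y i (v i)) - fun_scale (ksign (r * q)) (Y i (X i (v i)))"
      unfolding X_def Y_def eval_current_lbr by (rule op_lbr[OF hom])
    define b where "b = ksign (r * (\<Sum>j<i. p j)) * ksign (q * (\<Sum>j<i. p j))"
    define XY where "XY = pure_tensor n (v(i := X i (Y i (v i))))"
    define YX where "YX = pure_tensor n (v(i := Y i (X i (v i))))"
    have "A i i = fun_scale b XY" "B i i = fun_scale b YX"
      by (simp_all only: A_def B_def b_def XY_def YX_def less_irrefl if_False mult_1_right mult_1_left fun_upd_same
          fun_upd_upd mult.commute)
    moreover have "D i = fun_scale b (XY - fun_scale (ksign (r * q)) YX)"
      by (simp only: D_def b_def XY_def YX_def eq distrib_right ksign_add pure_tensor_upd_diff[OF ik(1)]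
          pure_tensor_upd_scale[OF ik(1)])
    ultimately show ?thesis
      using True by (simp add: fun_space.scale_right_diff_distrib fun_space.scale_left_commute
          del: fun_space.scale_scale)
  qed
  have TA: "T n z s (T n z y (pure_tensor n v)) = (\<Sum>i<n. \<Sum>k<n. A i k)"
    unfolding A_def X_def Y_def by (rule T_pure_twice[OF v s y])
  have TB: "T n z y (T n z s (pure_tensor n v)) = (\<Sum>i<n. \<Sum>k<n. B i k)"
    unfolding B_def X_def Y_def by (rule T_pure_twice[OF v y s])
  have "T n z s (T n z y (pure_tensor n v)) - fun_scale (ksign (r * q)) (T n z y (T n z s (pure_tensor n v)))
     = (\<Sum>i<n. \<Sum>k<n. A i k) - fun_scale (ksign (r * q)) (\<Sum>i<n. \<Sum>k<n. B i k)"
    by (simp only: TA TB)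
  also have "(\<Sum>i<n. \<Sum>k<n. B i k) = (\<Sum>i<n. \<Sum>k<n. B k i)"
    by (rule sum.swap)
  also have "(\<Sum>i<n. \<Sum>k<n. A i k) - fun_scale (ksign (r * q)) \<dots> =
      (\<Sum>i<n. \<Sum>k<n. A i k - fun_scale (ksign (r * q)) (B k i))"
    by (simp only: fun_space.scale_sum_right sum_subtractf)
  also have "\<dots> = (\<Sum>i<n. \<Sum>k<n. if i = k then D i else 0)"
    by (intro sum.cong refl) (simp only: AB lessThan_iff)
  also have "\<dots> = (\<Sum>i<n. D i)"
    by (intro sum.cong refl) (simp add: sum.delta)
  also have "\<dots> = T n z (lbr s y) (pure_tensor n v)"
    unfolding D_def by (rule T_pure[OF v lbr_parity[OF s y], symmetric])
  finally show ?thesis ..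
qed

lemma T_lbr:
  assumes s: "hcomp r s = s" and y: "hcomp q y = y"
  shows "T n z (lbr s y) u = T n z s (T n z y u) - fun_scale (ksign (r * q)) (T n z y (T n z s u))"
proof -
  define w where "w = (\<lambda>l. if length l = n then u l else 0)"
  have w: "w \<in> tensor_carrier n" by (simp add: w_def tensor_carrier_def)
  have T: "T n z y u = T n z y w" for y by (rule T_restrict) (simp add: w_def)
  have hom: "(\<lambda>i. unit_vec (l ! i)) i \<in> homog par ((\<lambda>i. par (l ! i)) i)" for l :: "'b list" and i
    by (simp add: unit_vec_def)
  have "T n z (lbr s y) (unit_tensor l) =
    T n z s (T n z y (unit_tensor l)) - fun_scale (ksign (r * q)) (T n z y (T n z s (unit_tensor l)))"
    if "length l = n" for l
    unfolding that by (rule T_lbr_pure[OF hom s y])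
  hence "(\<Sum>l | length l = n. fun_scale (w l) (T n z (lbr s y) (unit_tensor l))) =
    (\<Sum>l | length l = n. fun_scale (w l) (T n z s (T n z y (unit_tensor l)) -
       fun_scale (ksign (r * q)) (T n z y (T n z s (unit_tensor l)))))"
    by (intro sum.cong) auto
  also have "\<dots> = T n z s (T n z y (\<Sum>l | length l = n. fun_scale (w l) (unit_tensor l))) -
      fun_scale (ksign (r * q)) (T n z y (T n z s (\<Sum>l | length l = n. fun_scale (w l) (unit_tensor l))))"
    by (simp only: T_sum_right T_scale_right fun_space.scale_sum_right sum_subtractf
        fun_space.scale_right_diff_distrib fun_space.scale_scale mult.commute)
  finally have "T n z (lbr s y) (\<Sum>l | length l = n. fun_scale (w l) (unit_tensor l)) =
    T n z s (T n z y (\<Sum>l | length l = n. fun_scale (w l) (unit_tensor l))) -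
      fun_scale (ksign (r * q)) (T n z y (T n z s (\<Sum>l | length l = n. fun_scale (w l) (unit_tensor l))))"
    by (simp only: T_sum_right T_scale_right)
  thus ?thesis unfolding T tensor_expand[OF w, symmetric] .
qed

lemma T_part:
  assumes y: "hcomp q y = y" and u: "u \<in> tensor_part n (\<lambda>_. par) p"
  shows "T n z y u \<in> tensor_part n (\<lambda>_. par) (q + p)"
proof -
  have unit: "T n z y (unit_tensor l) \<in> tensor_part n (\<lambda>_. par) (q + (\<Sum>i<n. par (l ! i)))"
    if l: "length l = n" for l
  proof -
    have hom: "(\<lambda>i. unit_vec (l ! i)) i \<in> homog par ((\<lambda>i. par (l ! i)) i)" for i
      by (simp add: unit_vec_def)
    have "pure_tensor n ((\<lambda>i. unit_vec (l ! i))(i := \<rho> (eval_current (z i) y) (unit_vec (l ! i))))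
        \<in> tensor_part n (\<lambda>_. par) (q + (\<Sum>i<n. par (l ! i)))" if i: "i < n" for i
    proof -
      have "hcomp q (eval_current (z i) y) = eval_current (z i) y"
        by (simp add: y flip: eval_current_hcomp)
      hence "\<rho> (eval_current (z i) y) (unit_vec (l ! i)) \<in> homog par (q + par (l ! i))"
        by (rule par_op) (simp add: unit_vec_def)
      hence "((\<lambda>i. unit_vec (l ! i))(i := \<rho> (eval_current (z i) y) (unit_vec (l ! i)))) j
          \<in> homog par (((\<lambda>j. par (l ! j))(i := q + par (l ! i))) j)" for j
        by (cases "j = i") (simp_all add: unit_vec_def)
      hence "pure_tensor n ((\<lambda>i. unit_vec (l ! i))(i := \<rho> (eval_current (z i) y) (unit_vec (l ! i))))
        \<in> tensor_part n (\<lambda>_. par) (\<Sum>j<n. ((\<lambda>j. par (l ! j))(i := q + par (l ! i))) j)"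
        by (rule pure_tensor_part)
      also have "(\<Sum>j<n. ((\<lambda>j. par (l ! j))(i := q + par (l ! i))) j) =
          (\<Sum>j<n. (if j = i then q else 0) + par (l ! j))"
        by (intro sum.cong) auto
      also have "\<dots> = q + (\<Sum>i<n. par (l ! i))"
        using i by (simp only: sum.distrib sum.delta finite_lessThan lessThan_iff simp_thms if_True)
      finally show ?thesis .
    qed
    hence "(\<Sum>i<n. fun_scale (ksign (q * (\<Sum>j<i. par (l ! j))))
        (pure_tensor n ((\<lambda>i. unit_vec (l ! i))(i := \<rho> (eval_current (z i) y) (unit_vec (l ! i))))))
        \<in> tensor_part n (\<lambda>_. par) (q + (\<Sum>i<n. par (l ! i)))"
      by (intro fun_space.subspace_sum subspace_tensor_part fun_space.subspace_scale) auto
    also have "(\<Sum>i<n. fun_scale (ksign (q * (\<Sum>j<i. par (l ! j))))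
        (pure_tensor n ((\<lambda>i. unit_vec (l ! i))(i := \<rho> (eval_current (z i) y) (unit_vec (l ! i)))))) =
        T n z y (unit_tensor l)"
      unfolding l by (rule T_pure[OF hom y, symmetric])
    finally show ?thesis .
  qed
  show ?thesis
    using tensor_part_span[OF u]
  proof (induction rule: fun_space.span_induct_alt)
    case base
    have "T n z y 0 \<in> tensor_part n (\<lambda>_. par) (q + p)"
      by (simp only: T_zero_right fun_space.subspace_0 subspace_tensor_part)
    thus ?case .
  next
    case (step c v w)
    obtain l where l: "v = unit_tensor l" "length l = n" "(\<Sum>i<n. par (l ! i)) = p"
      using step(1) by blast
    have "T n z y v \<in> tensor_part n (\<lambda>_. par) (q + p)"
      unfolding l(1) l(3)[symmetric] by (rule unit[OF l(2)])
    hence "T n z y (fun_scale c v + w) \<in> tensor_part n (\<lambda>_. par) (q + p)"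
      unfolding T_add_right T_scale_right
      by (intro fun_space.subspace_add[OF subspace_tensor_part] step(2)
          fun_space.subspace_scale[OF subspace_tensor_part])
    thus ?case .
  qed
qed

definition x_tensor :: "nat \<Rightarrow> (nat \<Rightarrow> nat) \<Rightarrow> 'b list \<Rightarrow> complex" where
  "x_tensor n a = pure_tensor n (\<lambda>i. x (a i))"

text \<open>The factors from index \<open>k\<close> on are already vectors \<open>x m\<close>;
  multilinearity reduces factor \<open>k\<close> to this case in the step from \<open>k\<close> to
  \<open>k + 1\<close>.\<close>

lemma pure_tensor_x_span_aux:
  "k \<le> n \<Longrightarrow> (\<And>i. k \<le> i \<Longrightarrow> i < n \<Longrightarrow> v i \<in> x ` {..<3}) \<Longrightarrow>
    pure_tensor n v \<in> fun_space.span {x_tensor n a |a. \<forall>i<n. a i < 3}"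
proof (induction k arbitrary: v)
  case 0
  define a where "a = (\<lambda>i. SOME m. m < 3 \<and> v i = x m)"
  have a: "a i < 3 \<and> v i = x (a i)" if "i < n" for i
  proof -
    have "\<exists>m. m < 3 \<and> v i = x m" using 0 that by auto
    from someI_ex[OF this] show ?thesis by (simp add: a_def)
  qed
  hence "pure_tensor n v = x_tensor n a" unfolding x_tensor_def by (intro pure_tensor_cong) simp
  thus ?case using a by (intro fun_space.span_base) auto
next
  case (Suc k)
  let ?S = "fun_space.span {x_tensor n a |a. \<forall>i<n. a i < 3}"
  have k: "k < n" using Suc.prems(1) by simp
  have "pure_tensor n (v(k := w)) \<in> ?S" if "w \<in> fun_space.span (x ` {..<3})" for w
    using that
  proof (induction rule: fun_space.span_induct_alt)
    case base
    have "pure_tensor n (v(k := 0)) \<in> ?S"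
      by (simp only: pure_tensor_upd_zero[OF k] fun_space.span_zero)
    thus ?case .
  next
    case (step c u w)
    have "pure_tensor n (v(k := u)) \<in> ?S"
    proof (rule Suc.IH)
      fix i assume "k \<le> i" "i < n"
      thus "(v(k := u)) i \<in> x ` {..<3}"
        using Suc.prems(2)[of i] step(1) by (cases "i = k") auto
    qed (use k in simp)
    hence "pure_tensor n (v(k := fun_scale c u + w)) \<in> ?S"
      unfolding pure_tensor_upd_add[OF k] pure_tensor_upd_scale[OF k]
      by (intro fun_space.span_add[OF fun_space.span_scale step(2)])
    thus ?case .
  qed
  from this[of "v k"] show ?case by (simp add: span_x)
qed

lemma tensor_carrier_x_span:
  "tensor_carrier n \<subseteq> fun_space.span {x_tensor n a |a. \<forall>i<n. a i < 3}"
proof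
  fix u :: "'b list \<Rightarrow> complex" assume u: "u \<in> tensor_carrier n"
  have "unit_tensor l \<in> fun_space.span {x_tensor n a |a. \<forall>i<n. a i < 3}" if "length l = n" for l
    unfolding that by (rule pure_tensor_x_span_aux[OF order_refl]) auto
  hence "(\<Sum>l | length l = n. fun_scale (u l) (unit_tensor l))
      \<in> fun_space.span {x_tensor n a |a. \<forall>i<n. a i < 3}"
    by (intro fun_space.span_sum fun_space.span_scale) simp
  thus "u \<in> fun_space.span {x_tensor n a |a. \<forall>i<n. a i < 3}"
    by (simp only: tensor_expand[OF u, symmetric])
qed

lemma x_tensor_weight:
  "T n z (monom osp_h 0) (x_tensor n a) = fun_scale (\<Sum>i<n. of_nat (a i) - 1) (x_tensor n a)"
proof -
  have "T n z (monom osp_h 0) (x_tensor n a) =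
    (\<Sum>i<n. pure_tensor n ((\<lambda>i. x (a i))(i := fun_scale (of_nat (a i) - 1) (x (a i)))))"
    unfolding x_tensor_def
    by (subst T_pure[where q = 0 and p = "\<lambda>i. of_nat (a i)"])
      (simp_all only: x_homog hcomp_monom osp12_parity mult_zero_left ksign_0 fun_space.scale_one
        eval_current_monom power_0 scaleC_one h_x)
  also have "\<dots> = (\<Sum>i<n. fun_scale (of_nat (a i) - 1) (x_tensor n a))"
    by (intro sum.cong refl) (simp add: pure_tensor_upd_scale x_tensor_def fun_upd_idem)
  finally show ?thesis by (simp only: fun_space.scale_sum_left)
qed

lemma x_tensor_part: "x_tensor n a \<in> tensor_part n (\<lambda>_. par) (of_nat (\<Sum>i<n. a i))"
  unfolding x_tensor_def of_nat_sum by (rule pure_tensor_part) (rule x_homog)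

lemma T_lowest:
  assumes "hcomp q y = y" and "\<rho> y (x 0) = fun_scale c (x 0)"
  shows "T n z (monom y k) (x_tensor n (\<lambda>_. 0)) =
    fun_scale (\<Sum>i<n. z i ^ k * c) (x_tensor n (\<lambda>_. 0))"
proof -
  have "T n z (monom y k) (x_tensor n (\<lambda>_. 0)) =
    (\<Sum>i<n. pure_tensor n ((\<lambda>i. x 0)(i := fun_scale (z i ^ k * c) (x 0))))"
    unfolding x_tensor_def
    by (subst T_pure[where q = q and p = "\<lambda>i. 0"])
      (use x_homog[of 0] assms in \<open>simp_all add: hcomp_monom eval_current_monom op_scale_left\<close>)
  also have "\<dots> = (\<Sum>i<n. fun_scale (z i ^ k * c) (x_tensor n (\<lambda>_. 0)))"
    by (intro sum.cong refl) (simp add: pure_tensor_upd_scale x_tensor_def fun_upd_idem)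
  finally show ?thesis by (simp only: fun_space.scale_sum_left)
qed

text \<open>Lagrange interpolation at the points \<open>z i\<close> makes the factors act independently.\<close>

lemma T_single_factor:
  assumes z: "inj_on z {..<n}" and W: "fun_space.subspace W"
    and stable: "\<And>y k u. u \<in> W \<Longrightarrow> T n z (monom y k) u \<in> W"
    and v: "\<And>i. i < n \<Longrightarrow> v i \<in> homog par (p i)" and y: "hcomp q y = y" and i: "i < n"
    and W_v: "pure_tensor n v \<in> W"
  shows "pure_tensor n (v(i := \<rho> y (v i))) \<in> W"
proof -
  \<comment> \<open>The Lagrange basis polynomial at \<open>z i\<close>. The current
    \<open>y\<close> times \<open>P(t)\<close> then acts as \<open>y\<close> on factor
    \<open>i\<close> and as zero on the others, up to a Koszul sign.\<close>
  define P where "P = (\<Prod>j\<in>{..<n} - {i}. [:- z j / (z i - z j), 1 / (z i - z j):])"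
  have P: "poly P (z j) = (if j = i then 1 else 0)" if "j < n" for j
  proof (cases "j = i")
    case True
    have "poly P (z i) = (\<Prod>k\<in>{..<n} - {i}. 1)"
      unfolding P_def poly_prod
    proof (rule prod.cong[OF refl])
      fix k assume k: "k \<in> {..<n} - {i}"
      hence "z i - z k \<noteq> 0" using z i by (auto simp: inj_on_def)
      moreover have "poly [:- z k / (z i - z k), 1 / (z i - z k):] (z i) = (z i - z k) / (z i - z k)"
        by (simp only: diff_divide_distrib) simp
      ultimately show "poly [:- z k / (z i - z k), 1 / (z i - z k):] (z i) = 1" by simp
    qed
    thus ?thesis using True by simp
  next
    case False
    thus ?thesis using that by (auto simp: P_def poly_prod prod_zero_iff)
  qed
  define Y where "Y = (\<Sum>k\<le>degree P. monom (coeff P k *\<^sub>C y) k)"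
  have eval_sum: "eval_current w (\<Sum>k\<in>A. f k) = (\<Sum>k\<in>A. eval_current w (f k))"
    for w A and f :: "nat \<Rightarrow> osp12 poly"
    using eval_current_monom[of w "0 :: osp12" 0]
    by (induction A rule: infinite_finite_induct) (simp_all add: eval_current_add)
  have scaleC_sum: "(\<Sum>k\<in>A. c k) *\<^sub>C y = (\<Sum>k\<in>A. c k *\<^sub>C y)" for A :: "nat set" and c
    by (induction A rule: infinite_finite_induct) (simp_all add: scaleC_add_left)
  have evalY: "eval_current w Y = poly P w *\<^sub>C y" for w
    by (simp add: Y_def eval_sum eval_current_monom scaleC_scaleC poly_altdef scaleC_sum mult.commute)
  have T_sum_left: "T n z (\<Sum>k\<in>A. f k) u = (\<Sum>k\<in>A. T n z (f k) u)" for A and f :: "nat \<Rightarrow> osp12 poly" and u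
    using T_scale_left[of n z 0 0 u]
    by (induction A rule: infinite_finite_induct)
      (simp_all add: T_add_left del: plus_fun_apply zero_fun_apply)
  have TY: "T n z Y (pure_tensor n v) \<in> W"
    unfolding Y_def T_sum_left by (intro fun_space.subspace_sum[OF W] stable W_v)
  have hcomp_sum: "hcomp q (\<Sum>k\<in>A. f k) = (\<Sum>k\<in>A. hcomp q (f k))" for A and f :: "nat \<Rightarrow> osp12 poly"
    by (induction A rule: infinite_finite_induct) (simp_all add: hcomp_add)
  have "hcomp q Y = Y"
    by (simp add: Y_def hcomp_sum hcomp_monom hcomp_scaleC y)
  from T_pure[where z = z, OF v this] have "T n z Y (pure_tensor n v) =
    (\<Sum>j<n. fun_scale (ksign (q * (\<Sum>k<j. p k))) (pure_tensor n (v(j := \<rho> (eval_current (z j) Y) (v j)))))" .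
  also have "\<dots> = (\<Sum>j<n. if j = i then fun_scale (ksign (q * (\<Sum>k<i. p k)))
      (pure_tensor n (v(i := \<rho> y (v i)))) else 0)"
    by (intro sum.cong refl) (simp add: evalY P scaleC_one pure_tensor_upd_zero)
  also have "\<dots> = fun_scale (ksign (q * (\<Sum>k<i. p k))) (pure_tensor n (v(i := \<rho> y (v i))))"
    using i by (simp add: sum.delta)
  \<comment> \<open>The remaining sign squares to one and is removed by applying it again.\<close>
  finally have "fun_scale (ksign (q * (\<Sum>k<i. p k))) (pure_tensor n (v(i := \<rho> y (v i)))) \<in> W"
    using TY by simp
  from fun_space.subspace_scale[OF W this, of "ksign (q * (\<Sum>k<i. p k))"] show ?thesis
    by (simp add: ksign_square)
qed

text \<open>Acting with \<open>g^+\<close> on one factor at a time climbs from \<open>x 0\<close> to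
  every \<open>x m\<close> in that factor.\<close>

lemma T_cyclic:
  assumes z: "inj_on z {..<n}" and W: "fun_space.subspace W"
    and stable: "\<And>y k u. u \<in> W \<Longrightarrow> T n z (monom y k) u \<in> W"
    and W_v: "x_tensor n (\<lambda>_. 0) \<in> W"
  shows "tensor_carrier n \<subseteq> W"
proof -
  have raise: "x_tensor n (a(i := m)) \<in> W" if a: "x_tensor n (a(i := 0)) \<in> W" and i: "i < n" for a i m
  proof (induction m)
    case (Suc m)
    have "pure_tensor n ((\<lambda>j. x ((a(i := m)) j))(i := \<rho> osp_gp (x ((a(i := m)) i)))) \<in> W"
      using Suc unfolding x_tensor_def
      by (intro T_single_factor[OF z W stable x_homog osp12_parity(4) i])
    moreover have "(\<lambda>j. x ((a(i := m)) j))(i := \<rho> osp_gp (x ((a(i := m)) i))) = (\<lambda>j. x ((a(i := Suc m)) j))"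
      by (auto simp: gp_x)
    ultimately show ?case by (simp add: x_tensor_def)
  qed (rule a)
  have "x_tensor n a \<in> W" for a
  proof -
    have "x_tensor n (\<lambda>i. if i < k then a i else 0) \<in> W" if "k \<le> n" for k
      using that
    proof (induction k)
      case 0
      show ?case using W_v by simp
    next
      case (Suc k)
      let ?a = "\<lambda>i. if i < k then a i else 0"
      have "?a(k := 0) = ?a" by auto
      moreover have "?a(k := a k) = (\<lambda>i. if i < Suc k then a i else 0)" by auto
      ultimately show ?case using raise[of ?a k "a k"] Suc by simp
    qed
    from this[of n] show ?thesis
      unfolding x_tensor_def by (simp cong: pure_tensor_cong)
  qed
  hence "fun_space.span {x_tensor n a |a. \<forall>i<n. a i < 3} \<subseteq> W"
    by (intro fun_space.span_minimal W) auto
  thus ?thesis using tensor_carrier_x_span by blast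
qed

end

section \<open>The associated graded module\<close>

locale osp_fusion = osp_fundamental \<rho> par x
  for \<rho> :: "osp12 \<Rightarrow> ('b::finite \<Rightarrow> complex) \<Rightarrow> 'b \<Rightarrow> complex"
    and par :: "'b \<Rightarrow> bit" and x :: "nat \<Rightarrow> 'b \<Rightarrow> complex" +
  fixes n :: nat and z :: "nat \<Rightarrow> complex"
  assumes inj_z: "inj_on z {..<n}"
begin

abbreviation act :: "osp12 \<Rightarrow> nat \<Rightarrow> ('b list \<Rightarrow> complex) \<Rightarrow> 'b list \<Rightarrow> complex" where
  "act y k \<equiv> T n z (monom y k)"

definition v0 :: "'b list \<Rightarrow> complex" where
  "v0 = x_tensor n (\<lambda>_. 0)"

definition F :: "nat \<Rightarrow> ('b list \<Rightarrow> complex) set" where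
  "F = t_filtration (tensor_module n (\<lambda>_. par) (\<lambda>i y. \<rho> (eval_current (z i) y))) v0"

definition B :: "nat \<Rightarrow> ('b list \<Rightarrow> complex) set" where
  "B = filtration_below F"

lemma F_eq: "F s = fun_space.span {foldr (\<lambda>(y, k). act y k) ys v0 |ys. (\<Sum>(y, k)\<leftarrow>ys. k) \<le> s}"
  by (simp add: F_def t_filtration_def T_def tensor_module_def)

lemma subspace_F: "fun_space.subspace (F s)"
  by (simp add: F_eq)

lemma B_0: "B 0 = {0}" and B_Suc: "B (Suc s) = F s"
  by (simp_all add: B_def filtration_below_def)

lemma subspace_B: "fun_space.subspace (B s)"
  by (cases s) (simp_all add: B_0 B_Suc subspace_F fun_space.subspace_single_0)

lemma F_mono: "s \<le> t \<Longrightarrow> F s \<subseteq> F t"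
  unfolding F_eq by (rule fun_space.span_mono) (blast intro: order_trans)

lemma B_subset_F: "B s \<subseteq> F s"
  using F_mono[of _ s] by (cases s) (auto simp: B_0 B_Suc fun_space.subspace_0[OF subspace_F])

lemma v0_F: "v0 \<in> F s"
  unfolding F_eq by (intro fun_space.span_base CollectI exI[of _ "[]"]) simp

lemma act_F:
  assumes "u \<in> F s"
  shows "act y k u \<in> F (s + k)"
  using assms unfolding F_eq[of s]
proof (induction rule: fun_space.span_induct_alt)
  case base
  have "act y k 0 \<in> F (s + k)"
    by (simp only: T_zero_right fun_space.subspace_0 subspace_F)
  thus ?case .
next
  case (step c u w)
  then obtain ys where ys: "u = foldr (\<lambda>(y, k). act y k) ys v0" "(\<Sum>(y, k)\<leftarrow>ys. k) \<le> s" by blast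
  have "act y k u \<in> F (s + k)"
    unfolding F_eq ys(1) using ys(2)
    by (intro fun_space.span_base CollectI exI[of _ "(y, k) # ys"]) simp
  hence "act y k (fun_scale c u + w) \<in> F (s + k)"
    unfolding T_add_right T_scale_right
    by (intro fun_space.subspace_add[OF subspace_F] fun_space.subspace_scale[OF subspace_F] step(2))
  thus ?case .
qed

lemma act_B:
  assumes "u \<in> B s"
  shows "act y k u \<in> B (s + k)"
proof (cases s)
  case 0
  hence "u = 0" using assms by (simp add: B_0)
  thus ?thesis by (simp only: T_zero_right fun_space.subspace_0 subspace_B)
next
  case (Suc r)
  thus ?thesis using act_F[of u r y k] assms by (simp add: B_Suc)
qed

lemma F_carrier: "F s \<subseteq> tensor_carrier n"
  unfolding F_eq
proof (rule fun_space.span_minimal[OF _ subspace_tensor_carrier], rule subsetI)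
  fix u assume "u \<in> {foldr (\<lambda>(y, k). act y k) ys v0 |ys. (\<Sum>(y, k)\<leftarrow>ys. k) \<le> s}"
  then obtain ys where ys: "u = foldr (\<lambda>(y, k). act y k) ys v0" by blast
  show "u \<in> tensor_carrier n"
    unfolding ys by (cases ys) (auto simp: T_carrier v0_def x_tensor_def pure_tensor_carrier)
qed

text \<open>The union of the filtration is stable and contains the cyclic vector, hence is
  everything; the finitely many unit tensors then lie in a common step.\<close>

lemma F_exhausts: "\<exists>S. F S = tensor_carrier n"
proof -
  have "fun_space.subspace (\<Union>s. F s)"
  proof (rule fun_space.subspaceI)
    show "0 \<in> (\<Union>s. F s)" using fun_space.subspace_0[OF subspace_F] by blast
    show "fun_scale c u \<in> (\<Union>s. F s)" if "u \<in> (\<Union>s. F s)" for c u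
      using that fun_space.subspace_scale[OF subspace_F] by blast
    show "u + w \<in> (\<Union>s. F s)" if uw: "u \<in> (\<Union>s. F s)" "w \<in> (\<Union>s. F s)" for u w
    proof -
      obtain s t where "u \<in> F s" "w \<in> F t" using uw by blast
      hence "u \<in> F (max s t)" "w \<in> F (max s t)" using F_mono[of s "max s t"] F_mono[of t "max s t"] by auto
      thus ?thesis using fun_space.subspace_add[OF subspace_F] by blast
    qed
  qed
  moreover have "act y k u \<in> (\<Union>s. F s)" if "u \<in> (\<Union>s. F s)" for y k u
    using that act_F by blast
  moreover have "x_tensor n (\<lambda>_. 0) \<in> (\<Union>s. F s)"
    using v0_F unfolding v0_def by blast
  ultimately have "tensor_carrier n \<subseteq> (\<Union>s. F s)"
    by (rule T_cyclic[OF inj_z])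
  hence "\<forall>l\<in>{l :: 'b list. length l = n}. \<exists>s. unit_tensor l \<in> F s"
    using pure_tensor_carrier by blast
  then obtain f where f: "\<And>l. length l = n \<Longrightarrow> unit_tensor l \<in> F (f l)" for l :: "'b list"
    unfolding Ball_def mem_Collect_eq by metis
  define S where "S = Max (f ` {l. length l = n} \<union> {0})"
  have "f l \<le> S" if "length l = n" for l
    unfolding S_def by (rule Max_ge) (use that finite_lists_of_length[of n] in auto)
  hence unit: "unit_tensor l \<in> F S" if "length l = n" for l
    using f[OF that] F_mono[of "f l" S] that by blast
  have "u \<in> F S" if u: "u \<in> tensor_carrier n" for u
  proof -
    have "(\<Sum>l | length l = n. fun_scale (u l) (unit_tensor l)) \<in> F S"
      by (intro fun_space.subspace_sum[OF subspace_F] fun_space.subspace_scale[OF subspace_F])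
        (use unit in blast)
    thus ?thesis by (simp only: tensor_expand[OF u, symmetric])
  qed
  thus ?thesis using F_carrier[of S] by (intro exI[of _ S]) auto
qed

definition top_degree :: nat where
  "top_degree = (SOME S. F S = tensor_carrier n)"

lemma F_top: "top_degree \<le> s \<Longrightarrow> F s = tensor_carrier n"
  using someI_ex[OF F_exhausts] F_mono[of top_degree s] F_carrier[of s]
  unfolding top_degree_def[symmetric] by auto

section \<open>Splitting the filtration\<close>

sublocale const: osp_rep fun_scale "\<lambda>y. act y 0"
proof unfold_locales
  fix p q and y y' :: osp12 and u
  assume "hcomp p y = y" "hcomp q y' = y'"
  thus "act (lbr y y') 0 u = act y 0 (act y' 0 u) - fun_scale (ksign (p * q)) (act y' 0 (act y 0 u))"
    using T_lbr[of p "monom y 0" q "monom y' 0" n z u] by (simp add: hcomp_monom lbr_monom)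
qed (simp_all add: T_add_right T_scale_right flip: T_add_left T_scale_left add_monom scaleC_monom)

lemma sum_weights: "(\<Sum>i<n. of_nat (a i) - 1) = (of_int (int (\<Sum>i<n. a i) - int n) :: complex)"
  by (simp add: sum_subtractf)

lemma sum_weights_bound:
  assumes "\<forall>i<n. a i < (3::nat)"
  shows "\<bar>int (\<Sum>i<n. a i) - int n\<bar> \<le> int n"
proof -
  have "(\<Sum>i<n. a i) \<le> (\<Sum>i<n. 2)" using assms by (intro sum_mono) (auto simp: less_Suc_eq_le numeral_3_eq_3 numeral_2_eq_2)
  hence "(\<Sum>i<n. a i) \<le> 2 * n" by simp
  thus ?thesis by linarith
qed

sublocale wm: osp_weight_module fun_scale "tensor_carrier n" "act osp_gp 0" "act osp_gm 0" "act osp_h 0" n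
proof unfold_locales
  show "tensor_carrier n \<subseteq> fun_space.span {u \<in> tensor_carrier n.
      \<exists>j::int. \<bar>j\<bar> \<le> int n \<and> act osp_h 0 u = fun_scale (of_int j) u}"
  proof (rule order_trans[OF tensor_carrier_x_span fun_space.span_mono], rule subsetI)
    fix u assume "u \<in> {x_tensor n a |a. \<forall>i<n. a i < 3}"
    then obtain a where a: "u = x_tensor n a" "\<forall>i<n. a i < 3" by blast
    show "u \<in> {u \<in> tensor_carrier n. \<exists>j::int. \<bar>j\<bar> \<le> int n \<and> act osp_h 0 u = fun_scale (of_int j) u}"
      using x_tensor_weight[of n z a, unfolded sum_weights] sum_weights_bound[OF a(2)] pure_tensor_carrier
      unfolding a(1) x_tensor_def by blast
  qed
  show "act osp_h 0 u = act osp_gp 0 (act osp_gm 0 u) + act osp_gm 0 (act osp_gp 0 u)" for u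
    by (rule const.op_h)
  show "act osp_h 0 (act osp_gp 0 u) = act osp_gp 0 (act osp_h 0 u) + act osp_gp 0 u" for u
    by (rule const.op_h_gp)
  show "act osp_h 0 (act osp_gm 0 u) = act osp_gm 0 (act osp_h 0 u) - act osp_gm 0 u" for u
    by (rule const.op_h_gm)
qed (simp_all add: subspace_tensor_carrier T_add_right T_scale_right T_carrier)

text \<open>\<open>x k\<close> has weight \<open>k - 1\<close> and parity \<open>k\<close>, so a
  tensor of weight \<open>j\<close> has parity \<open>j + n\<close>. This is why subspaces and
  projections compatible with \<open>h\<close> respect parity.\<close>

lemma wt_tensor_part:
  assumes "u \<in> wm.wt j"
  shows "u \<in> tensor_part n (\<lambda>_. par) (of_nat (nat (j + int n)))"
proof -
  define P where "P = (\<lambda>j. tensor_part n (\<lambda>_. par) (of_nat (nat (j + int n))))"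
  have "\<exists>xs. (\<forall>j. xs j \<in> wm.wt j \<inter> P j) \<and> u = (\<Sum>j\<in>{- int n..int n}. xs j)"
  proof (rule wm.span_wt_decomp)
    show "fun_space.subspace (P j)" for j unfolding P_def by (rule subspace_tensor_part)
    show "u \<in> fun_space.span {x_tensor n a |a. \<forall>i<n. a i < 3}"
      using assms tensor_carrier_x_span by (auto simp: wm.wt_def)
    fix w assume "w \<in> {x_tensor n a |a. \<forall>i<n. a i < 3}"
    then obtain a where a: "w = x_tensor n a" "\<forall>i<n. a i < 3" by blast
    have "w \<in> wm.wt (int (\<Sum>i<n. a i) - int n)"
      using x_tensor_weight[of n z a, unfolded sum_weights] pure_tensor_carrier
      by (simp add: wm.wt_def a(1) x_tensor_def)
    moreover have "w \<in> P (int (\<Sum>i<n. a i) - int n)"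
      using x_tensor_part[of n a] by (simp only: P_def a(1) diff_add_cancel nat_int)
    ultimately show "\<exists>j. \<bar>j\<bar> \<le> int n \<and> w \<in> wm.wt j \<inter> P j"
      using sum_weights_bound[OF a(2)] by blast
  qed
  then obtain xs where xs: "\<And>j. xs j \<in> wm.wt j \<inter> P j" "u = (\<Sum>j\<in>{- int n..int n}. xs j)" by blast
  have "u = (if \<bar>j\<bar> \<le> int n then xs j else 0)"
    using xs by (intro wm.wt_unique[OF assms]) auto
  thus ?thesis
    using xs(1)[of j] fun_space.subspace_0[OF subspace_tensor_part] by (auto simp: P_def split: if_splits)
qed

text \<open>A stable complement of \<open>B s\<close> in the whole tensor product is cut down to
  \<open>F s\<close>; by the modular law it remains a complement because \<open>B s\<close> lies in
  \<open>F s\<close>.\<close>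

lemma ex_complement:
  "\<exists>C. fun_space.subspace C \<and> C \<subseteq> F s \<and> (\<forall>y. \<forall>u\<in>C. act y 0 u \<in> C) \<and> B s \<inter> C = {0} \<and>
    (\<forall>u\<in>F s. \<exists>b\<in>B s. \<exists>c\<in>C. u = b + c)"
proof -
  have stable: "act y 0 u \<in> B s" if "u \<in> B s" for y u
    using act_B[OF that, of y 0] by simp
  have "B s \<subseteq> tensor_carrier n" using B_subset_F F_carrier by (rule order_trans)
  hence "\<exists>D. fun_space.subspace D \<and> D \<subseteq> tensor_carrier n \<and> (\<forall>u\<in>D. act osp_gp 0 u \<in> D) \<and>
      (\<forall>u\<in>D. act osp_gm 0 u \<in> D) \<and> B s \<inter> D = {0} \<and>
      (\<forall>u\<in>tensor_carrier n. \<exists>b\<in>B s. \<exists>d\<in>D. u = b + d)"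
    by (rule wm.exists_stable_complement[OF subspace_B]) (erule stable)+
  then obtain D where D: "fun_space.subspace D" "D \<subseteq> tensor_carrier n" "\<forall>u\<in>D. act osp_gp 0 u \<in> D"
    "\<forall>u\<in>D. act osp_gm 0 u \<in> D" "B s \<inter> D = {0}" "\<forall>u\<in>tensor_carrier n. \<exists>b\<in>B s. \<exists>d\<in>D. u = b + d"
    by (elim exE conjE) (rule that; assumption)
  show ?thesis
  proof (intro exI[of _ "D \<inter> F s"] conjI allI ballI)
    show "fun_space.subspace (D \<inter> F s)" by (intro fun_space.subspace_inter D(1) subspace_F)
    show "act y 0 u \<in> D \<inter> F s" if u: "u \<in> D \<inter> F s" for y u
      using const.op_stable[OF D(1), of u y] D(3,4) act_F[of u s y 0] u by simp
    show "\<exists>b\<in>B s. \<exists>c\<in>D \<inter> F s. u = b + c" if u: "u \<in> F s" for u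
    proof -
      obtain b d where bd: "b \<in> B s" "d \<in> D" "u = b + d" using D(6) F_carrier u by blast
      have "d = u - b" using bd(3) by simp
      hence "d \<in> F s" using u bd(1) B_subset_F by (auto intro: fun_space.subspace_diff[OF subspace_F])
      thus ?thesis using bd by blast
    qed
    show "B s \<inter> (D \<inter> F s) = {0}"
      using D(5) fun_space.subspace_0[OF subspace_F] by blast
  qed auto
qed

definition C :: "nat \<Rightarrow> ('b list \<Rightarrow> complex) set" where
  "C s = (SOME C. fun_space.subspace C \<and> C \<subseteq> F s \<and> (\<forall>y. \<forall>u\<in>C. act y 0 u \<in> C) \<and> B s \<inter> C = {0} \<and>
    (\<forall>u\<in>F s. \<exists>b\<in>B s. \<exists>c\<in>C. u = b + c))"

lemma C_props: "fun_space.subspace (C s)" "C s \<subseteq> F s" "u \<in> C s \<Longrightarrow> act y 0 u \<in> C s"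
  "B s \<inter> C s = {0}" "u \<in> F s \<Longrightarrow> \<exists>b\<in>B s. \<exists>c\<in>C s. u = b + c"
  using someI_ex[OF ex_complement[of s]] unfolding C_def[symmetric] by blast+

lemma C_decomp:
  assumes "u \<in> F m"
  shows "\<exists>c. (\<forall>s. c s \<in> C s) \<and> (\<forall>s>m. c s = 0) \<and> u = (\<Sum>s\<le>m. c s)"
  using assms
proof (induction m arbitrary: u)
  case 0
  have "u \<in> C 0" using C_props(5)[OF 0] by (auto simp: B_0)
  thus ?case
    using fun_space.subspace_0[OF C_props(1)] by (intro exI[of _ "\<lambda>s. if s = 0 then u else 0"]) auto
next
  case (Suc m)
  obtain b d where bd: "b \<in> F m" "d \<in> C (Suc m)" "u = b + d" using C_props(5)[OF Suc.prems] by (auto simp: B_Suc)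
  obtain c where c: "\<forall>s. c s \<in> C s" "\<forall>s>m. c s = 0" "b = (\<Sum>s\<le>m. c s)" using Suc.IH[OF bd(1)] by blast
  have "(\<Sum>s\<le>Suc m. (c(Suc m := d)) s) = u" by (simp add: bd(3) c(3))
  thus ?case using c bd(2) by (intro exI[of _ "c(Suc m := d)"]) auto
qed

text \<open>The component of top degree equals minus the sum of the others, so it lies in the
  preceding filtration step and in its complement.\<close>

lemma C_unique_0:
  assumes c: "\<And>s. c s \<in> C s"
  shows "(\<Sum>s\<le>m. c s) = 0 \<Longrightarrow> s \<le> m \<Longrightarrow> c s = 0"
proof (induction m)
  case 0
  have "(\<Sum>s\<le>0. c s) = 0" by (rule 0(1))
  hence "c 0 = 0" by simp
  thus ?case using 0(2) by simp
next
  case (Suc m)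
  have sum: "(\<Sum>s\<le>Suc m. c s) = 0" by (rule Suc.prems(1))
  have "c s \<in> F m" if "s \<le> m" for s
    using c[of s] C_props(2)[of s] F_mono[OF that] by blast
  hence "(\<Sum>s\<le>m. c s) \<in> F m"
    by (intro fun_space.subspace_sum[OF subspace_F]) simp
  moreover have "c (Suc m) = - (\<Sum>s\<le>m. c s)"
    using sum by (simp add: eq_neg_iff_add_eq_0 add.commute)
  ultimately have "c (Suc m) \<in> B (Suc m)"
    by (simp only: B_Suc fun_space.subspace_neg[OF subspace_F])
  hence top: "c (Suc m) = 0" using c[of "Suc m"] C_props(4)[of "Suc m"] by blast
  hence "(\<Sum>s\<le>m. c s) = 0" using sum by simp
  hence "s \<le> m \<Longrightarrow> c s = 0" by (rule Suc.IH)
  thus ?case using Suc.prems(2) top by (metis le_Suc_eq)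
qed

text \<open>The filtration is constant from \<open>top_degree\<close> on, so
  \<open>B s = F s\<close> there.\<close>

lemma C_above_top: "s > top_degree \<Longrightarrow> u \<in> C s \<Longrightarrow> u = 0"
  using C_props(2,4)[of s] F_top[of s] F_top[of "s - 1"] B_Suc[of "s - 1"] by auto

lemma C_unique:
  assumes "\<And>s. c s \<in> C s" "\<And>s. d s \<in> C s" "(\<Sum>s\<le>top_degree. c s) = (\<Sum>s\<le>top_degree. d s)"
  shows "c s = d s"
proof (cases "s \<le> top_degree")
  case True
  have "(\<Sum>s\<le>top_degree. c s - d s) = 0" using assms(3) by (simp add: sum_subtractf)
  moreover have "c s - d s \<in> C s" for s using assms by (intro fun_space.subspace_diff[OF C_props(1)])
  ultimately show ?thesis using C_unique_0[of "\<lambda>s. c s - d s" top_degree s] True by (simp del: fun_diff_def)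
next
  case False
  thus ?thesis using C_above_top[of s "c s"] C_above_top[of s "d s"] assms by simp
qed

section \<open>Projections onto the graded pieces\<close>

definition restr :: "('b list \<Rightarrow> complex) \<Rightarrow> 'b list \<Rightarrow> complex" where
  "restr u = (\<lambda>l. if length l = n then u l else 0)"

text \<open>The cut-off \<^const>\<open>restr\<close> makes the projections linear on the whole function type.\<close>

definition pr :: "nat \<Rightarrow> ('b list \<Rightarrow> complex) \<Rightarrow> 'b list \<Rightarrow> complex" where
  "pr s u = (SOME c. (\<forall>s. c s \<in> C s) \<and> restr u = (\<Sum>s\<le>top_degree. c s)) s"

lemma restr_carrier: "restr u \<in> tensor_carrier n"
  by (simp add: restr_def tensor_carrier_def)

lemma restr_id: "u \<in> tensor_carrier n \<Longrightarrow> restr u = u"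
  by (rule ext) (simp add: restr_def tensor_carrier_def)

lemma pr_props: "pr s u \<in> C s" "restr u = (\<Sum>s\<le>top_degree. pr s u)"
proof -
  have "restr u \<in> F top_degree" using restr_carrier F_top[of top_degree] by simp
  from C_decomp[OF this] have "\<exists>c. (\<forall>s. c s \<in> C s) \<and> restr u = (\<Sum>s\<le>top_degree. c s)" by blast
  from someI_ex[OF this] show "pr s u \<in> C s" "restr u = (\<Sum>s\<le>top_degree. pr s u)"
    unfolding pr_def by blast+
qed

lemma pr_eqI:
  assumes "\<And>s. c s \<in> C s" "restr u = (\<Sum>s\<le>top_degree. c s)"
  shows "pr s u = c s"
  by (rule C_unique) (use assms pr_props in auto)

lemma pr_sum: "u \<in> tensor_carrier n \<Longrightarrow> u = (\<Sum>s\<le>top_degree. pr s u)"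
  using pr_props(2)[of u] by (simp add: restr_id)

lemma pr_add: "pr s (u + w) = pr s u + pr s w"
proof (rule pr_eqI)
  show "pr s u + pr s w \<in> C s" for s by (intro fun_space.subspace_add[OF C_props(1)] pr_props)
  have "restr (u + w) = restr u + restr w" by (rule ext) (simp add: restr_def)
  thus "restr (u + w) = (\<Sum>s\<le>top_degree. pr s u + pr s w)"
    by (simp only: pr_props(2) sum.distrib)
qed

lemma pr_scale: "pr s (fun_scale a u) = fun_scale a (pr s u)"
proof (rule pr_eqI)
  show "fun_scale a (pr s u) \<in> C s" for s by (intro fun_space.subspace_scale[OF C_props(1)] pr_props)
  have "restr (fun_scale a u) = fun_scale a (restr u)" by (rule ext) (simp add: restr_def fun_scale_def)
  thus "restr (fun_scale a u) = (\<Sum>s\<le>top_degree. fun_scale a (pr s u))"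
    by (simp only: pr_props(2) fun_space.scale_sum_right)
qed

lemma pr_zero: "pr s 0 = 0"
  using pr_scale[of s 0 0] by simp

lemma pr_diff: "pr s (u - w) = pr s u - pr s w"
  using pr_add[of s "u - w" w] by simp

lemma pr_sum_right: "pr s (\<Sum>i\<in>A. f i) = (\<Sum>i\<in>A. pr s (f i))"
  by (induction A rule: infinite_finite_induct)
    (simp_all add: pr_add pr_zero del: plus_fun_apply zero_fun_apply)

lemma C_carrier: "u \<in> C s \<Longrightarrow> u \<in> tensor_carrier n"
  using C_props(2) F_carrier by blast

lemma pr_C:
  assumes u: "u \<in> C t"
  shows "pr s u = (if s = t then u else 0)"
proof (rule pr_eqI)
  show "(if s = t then u else 0) \<in> C s" for s
    using u fun_space.subspace_0[OF C_props(1)] by auto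
  have "(\<Sum>s\<le>top_degree. if s = t then u else 0) = (if t \<le> top_degree then u else 0)"
    by (subst sum.delta) auto
  also have "\<dots> = u" using C_above_top[of t u] u by auto
  finally show "restr u = (\<Sum>s\<le>top_degree. if s = t then u else 0)"
    using restr_id[OF C_carrier[OF u]] by simp
qed

lemma pr_pr: "pr s (pr t u) = (if s = t then pr t u else 0)"
  by (rule pr_C[OF pr_props(1)])

lemma pr_F:
  assumes "u \<in> F m" "m < s"
  shows "pr s u = 0"
proof -
  obtain c where c: "\<And>s. c s \<in> C s" "\<forall>s>m. c s = 0" "u = (\<Sum>s\<le>m. c s)" using C_decomp[OF assms(1)] by blast
  have "pr s u = (\<Sum>t\<le>m. pr s (c t))" by (simp only: c(3) pr_sum_right)
  also have "\<dots> = 0" using assms(2) by (intro sum.neutral) (simp add: pr_C[OF c(1)])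
  finally show ?thesis .
qed

lemma pr_B: "u \<in> B s \<Longrightarrow> pr s u = 0"
  by (cases s) (auto simp: B_0 B_Suc pr_zero pr_F)

lemma pr_diff_B:
  assumes "u \<in> F s"
  shows "u - pr s u \<in> B s"
proof -
  obtain b c where bc: "b \<in> B s" "c \<in> C s" "u = b + c" using C_props(5)[OF assms] by blast
  have "pr s u = c" using bc by (simp add: pr_add pr_B pr_C)
  thus ?thesis using bc by simp
qed

lemma pr_F_mem: "pr s u \<in> F s"
  using pr_props(1) C_props(2) by blast

lemma pr_act_0: "pr s (act y 0 u) = act y 0 (pr s u)"
proof (rule pr_eqI)
  show "act y 0 (pr s u) \<in> C s" for s by (intro C_props(3) pr_props)
  have "act y 0 u = act y 0 (restr u)" by (rule T_restrict) (simp add: restr_def)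
  hence "restr (act y 0 u) = act y 0 (restr u)" by (simp add: restr_id[OF T_carrier])
  thus "restr (act y 0 u) = (\<Sum>s\<le>top_degree. act y 0 (pr s u))"
    by (simp only: pr_props(2) T_sum_right)
qed

text \<open>Replacing \<open>u\<close> by its leading component changes \<open>u\<close> within
  \<open>B r\<close>, and the image of that under \<open>act y k\<close> lies in
  \<open>B (r + k)\<close>, which \<open>pr (r + k)\<close> kills.\<close>

lemma pr_act_pr:
  assumes "u \<in> F r"
  shows "pr (r + k) (act y k (pr r u)) = pr (r + k) (act y k u)"
proof -
  have "act y k (u - pr r u) \<in> B (r + k)" by (rule act_B[OF pr_diff_B[OF assms]])
  hence "pr (r + k) (act y k (u - pr r u)) = 0" by (rule pr_B)
  moreover have "act y k (u - pr r u) = act y k u - act y k (pr r u)"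
    using T_add_right[of n z "monom y k" "u - pr r u" "pr r u"] by simp
  ultimately show ?thesis by (simp add: pr_diff)
qed

lemma pr_wt: "u \<in> wm.wt j \<Longrightarrow> pr s u \<in> wm.wt j"
  by (auto simp: wm.wt_def pr_scale C_carrier[OF pr_props(1)] simp flip: pr_act_0)

text \<open>The projection commutes with \<open>h\<close>, hence preserves weights, and weights
  determine parities.\<close>

lemma pr_part:
  assumes u: "u \<in> tensor_part n (\<lambda>_. par) p"
  shows "pr s u \<in> tensor_part n (\<lambda>_. par) p"
proof -
  let ?P = "tensor_part n (\<lambda>_. par)"
  have "u \<in> tensor_carrier n" using u by (simp add: tensor_part_def)
  then obtain xs where xs: "\<And>j. xs j \<in> wm.wt j" "u = (\<Sum>j\<in>{- int n..int n}. xs j)"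
    using wm.wt_decomp by blast
  \<comment> \<open>The weights that carry parity \<open>p\<close>; the components of the other
    weights add up to a vector of both parities.\<close>
  define J where "J = {j \<in> {- int n..int n}. of_nat (nat (j + int n)) = p}"
  define J' where "J' = {j \<in> {- int n..int n}. of_nat (nat (j + int n)) \<noteq> p}"
  have u_eq: "u = (\<Sum>j\<in>J. xs j) + (\<Sum>j\<in>J'. xs j)"
  proof -
    have "finite J" "finite J'"
      unfolding J_def J'_def by (rule finite_subset[of _ "{- int n..int n}"]; auto)+
    moreover have "J \<inter> J' = {}" "{- int n..int n} = J \<union> J'" by (auto simp: J_def J'_def)
    ultimately show ?thesis unfolding xs(2) by (simp add: sum.union_disjoint)
  qed
  have J: "xs j \<in> ?P p" if "j \<in> J" for j
    using wt_tensor_part[OF xs(1), of j] that by (simp add: J_def)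
  have J': "xs j \<in> ?P (p + 1)" if "j \<in> J'" for j
  proof -
    have "of_nat (nat (j + int n)) = p + 1" using that by (cases p) (auto simp: J'_def)
    thus ?thesis using wt_tensor_part[OF xs(1), of j] by simp
  qed
  have "(\<Sum>j\<in>J'. xs j) = u - (\<Sum>j\<in>J. xs j)" using u_eq by simp
  hence "(\<Sum>j\<in>J'. xs j) \<in> ?P p"
    using u J by (simp only:) (intro fun_space.subspace_diff fun_space.subspace_sum subspace_tensor_part)
  moreover have "(\<Sum>j\<in>J'. xs j) \<in> ?P (p + 1)"
    using J' by (intro fun_space.subspace_sum subspace_tensor_part)
  ultimately have "(\<Sum>j\<in>J'. xs j) = 0"
    using tensor_part_disjoint[of "\<Sum>j\<in>J'. xs j" n "\<lambda>_. par"] by (cases p) simp_all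
  hence "pr s u = (\<Sum>j\<in>J. pr s (xs j))" using u_eq by (simp add: pr_sum_right)
  moreover have "pr s (xs j) \<in> ?P p" if "j \<in> J" for j
    using wt_tensor_part[OF pr_wt[OF xs(1)], of s j] that by (simp add: J_def)
  ultimately show ?thesis by (simp add: fun_space.subspace_sum[OF subspace_tensor_part])
qed

text \<open>The action on the associated graded space, carried over to the tensor product by
  identifying \<open>F s / F (s-1)\<close> with the complement \<open>C s\<close>.\<close>

definition gop :: "osp12 poly \<Rightarrow> ('b list \<Rightarrow> complex) \<Rightarrow> 'b list \<Rightarrow> complex" where
  "gop y u = (\<Sum>t\<le>top_degree. \<Sum>k\<le>t. pr t (act (coeff y k) k (pr (t - k) u)))"

lemma gop_carrier: "gop y u \<in> tensor_carrier n"
  unfolding gop_def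
  by (intro fun_space.subspace_sum[OF subspace_tensor_carrier] C_carrier[OF pr_props(1)])

lemma pr_gop: "pr r (gop y u) = (\<Sum>k\<le>r. pr r (act (coeff y k) k (pr (r - k) u)))"
proof -
  have "pr r (gop y u) = (\<Sum>t\<le>top_degree. if t = r then \<Sum>k\<le>r. pr r (act (coeff y k) k (pr (r - k) u)) else 0)"
    unfolding gop_def pr_sum_right by (intro sum.cong refl) (simp add: pr_pr)
  also have "\<dots> = (if r \<le> top_degree then \<Sum>k\<le>r. pr r (act (coeff y k) k (pr (r - k) u)) else 0)"
    by (subst sum.delta) auto
  also have "\<dots> = (\<Sum>k\<le>r. pr r (act (coeff y k) k (pr (r - k) u)))"
    using C_above_top[OF _ pr_props(1), of r] by (auto intro!: sum.neutral[symmetric])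
  finally show ?thesis .
qed

lemma eq_prI:
  assumes "u \<in> tensor_carrier n" "w \<in> tensor_carrier n" "\<And>r. pr r u = pr r w"
  shows "u = w"
  using pr_sum[OF assms(1)] pr_sum[OF assms(2)] assms(3) by simp

lemma gop_monom_pr: "gop (monom a i) (pr r u) = pr (r + i) (act a i (pr r u))"
proof (rule eq_prI[OF gop_carrier C_carrier[OF pr_props(1)]])
  fix s
  have "pr s (gop (monom a i) (pr r u)) = (\<Sum>k\<le>s. if k = i then pr s (act a i (pr (s - i) (pr r u))) else 0)"
    unfolding pr_gop using T_scale_left[of n z 0 0]
    by (intro sum.cong refl) (auto simp: pr_zero)
  also have "\<dots> = (if i \<le> s then pr s (act a i (pr (s - i) (pr r u))) else 0)"
    by (subst sum.delta) auto
  also have "\<dots> = pr s (pr (r + i) (act a i (pr r u)))"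
    by (auto simp: pr_pr T_zero_right pr_zero)
  finally show "pr s (gop (monom a i) (pr r u)) = pr s (pr (r + i) (act a i (pr r u)))" .
qed

lemma gop_add_right: "gop y (u + w) = gop y u + gop y w"
  by (simp add: gop_def pr_add T_add_right sum.distrib)

lemma gop_scale_right: "gop y (fun_scale c u) = fun_scale c (gop y u)"
  by (simp add: gop_def pr_scale T_scale_right fun_space.scale_sum_right)

lemma gop_add_left: "gop (y + y') u = gop y u + gop y' u"
  by (simp add: gop_def T_add_left pr_add sum.distrib flip: add_monom)

lemma gop_scale_left: "gop (c *\<^sub>C y) u = fun_scale c (gop y u)"
  by (simp add: gop_def coeff_scaleC T_scale_left pr_scale fun_space.scale_sum_right flip: scaleC_monom)

lemma gop_sum_right: "gop y (\<Sum>i\<in>A. f i) = (\<Sum>i\<in>A. gop y (f i))"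
  by (simp add: gop_def pr_sum_right T_sum_right sum.swap[of _ _ A])

lemma gop_pr_sum: "gop y u = (\<Sum>r\<le>top_degree. gop y (pr r u))"
proof -
  have "pr t (\<Sum>r\<le>top_degree. pr r u) = pr t u" for t
    by (rule pr_eqI[OF pr_props(1)]) (simp add: pr_props(2)[symmetric] restr_id[OF restr_carrier])
  hence "gop y u = gop y (\<Sum>r\<le>top_degree. pr r u)" by (simp add: gop_def)
  thus ?thesis by (simp only: gop_sum_right)
qed

lemma gop_lbr_monom:
  assumes a: "hcomp p a = a" and b: "hcomp q b = b"
  shows "gop (lbr (monom a i) (monom b j)) u =
    gop (monom a i) (gop (monom b j) u) - fun_scale (ksign (p * q)) (gop (monom b j) (gop (monom a i) u))"
proof -
  have two: "gop (monom a i) (gop (monom b j) (pr r u)) = pr (r + (i + j)) (act a i (act b j (pr r u)))"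
    for a b i j r
  proof -
    have "act b j (pr r u) \<in> F (r + j)" by (rule act_F[OF pr_F_mem])
    from pr_act_pr[OF this, of i a] show ?thesis by (simp add: gop_monom_pr add_ac)
  qed
  have one: "gop (lbr (monom a i) (monom b j)) (pr r u) =
    gop (monom a i) (gop (monom b j) (pr r u)) -
      fun_scale (ksign (p * q)) (gop (monom b j) (gop (monom a i) (pr r u)))" for r
  proof -
    have "T n z (lbr (monom a i) (monom b j)) (pr r u) = act a i (act b j (pr r u)) -
        fun_scale (ksign (p * q)) (act b j (act a i (pr r u)))"
      using a b by (intro T_lbr) (simp_all add: hcomp_monom)
    thus ?thesis
      unfolding two unfolding lbr_monom gop_monom_pr by (simp only: pr_diff pr_scale add.commute[of j i])
  qed
  have "gop (lbr (monom a i) (monom b j)) u = (\<Sum>r\<le>top_degree. gop (lbr (monom a i) (monom b j)) (pr r u))"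
    by (rule gop_pr_sum)
  also have "\<dots> = gop (monom a i) (\<Sum>r\<le>top_degree. gop (monom b j) (pr r u)) -
      fun_scale (ksign (p * q)) (gop (monom b j) (\<Sum>r\<le>top_degree. gop (monom a i) (pr r u)))"
    by (simp only: one gop_sum_right sum_subtractf fun_space.scale_sum_right)
  finally show ?thesis by (simp only: gop_pr_sum[symmetric])
qed

lemma gop_lbr:
  assumes s: "hcomp p s = s" and y: "hcomp q y = y"
  shows "gop (lbr s y) u = gop s (gop y u) - fun_scale (ksign (p * q)) (gop y (gop s u))"
  using s
proof (induction s rule: poly_homog_induct)
  case (monom a i)
  note a = \<open>hcomp p a = a\<close>
  show ?case
    using y
  proof (induction y rule: poly_homog_induct)
    case (monom b j)
    show ?case by (rule gop_lbr_monom[OF a \<open>hcomp q b = b\<close>])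
  next
    case (add y y')
    have IH: "gop (lbr (monom a i) w) u = gop (monom a i) (gop w u) -
        fun_scale (ksign (p * q)) (gop w (gop (monom a i) u))" if "w = y \<or> w = y'" for w
      using that by (elim disjE) (simp_all only: add)
    have "gop (lbr (monom a i) (y + y')) u = gop (monom a i) (gop (y + y') u) -
        fun_scale (ksign (p * q)) (gop (y + y') (gop (monom a i) u))"
      by (simp only: lbr_add_right gop_add_left gop_add_right IH simp_thms fun_space.scale_right_distrib add_diff_add)
    thus ?case .
  qed
next
  case (add s s')
  have IH: "gop (lbr w y) u = gop w (gop y u) - fun_scale (ksign (p * q)) (gop y (gop w u))"
    if "w = s \<or> w = s'" for w
    using that by (elim disjE) (simp_all only: add)
  have "gop (lbr (s + s') y) u = gop (s + s') (gop y u) - fun_scale (ksign (p * q)) (gop y (gop (s + s') u))"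
    by (simp only: lbr_add_left gop_add_left gop_add_right IH simp_thms fun_space.scale_right_distrib add_diff_add)
  thus ?case .
qed

sublocale gr: osp_current_rep fun_scale gop
  by unfold_locales (simp_all add: gop_add_right gop_scale_right gop_add_left gop_scale_left gop_lbr)

text \<open>The complements are stable under constant currents, so for these the projections commute
  with the action and grading changes nothing.\<close>

lemma gop_const:
  assumes "u \<in> tensor_carrier n"
  shows "gop (monom y 0) u = act y 0 u"
proof -
  have "gop (monom y 0) u = (\<Sum>r\<le>top_degree. act y 0 (pr r u))"
    by (subst gop_pr_sum) (simp add: gop_monom_pr pr_act_0 pr_pr)
  also have "\<dots> = act y 0 u" using pr_sum[OF assms] by (simp flip: T_sum_right)
  finally show ?thesis .
qed

lemma pr_v0: "pr 0 v0 = v0"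
  using pr_diff_B[OF v0_F[of 0]] by (simp add: B_0)

lemma v0_carrier: "v0 \<in> tensor_carrier n"
  using v0_F F_carrier by blast

lemma gop_part:
  assumes y: "hcomp q y = y" and u: "u \<in> tensor_part n (\<lambda>_. par) p"
  shows "gop y u \<in> tensor_part n (\<lambda>_. par) (q + p)"
proof -
  have "hcomp q (monom (coeff y k) k) = monom (coeff y k) k" for k
    using y by (metis hcomp_monom coeff_hcomp)
  thus ?thesis
    unfolding gop_def
    by (intro fun_space.subspace_sum[OF subspace_tensor_part] pr_part T_part u)
qed

end

section \<open>The map from the Weyl module\<close>

context osp_fusion
begin

lemma T_zero_left: "T n z 0 u = 0"
  using T_scale_left[of n z 0 0 u] by simp

lemma pr_v0_eq: "pr s v0 = (if s = 0 then v0 else 0)"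
  using pr_pr[of s 0 v0] by (simp add: pr_v0)

lemma act_f_v0: "act osp_f k v0 = 0" and act_gm_v0: "act osp_gm k v0 = 0"
  and act_h_v0: "act osp_h k v0 = fun_scale (- (\<Sum>i<n. z i ^ k)) v0"
proof -
  have f: "\<rho> osp_f (x 0) = fun_scale 0 (x 0)"
    using gm_x0 op_f[of "x 0"] op_zero_right[of osp_gm] by simp
  have gm: "\<rho> osp_gm (x 0) = fun_scale 0 (x 0)" by (simp add: gm_x0)
  have h: "\<rho> osp_h (x 0) = fun_scale (-1) (x 0)" using h_x[of 0] by simp
  show "act osp_f k v0 = 0" "act osp_gm k v0 = 0"
    using T_lowest[OF osp12_parity(3) f] T_lowest[OF osp12_parity(5) gm] by (simp_all add: v0_def)
  show "act osp_h k v0 = fun_scale (- (\<Sum>i<n. z i ^ k)) v0"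
    using T_lowest[OF osp12_parity(2) h] by (simp add: v0_def sum_negf)
qed

lemma act_n_minus_v0:
  assumes "a \<in> n_minus"
  shows "act a k v0 = 0"
proof -
  obtain \<alpha> \<beta> where "a = \<alpha> *\<^sub>C osp_f + \<beta> *\<^sub>C osp_gm" using assms by (auto simp: n_minus_def)
  thus ?thesis
    by (simp add: T_add_left T_scale_left act_f_v0 act_gm_v0 flip: add_monom scaleC_monom)
qed

text \<open>The result lies in \<open>F 0\<close>, so it has no component in degree
  \<open>k > 0\<close>; this is why the Weyl relations of positive \<open>t\<close>-degree hold
  after grading.\<close>

lemma act_borel_v0:
  assumes "a \<in> n_minus + cartan"
  shows "\<exists>c. act a k v0 = fun_scale c v0"
proof -
  obtain b \<gamma> where b: "b \<in> n_minus" "a = b + \<gamma> *\<^sub>C osp_h"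
    using assms by (auto simp: cartan_def elim!: set_plus_elim)
  have "act a k v0 = fun_scale (\<gamma> * - (\<Sum>i<n. z i ^ k)) v0"
    using act_n_minus_v0[OF b(1)]
    by (simp add: b(2) T_add_left T_scale_left act_h_v0 flip: add_monom scaleC_monom)
  thus ?thesis by blast
qed

lemma weyl_relations_v0:
  assumes "r \<in> weyl_relations n"
  shows "gr.word_act r v0 = 0"
proof -
  consider (borel) y where "r = gen y" "coeff y 0 = 0" "\<forall>i. coeff y i \<in> n_minus + cartan"
    | (n_minus) y where "r = gen (monom y 0)" "y \<in> n_minus"
    | (h) "r = gen (monom osp_h 0) + fa_scale (of_nat n) 1"
    | (e) "r = gen (monom osp_e 0) ^ (n + 1)"
    using assms unfolding weyl_relations_def by blast
  thus ?thesis
  proof cases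
    case borel
    have "pr t (act (coeff y k) k (pr (t - k) v0)) = 0" if "k \<le> t" for t k
    proof (cases "t = k")
      case True
      obtain c where c: "act (coeff y k) k v0 = fun_scale c v0" using act_borel_v0 borel(3) by blast
      show ?thesis
      proof (cases "k = 0")
        case True
        thus ?thesis using \<open>t = k\<close> borel(2) by (simp add: T_zero_left pr_zero)
      next
        case False
        thus ?thesis using \<open>t = k\<close> c by (simp add: pr_v0_eq pr_scale)
      qed
    next
      case False
      thus ?thesis using that by (simp add: pr_v0_eq T_zero_right pr_zero)
    qed
    hence "gop y v0 = 0" unfolding gop_def by (intro sum.neutral ballI) simp
    thus ?thesis using borel(1) by (simp add: gr.word_act_gen)
  next
    case n_minus
    thus ?thesis by (simp add: gr.word_act_gen gop_const v0_carrier act_n_minus_v0)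
  next
    case h
    have "gop (monom osp_h 0) v0 = fun_scale (- of_nat n) v0"
      by (simp add: gop_const v0_carrier act_h_v0)
    hence "gr.word_act r v0 = fun_scale (- of_nat n) v0 + fun_scale (of_nat n) v0"
      by (simp add: h gr.word_act_add gr.word_act_gen gr.word_act_scale)
    thus ?thesis by (simp flip: fun_space.scale_left_distrib)
  next
    case e
    have pow: "(gop (monom osp_e 0) ^^ k) v0 = (act osp_gp 0 ^^ (2 * k)) v0" for k
    proof (induction k)
      case (Suc k)
      have "(act osp_gp 0 ^^ (2 * k)) v0 \<in> tensor_carrier n"
        by (cases "2 * k") (simp_all add: v0_carrier T_carrier)
      thus ?case using Suc by (simp add: gop_const const.op_e)
    qed simp
    \<comment> \<open>As \<open>e_0\<close> is the square of \<open>g^+_0\<close>, the vector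
      \<open>e_0^(n+1) v0\<close> has weight \<open>n + 2\<close>, above the bound
      \<open>n\<close>.\<close>
    have "v0 \<in> wm.wt (- int n)"
      using act_h_v0[of 0] by (simp add: wm.wt_def v0_carrier)
    from wm.wt_bounded[OF wm.G_power_wt[OF this, of "2 * (n + 1)"]]
    show ?thesis by (simp only: e gr.word_act_gen_power pow) simp
  qed
qed

abbreviation \<psi> :: "osp12 poly free_alg \<Rightarrow> 'b list \<Rightarrow> complex" where
  "\<psi> a \<equiv> gr.word_act a v0"

lemma \<psi>_cyclic_ker: "a \<in> cyclic_ker (weyl_relations n) \<Longrightarrow> \<psi> a = 0"
  by (rule gr.word_act_cyclic_ker[where R = "weyl_relations n"]) (erule weyl_relations_v0)

lemma \<psi>_carrier: "\<psi> a \<in> tensor_carrier n"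
proof -
  have "foldr gop ys v0 \<in> tensor_carrier n" for ys
    by (cases ys) (simp_all add: v0_carrier gop_carrier)
  thus ?thesis
    unfolding gr.word_act_def
    by (intro fun_space.subspace_sum[OF subspace_tensor_carrier] fun_space.subspace_scale[OF subspace_tensor_carrier])
qed

text \<open>In the graded action, a word in monomials gives the component of its original value in
  degree equal to the total \<open>t\<close>-degree.\<close>

lemma foldr_gop:
  "foldr gop (map (\<lambda>(y, k). monom y k) ys) v0 =
    pr (\<Sum>(y, k)\<leftarrow>ys. k) (foldr (\<lambda>(y, k). act y k) ys v0) \<and>
   foldr (\<lambda>(y, k). act y k) ys v0 \<in> F (\<Sum>(y, k)\<leftarrow>ys. k)"
proof (induction ys)
  case Nil
  show ?case by (simp add: pr_v0 v0_F)
next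
  case (Cons yk ys)
  obtain y k where yk: "yk = (y, k)" by (cases yk)
  define s where "s = (\<Sum>(y, k)\<leftarrow>ys. k)"
  define u where "u = foldr (\<lambda>(y, k). act y k) ys v0"
  have IH: "foldr gop (map (\<lambda>(y, k). monom y k) ys) v0 = pr s u" "u \<in> F s"
    using Cons unfolding s_def u_def by blast+
  have "gop (monom y k) (pr s u) = pr (k + s) (act y k u)"
    using gop_monom_pr[of y k s u] pr_act_pr[OF IH(2), of k y] by (simp add: add.commute)
  moreover have "act y k u \<in> F (k + s)" using act_F[OF IH(2), of y k] by (simp add: add.commute)
  ultimately show ?case
    by (simp add: yk IH(1) flip: s_def u_def)
qed

text \<open>Each \<open>F s\<close> is spanned by words of degree at most \<open>s\<close>; those of
  degree \<open>s\<close> give their leading components by \<open>foldr_gop\<close>, those of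
  smaller degree have none.\<close>

lemma \<psi>_surj:
  assumes "u \<in> tensor_carrier n"
  shows "\<exists>a. \<psi> a = u"
proof -
  have pr_range: "\<exists>a. \<psi> a = pr s u" if "u \<in> F s" for s u
    using that unfolding F_eq
  proof (induction rule: fun_space.span_induct_alt)
    case base
    have "\<psi> 0 = pr s 0" by (simp only: pr_zero gr.word_act_zero)
    thus ?case by blast
  next
    case (step c w w')
    obtain a where a: "\<psi> a = pr s w'" using step(2) by blast
    obtain ys where ys: "w = foldr (\<lambda>(y, k). act y k) ys v0" "(\<Sum>(y, k)\<leftarrow>ys. k) \<le> s" using step(1) by blast
    have "\<exists>b. \<psi> b = pr s w"
    proof (cases "(\<Sum>(y, k)\<leftarrow>ys. k) = s")
      case True
      have "\<psi> (of_word (map (\<lambda>(y, k). monom y k) ys)) = pr s w"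
        using foldr_gop[of ys] by (simp only: gr.word_act_of_word True ys(1))
      thus ?thesis by blast
    next
      case False
      hence "(\<Sum>(y, k)\<leftarrow>ys. k) < s" using ys(2) by simp
      hence "pr s w = 0" using foldr_gop[of ys] unfolding ys(1) by (intro pr_F) blast+
      thus ?thesis by (intro exI[of _ 0]) simp
    qed
    then obtain b where b: "\<psi> b = pr s w" by blast
    have "\<psi> (fa_scale c b + a) = pr s (fun_scale c w + w')"
      by (simp only: gr.word_act_add gr.word_act_scale a b pr_add pr_scale)
    thus ?case by blast
  qed
  have "\<exists>a. \<psi> a = pr s u" for s
    using pr_range[OF pr_F_mem[of s u]] by (simp add: pr_pr)
  then obtain f where f: "\<And>s. \<psi> (f s) = pr s u" by metis
  have "\<psi> (\<Sum>s\<in>A. f s) = (\<Sum>s\<in>A. pr s u)" for A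
    by (induction A rule: infinite_finite_induct)
      (simp_all add: gr.word_act_add f del: plus_fun_apply zero_fun_apply)
  hence "\<psi> (\<Sum>s\<le>top_degree. f s) = u" using pr_sum[OF assms] by simp
  thus ?thesis by blast
qed

lemma unit_tensors_independent:
  "fun_space.independent {unit_tensor l |l :: 'b list. length l = n}"
  and card_unit_tensors: "card {unit_tensor l |l :: 'b list. length l = n} = card (UNIV :: 'b set) ^ n"
  and finite_unit_tensors: "finite {unit_tensor l |l :: 'b list. length l = n}"
proof -
  let ?L = "{l :: 'b list. length l = n}"
  have U: "{unit_tensor l |l :: 'b list. length l = n} = (\<lambda>l. unit_tensor l) ` ?L" by blast
  have inj: "inj_on (\<lambda>l. unit_tensor l) ?L"
    by (rule inj_onI) (metis unit_tensor_eq zero_neq_one)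
  show fin: "finite {unit_tensor l |l :: 'b list. length l = n}"
    unfolding U by (rule finite_imageI[OF finite_lists_of_length])
  show "card {unit_tensor l |l :: 'b list. length l = n} = card (UNIV :: 'b set) ^ n"
    unfolding U card_image[OF inj] using card_lists_length_eq[of "UNIV :: 'b set" n] by simp
  have "c (unit_tensor l) = 0"
    if c: "(\<Sum>w\<in>(\<lambda>l. unit_tensor l) ` ?L. fun_scale (c w) w) = 0" and l: "l \<in> ?L" for c and l :: "'b list"
  proof -
    have "(\<Sum>k\<in>?L. fun_scale (c (unit_tensor k)) (unit_tensor k)) = 0"
      using c by (subst (asm) sum.reindex[OF inj]) simp
    hence "0 = (\<Sum>k\<in>?L. fun_scale (c (unit_tensor k)) (unit_tensor k)) l" by simp
    also have "\<dots> = (\<Sum>k\<in>?L. if k = l then c (unit_tensor l) else 0)"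
      unfolding sum_fun_apply by (intro sum.cong) (auto simp: fun_scale_def unit_tensor_eq)
    also have "\<dots> = c (unit_tensor l)" using l by (subst sum.delta[OF finite_lists_of_length]) auto
    finally show ?thesis by simp
  qed
  thus "fun_space.independent {unit_tensor l |l :: 'b list. length l = n}"
    using fin unfolding U by (subst fun_space.dependent_finite) blast+
qed

lemma \<psi>_sum: "\<psi> (\<Sum>s\<in>A. fa_scale (c s) s) = (\<Sum>s\<in>A. fun_scale (c s) (\<psi> s))"
  by (induction A rule: infinite_finite_induct)
    (simp_all add: gr.word_act_add gr.word_act_scale del: plus_fun_apply zero_fun_apply)

text \<open>The upper bound for the Weyl module meets the dimension of the tensor product.\<close>

lemma \<psi>_eq_0_iff:
  assumes card3: "card (UNIV :: 'b set) = 3"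
  shows "\<psi> a = 0 \<longleftrightarrow> a \<in> cyclic_ker (weyl_relations n)"
proof
  assume "a \<in> cyclic_ker (weyl_relations n)"
  thus "\<psi> a = 0" by (rule \<psi>_cyclic_ker)
next
  assume a: "\<psi> a = 0"
  let ?K = "cyclic_ker (weyl_relations n)"
  have K: "\<psi> k = 0" if "k \<in> ?K" for k using that by (rule \<psi>_cyclic_ker)
  obtain S where S: "finite S" "card S \<le> 3 ^ n" "\<And>a. \<exists>b\<in>free_alg.span S. a - b \<in> ?K"
    using weyl_module_span by blast
  obtain b where b: "b \<in> free_alg.span S" "a - b \<in> ?K" using S(3) by blast
  have "\<psi> b = 0" using K[OF b(2)] a by (simp add: gr.word_act_diff)
  obtain c where c: "b = (\<Sum>s\<in>S. fa_scale (c s) s)"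
    using b(1) unfolding free_alg.span_finite[OF S(1)] by blast
  have "b = 0"
  proof (rule ccontr)
    assume "b \<noteq> 0"
    have "\<exists>s0\<in>S. c s0 \<noteq> 0"
    proof (rule ccontr)
      assume "\<not> (\<exists>s0\<in>S. c s0 \<noteq> 0)"
      hence "b = 0" unfolding c by (intro sum.neutral ballI) simp
      thus False using \<open>b \<noteq> 0\<close> by contradiction
    qed
    then obtain s0 where s0: "s0 \<in> S" "c s0 \<noteq> 0" by blast
    \<comment> \<open>A nontrivial relation among the images of \<open>S\<close> makes
      \<open>\<psi> s0\<close> redundant, so fewer than \<open>3 ^ n\<close> vectors would span the
      tensor product.\<close>
    let ?V = "fun_space.span (\<psi> ` (S - {s0}))"
    have "fun_scale (c s0) (\<psi> s0) + (\<Sum>s\<in>S - {s0}. fun_scale (c s) (\<psi> s)) = 0"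
      using \<open>\<psi> b = 0\<close> sum.remove[OF S(1) s0(1), of "\<lambda>s. fun_scale (c s) (\<psi> s)"]
      by (simp only: c \<psi>_sum)
    hence "fun_scale (c s0) (\<psi> s0) = - (\<Sum>s\<in>S - {s0}. fun_scale (c s) (\<psi> s))"
      by (simp only: eq_neg_iff_add_eq_0)
    moreover have "- (\<Sum>s\<in>S - {s0}. fun_scale (c s) (\<psi> s)) \<in> ?V"
      by (rule fun_space.span_neg, rule fun_space.span_sum, rule fun_space.span_scale)
        (rule fun_space.span_base, blast)
    ultimately have "fun_scale (inverse (c s0)) (fun_scale (c s0) (\<psi> s0)) \<in> ?V"
      by (simp only: fun_space.span_scale)
    hence "\<psi> s0 \<in> ?V" using s0(2) by simp
    hence V: "\<psi> s \<in> ?V" if "s \<in> S" for s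
      using that by (cases "s = s0") (auto intro: fun_space.span_base)
    have range: "\<psi> d \<in> ?V" for d
    proof -
      obtain e where e: "e \<in> free_alg.span S" "d - e \<in> ?K" using S(3) by blast
      obtain c' where c': "e = (\<Sum>s\<in>S. fa_scale (c' s) s)"
        using e(1) unfolding free_alg.span_finite[OF S(1)] by blast
      have "\<psi> d = \<psi> e" using K[OF e(2)] by (simp add: gr.word_act_diff)
      also have "\<dots> \<in> ?V"
        unfolding c' \<psi>_sum by (intro fun_space.span_sum fun_space.span_scale V)
      finally show ?thesis .
    qed
    have "{unit_tensor l |l :: 'b list. length l = n} \<subseteq> ?V"
    proof
      fix u assume "u \<in> {unit_tensor l |l :: 'b list. length l = n}"
      hence "u \<in> tensor_carrier n" using pure_tensor_carrier by blast
      thus "u \<in> ?V" using \<psi>_surj range by blast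
    qed
    from fun_space.independent_span_bound[OF _ unit_tensors_independent this]
    have "3 ^ n \<le> card (\<psi> ` (S - {s0}))"
      using S(1) by (simp add: card_unit_tensors card3)
    also have "\<dots> \<le> card (S - {s0})" by (rule card_image_le) (use S(1) in simp)
    also have "\<dots> < card S" by (rule card_Diff1_less[OF S(1) s0(1)])
    finally show False using S(2) by simp
  qed
  thus "a \<in> ?K" using b(2) by simp
qed

lemma v0_part: "v0 \<in> tensor_part n (\<lambda>_. par) 0"
  using x_tensor_part[of n "\<lambda>_. 0"] by (simp add: v0_def)

lemma \<psi>_part:
  assumes "a \<in> fa_part p"
  shows "\<psi> a \<in> tensor_part n (\<lambda>_. par) p"
  using assms unfolding fa_part_def
proof (induction rule: free_alg.span_induct_alt)
  case base
  show ?case by (simp only: gr.word_act_zero fun_space.subspace_0 subspace_tensor_part)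
next
  case (step c w a)
  have word: "foldr gop ys v0 \<in> tensor_part n (\<lambda>_. par) (sum_list ps)"
    if "list_all2 (\<lambda>y q. hcomp q y = y) ys ps" for ys ps
    using that
  proof (induction rule: list_all2_induct)
    case Nil
    show ?case by (simp add: v0_part)
  next
    case (Cons y ys q ps)
    thus ?case using gop_part[of q y] by simp
  qed
  obtain ys ps where "w = of_word ys" "list_all2 (\<lambda>y q. hcomp q y = y) ys ps" "sum_list ps = p"
    using step(1) by blast
  hence "\<psi> w \<in> tensor_part n (\<lambda>_. par) p" using word by (auto simp: gr.word_act_of_word)
  thus ?case
    unfolding gr.word_act_add gr.word_act_scale
    by (intro fun_space.subspace_add[OF subspace_tensor_part] step(2)
        fun_space.subspace_scale[OF subspace_tensor_part])
qed

text \<open>A preimage is split modulo the kernel; the image of its component of the wrong parity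
  has both parities and vanishes.\<close>

lemma \<psi>_part_surj:
  assumes u: "u \<in> tensor_part n (\<lambda>_. par) p"
  shows "\<exists>a\<in>fa_part p. \<psi> a = u"
proof -
  let ?P = "tensor_part n (\<lambda>_. par)"
  have "u \<in> tensor_carrier n" using u by (simp add: tensor_part_def)
  then obtain a where a: "\<psi> a = u" using \<psi>_surj by blast
  obtain a0 a1 where d: "a0 \<in> fa_part 0" "a1 \<in> fa_part 1" "a - a0 - a1 \<in> cyclic_ker (weyl_relations n)"
    using fa_homogeneous_decomp[of a] by blast
  have "\<psi> (a - a0 - a1) = 0" by (rule \<psi>_cyclic_ker[OF d(3)])
  hence "u - \<psi> a0 - \<psi> a1 = 0" by (simp only: gr.word_act_diff a)
  hence sum: "\<psi> a0 + \<psi> a1 = u" by (simp add: algebra_simps)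
  note P = \<psi>_part[OF d(1)] \<psi>_part[OF d(2)]
  show ?thesis
  proof (cases p)
    case zero
    have "\<psi> a1 = u - \<psi> a0" using sum by (simp add: algebra_simps)
    hence "\<psi> a1 \<in> ?P 0"
      using u P(1) zero by (simp only: fun_space.subspace_diff subspace_tensor_part)
    hence "\<psi> a1 = 0" using tensor_part_disjoint P(2) by blast
    thus ?thesis using sum d(1) zero by (intro bexI[of _ a0]) simp_all
  next
    case one
    have "\<psi> a0 = u - \<psi> a1" using sum by (simp add: algebra_simps)
    hence "\<psi> a0 \<in> ?P 1"
      using u P(2) one by (simp only: fun_space.subspace_diff subspace_tensor_part)
    hence "\<psi> a0 = 0" using tensor_part_disjoint P(1) by blast
    thus ?thesis using sum d(2) one by (intro bexI[of _ a1]) simp_all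
  qed
qed

end

section \<open>The isomorphisms\<close>

text \<open>The condition of \<open>supermodule_iso\<close> with the map made explicit, for
  composing isomorphisms.\<close>

definition is_supermodule_iso :: "('v \<Rightarrow> 'w) \<Rightarrow> ('g, 'v) supermodule \<Rightarrow> ('g, 'w) supermodule \<Rightarrow> bool" where
  "is_supermodule_iso f M N \<longleftrightarrow>
     bij_betw f (carrier M) (carrier N) \<and>
     (\<forall>v\<in>carrier M. \<forall>w\<in>carrier M. f (v \<oplus>\<^bsub>M\<^esub> w) = f v \<oplus>\<^bsub>N\<^esub> f w) \<and>
     (\<forall>c. \<forall>v\<in>carrier M. f (c \<odot>\<^bsub>M\<^esub> v) = c \<odot>\<^bsub>N\<^esub> f v) \<and>
     (\<forall>p. f ` part M p = part N p) \<and>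
     (\<forall>y. \<forall>v\<in>carrier M. f (act M y v) = act N y (f v))"

lemma supermodule_iso_iff: "supermodule_iso M N \<longleftrightarrow> (\<exists>f. is_supermodule_iso f M N)"
  unfolding supermodule_iso_def is_supermodule_iso_def ..

lemma is_supermodule_isoD:
  assumes "is_supermodule_iso f M N"
  shows "bij_betw f (carrier M) (carrier N)"
    and "v \<in> carrier M \<Longrightarrow> w \<in> carrier M \<Longrightarrow> f (v \<oplus>\<^bsub>M\<^esub> w) = f v \<oplus>\<^bsub>N\<^esub> f w"
    and "v \<in> carrier M \<Longrightarrow> f (c \<odot>\<^bsub>M\<^esub> v) = c \<odot>\<^bsub>N\<^esub> f v"
    and "f ` part M p = part N p"
    and "v \<in> carrier M \<Longrightarrow> f (act M y v) = act N y (f v)"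
  using assms by (simp_all add: is_supermodule_iso_def)

text \<open>Symmetry and transitivity in one step. The closure conditions ensure that inverting the
  first map commutes with the operations of \<open>M\<close>.\<close>

lemma supermodule_iso_common_source:
  assumes MA: "supermodule_iso M A" and MN: "supermodule_iso M N"
    and add: "\<And>v w. v \<in> carrier M \<Longrightarrow> w \<in> carrier M \<Longrightarrow> v \<oplus>\<^bsub>M\<^esub> w \<in> carrier M"
    and smult: "\<And>c v. v \<in> carrier M \<Longrightarrow> c \<odot>\<^bsub>M\<^esub> v \<in> carrier M"
    and act: "\<And>y v. v \<in> carrier M \<Longrightarrow> act M y v \<in> carrier M"
    and part: "\<And>p. part M p \<subseteq> carrier M"
  shows "supermodule_iso A N"
proof -
  obtain f g where fg: "is_supermodule_iso f M A" "is_supermodule_iso g M N"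
    using MA MN unfolding supermodule_iso_iff by blast
  note f = is_supermodule_isoD[OF fg(1)] and g = is_supermodule_isoD[OF fg(2)]
  define h where "h = inv_into (carrier M) f"
  have hf: "h (f v) = v" if "v \<in> carrier M" for v
    unfolding h_def by (rule inv_into_f_f[OF bij_betw_imp_inj_on[OF f(1)] that])
  have h: "bij_betw h (carrier A) (carrier M)" unfolding h_def by (rule bij_betw_inv_into[OF f(1)])
  have pre: "\<exists>u\<in>carrier M. a = f u" if "a \<in> carrier A" for a
    using f(1) that by (auto simp: bij_betw_def)
  show ?thesis
    unfolding supermodule_iso_iff is_supermodule_iso_def
  proof (intro exI[of _ "g \<circ> h"] conjI ballI allI)
    show "bij_betw (g \<circ> h) (carrier A) (carrier N)" by (rule bij_betw_trans[OF h g(1)])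
    show "(g \<circ> h) (v \<oplus>\<^bsub>A\<^esub> w) = (g \<circ> h) v \<oplus>\<^bsub>N\<^esub> (g \<circ> h) w"
      if v: "v \<in> carrier A" and w: "w \<in> carrier A" for v w
    proof -
      obtain v' w' where "v' \<in> carrier M" "v = f v'" "w' \<in> carrier M" "w = f w'"
        using pre[OF v] pre[OF w] by blast
      thus ?thesis by (simp add: hf add g(2) f(2)[symmetric])
    qed
    show "(g \<circ> h) (c \<odot>\<^bsub>A\<^esub> v) = c \<odot>\<^bsub>N\<^esub> (g \<circ> h) v" if v: "v \<in> carrier A" for c v
    proof -
      obtain v' where "v' \<in> carrier M" "v = f v'" using pre[OF v] by blast
      thus ?thesis by (simp add: hf smult g(3) flip: f(3))
    qed
    show "(g \<circ> h) ` part A p = part N p" for p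
    proof -
      have "h ` part A p = part M p"
        unfolding f(4)[symmetric] image_image using part[of p] hf by force
      thus ?thesis by (simp only: image_comp[symmetric] g(4))
    qed
    show "(g \<circ> h) (act A y v) = act N y ((g \<circ> h) v)" if v: "v \<in> carrier A" for y v
    proof -
      obtain v' where "v' \<in> carrier M" "v = f v'" using pre[OF v] by blast
      thus ?thesis by (simp add: hf act g(5) flip: f(5))
    qed
  qed
qed

lemma supermodule_iso_refl: "supermodule_iso M M"
  unfolding supermodule_iso_def by (intro exI[of _ id]) auto

section \<open>Arithmetic of cosets\<close>

lemma coset_eq_iff:
  assumes "fun_space.subspace B"
  shows "x +o B = y +o B \<longleftrightarrow> x - y \<in> B"
proof
  assume "x +o B = y +o B"
  moreover have "x \<in> x +o B" using fun_space.subspace_0[OF assms] by (force simp: elt_set_plus_def)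
  ultimately show "x - y \<in> B" by (auto simp: elt_set_plus_def)
next
  assume d: "x - y \<in> B"
  show "x +o B = y +o B"
  proof (intro equalityI subsetI)
    fix u assume "u \<in> x +o B"
    then obtain b where b: "b \<in> B" "u = y + ((x - y) + b)" by (auto simp: elt_set_plus_def)
    show "u \<in> y +o B" unfolding b(2) by (rule set_plus_intro2[OF fun_space.subspace_add[OF assms d b(1)]])
  next
    fix u assume "u \<in> y +o B"
    then obtain b where b: "b \<in> B" "u = x + (b - (x - y))" by (auto simp: elt_set_plus_def)
    show "u \<in> x +o B" unfolding b(2) by (rule set_plus_intro2[OF fun_space.subspace_diff[OF assms b(1) d]])
  qed
qed

text \<open>The image of a coset under an operator may be smaller than a coset, as under scaling by
  zero; adding \<open>B\<close> completes it.\<close>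

lemma coset_absorb:
  assumes B: "fun_space.subspace B" and X: "X \<noteq> {}" "X \<subseteq> t +o B"
  shows "X + B = t +o B"
proof (intro equalityI subsetI)
  fix u assume "u \<in> X + B"
  then obtain w b where w: "w \<in> X" "b \<in> B" "u = w + b" by (elim set_plus_elim)
  then obtain b' where b': "b' \<in> B" "w = t + b'" using X(2) by (auto simp: elt_set_plus_def)
  show "u \<in> t +o B"
    unfolding w(3) b'(2) add.assoc by (rule set_plus_intro2[OF fun_space.subspace_add[OF B b'(1) w(2)]])
next
  fix u assume "u \<in> t +o B"
  then obtain b where b: "b \<in> B" "u = t + b" by (auto simp: elt_set_plus_def)
  obtain w where w: "w \<in> X" using X(1) by blast
  then obtain b' where b': "b' \<in> B" "w = t + b'" using X(2) by (auto simp: elt_set_plus_def)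
  have "u = w + (b - b')" by (simp add: b b')
  thus "u \<in> X + B" using set_plus_intro[OF w fun_space.subspace_diff[OF B b(1) b'(1)]] by (simp only:)
qed

lemma coset_sum:
  assumes B: "fun_space.subspace B" and "finite A"
    and "\<And>k. k \<in> A \<Longrightarrow> X k \<noteq> {}" "\<And>k. k \<in> A \<Longrightarrow> X k \<subseteq> t k +o B"
  shows "(\<Sum>k\<in>A. X k) \<noteq> {} \<and> (\<Sum>k\<in>A. X k) \<subseteq> (\<Sum>k\<in>A. t k) +o B"
  using assms(2-)
proof (induction A rule: finite_induct)
  case empty
  have "(0 :: 'a \<Rightarrow> complex) \<in> B" by (rule fun_space.subspace_0[OF B])
  hence "(\<Sum>k\<in>{}. X k) \<noteq> {} \<and> (\<Sum>k\<in>{}. X k) \<subseteq> (\<Sum>k\<in>{}. t k) +o B"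
    by (simp add: set_zero elt_set_plus_def)
  thus ?case .
next
  case (insert m A)
  have IH: "(\<Sum>k\<in>A. X k) \<noteq> {}" "(\<Sum>k\<in>A. X k) \<subseteq> (\<Sum>k\<in>A. t k) +o B"
    using insert.IH insert.prems by auto
  have m: "X m \<noteq> {}" "X m \<subseteq> t m +o B" using insert.prems by auto
  have "X m + (\<Sum>k\<in>A. X k) \<subseteq> (t m + (\<Sum>k\<in>A. t k)) +o B"
  proof
    fix u assume "u \<in> X m + (\<Sum>k\<in>A. X k)"
    then obtain a c where ac: "a \<in> X m" "c \<in> (\<Sum>k\<in>A. X k)" "u = a + c" by (elim set_plus_elim)
    have "a \<in> t m +o B" "c \<in> (\<Sum>k\<in>A. t k) +o B" using ac m(2) IH(2) by blast+
    then obtain b b' where b: "b \<in> B" "b' \<in> B" "a = t m + b" "c = (\<Sum>k\<in>A. t k) + b'"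
      unfolding elt_set_plus_def by blast
    have "u = (t m + (\<Sum>k\<in>A. t k)) + (b + b')" unfolding ac(3) b by (simp only: add_ac)
    thus "u \<in> (t m + (\<Sum>k\<in>A. t k)) +o B"
      using set_plus_intro2[OF fun_space.subspace_add[OF B b(1,2)]] by (simp only:)
  qed
  moreover have "X m + (\<Sum>k\<in>A. X k) \<noteq> {}" using m(1) IH(1) set_plus_intro by blast
  ultimately have "(\<Sum>k\<in>insert m A. X k) \<noteq> {} \<and> (\<Sum>k\<in>insert m A. X k) \<subseteq> (\<Sum>k\<in>insert m A. t k) +o B"
    by (simp only: sum.insert[OF insert.hyps] simp_thms)
  thus ?case .
qed

lemma coset_plus:
  assumes "fun_space.subspace B"
  shows "(x +o B) + (y +o B) = (x + y) +o B"
proof -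
  have "(x +o B) + (y +o B) = (x + y) +o (B + B)" by (rule set_plus_rearrange)
  also have "B + B = B"
  proof -
    have "B + B = 0 +o B"
      using fun_space.subspace_0[OF assms] by (intro coset_absorb[OF assms]) auto
    thus ?thesis by simp
  qed
  finally show ?thesis .
qed

section \<open>Weyl module and fusion product as copies of one model\<close>

context osp_fusion
begin

text \<open>The fusion product realised on the tensor product itself; both isomorphisms start
  here.\<close>

definition graded_model :: "(osp12 poly, 'b list \<Rightarrow> complex) supermodule" where
  "graded_model = \<lparr>carrier = tensor_carrier n, mult = undefined, one = undefined, zero = 0,
     add = (+), smult = fun_scale, part = tensor_part n (\<lambda>_. par), act = gop\<rparr>"

text \<open>The inverse of the map that \<open>\<psi>\<close> induces on the Weyl module, whose
  elements are cosets of the kernel.\<close>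

definition fiber :: "('b list \<Rightarrow> complex) \<Rightarrow> osp12 poly free_alg set" where
  "fiber u = {a. \<psi> a = u}"

lemma fiber_props:
  assumes card3: "card (UNIV :: 'b set) = 3"
  shows "bij_betw fiber (tensor_carrier n) (carrier (weyl_module n))"
    and "u \<in> tensor_carrier n \<Longrightarrow> w \<in> tensor_carrier n \<Longrightarrow> fiber (u + w) = fiber u \<oplus>\<^bsub>weyl_module n\<^esub> fiber w"
    and "u \<in> tensor_carrier n \<Longrightarrow> fiber (fun_scale c u) = c \<odot>\<^bsub>weyl_module n\<^esub> fiber u"
    and "fiber ` tensor_part n (\<lambda>_. par) p = part (weyl_module n) p"
    and "u \<in> tensor_carrier n \<Longrightarrow> fiber (gop y u) = supermodule.act (weyl_module n) y (fiber u)"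
proof -
  let ?K = "cyclic_ker (weyl_relations n)"
  note K = \<psi>_eq_0_iff[OF card3]
  have diff: "\<psi> b = \<psi> a \<longleftrightarrow> b - a \<in> ?K" for a b
    using K[of "b - a"] by (simp add: gr.word_act_diff)
  have coset: "fiber (\<psi> a) = a +o ?K" for a
  proof (intro equalityI subsetI)
    fix b assume "b \<in> fiber (\<psi> a)"
    hence "b - a \<in> ?K" "b = a + (b - a)" by (simp_all add: fiber_def diff)
    thus "b \<in> a +o ?K" unfolding elt_set_plus_def by blast
  next
    fix b assume "b \<in> a +o ?K"
    thus "b \<in> fiber (\<psi> a)" by (auto simp: elt_set_plus_def fiber_def diff)
  qed
  show "bij_betw fiber (tensor_carrier n) (carrier (weyl_module n))"
    unfolding bij_betw_def
  proof
    show "inj_on fiber (tensor_carrier n)"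
    proof (rule inj_onI)
      fix u w assume "u \<in> tensor_carrier n" "fiber u = fiber w"
      moreover then obtain a where "\<psi> a = u" using \<psi>_surj by blast
      ultimately show "u = w" by (auto simp: fiber_def)
    qed
    have "fiber ` tensor_carrier n = (\<lambda>a. fiber (\<psi> a)) ` UNIV"
      using \<psi>_surj \<psi>_carrier by (auto simp: image_iff)
    thus "fiber ` tensor_carrier n = carrier (weyl_module n)"
      by (simp add: coset weyl_module_def cyclic_module_def)
  qed
  show "fiber (u + w) = fiber u \<oplus>\<^bsub>weyl_module n\<^esub> fiber w"
    if u: "u \<in> tensor_carrier n" and w: "w \<in> tensor_carrier n"
  proof -
    obtain a where a: "\<psi> a = u" using \<psi>_surj[OF u] by blast
    have "fiber (u + w) = fiber u + fiber w"
    proof (intro equalityI subsetI)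
      fix b assume "b \<in> fiber (u + w)"
      hence "b - a \<in> fiber w" "a \<in> fiber u" using a by (simp_all add: fiber_def gr.word_act_diff)
      from set_plus_intro[OF this(2,1)] show "b \<in> fiber u + fiber w" by simp
    next
      fix b assume "b \<in> fiber u + fiber w"
      thus "b \<in> fiber (u + w)" by (auto simp: fiber_def gr.word_act_add elim!: set_plus_elim)
    qed
    thus ?thesis by (simp add: weyl_module_def cyclic_module_def)
  qed
  \<comment> \<open>Scaling and action in the cyclic module are both an image of a coset plus the
    kernel, so one argument serves for both.\<close>
  have image: "fiber u' = f ` fiber u + ?K"
    if u: "u \<in> tensor_carrier n" and f: "\<And>a. \<psi> a = u \<Longrightarrow> \<psi> (f a) = u'" for u u' f
  proof -
    obtain a where a: "\<psi> a = u" using \<psi>_surj[OF u] by blast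
    show ?thesis
    proof (intro equalityI subsetI)
      fix b assume "b \<in> fiber u'"
      hence "b - f a \<in> ?K" using f[OF a] by (simp add: fiber_def flip: diff)
      moreover have "f a \<in> f ` fiber u" using a by (simp add: fiber_def)
      ultimately show "b \<in> f ` fiber u + ?K" using set_plus_intro[of "f a" _ "b - f a"] by simp
    next
      fix b assume "b \<in> f ` fiber u + ?K"
      then obtain c k where "b = f c + k" "\<psi> c = u" "k \<in> ?K" by (auto simp: fiber_def elim!: set_plus_elim)
      thus "b \<in> fiber u'" using f K by (simp add: fiber_def gr.word_act_add)
    qed
  qed
  show "fiber (fun_scale c u) = c \<odot>\<^bsub>weyl_module n\<^esub> fiber u" if "u \<in> tensor_carrier n"
    using image[OF that, of "fa_scale c" "fun_scale c u"]
    by (simp add: weyl_module_def cyclic_module_def gr.word_act_scale)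
  show "fiber (gop y u) = supermodule.act (weyl_module n) y (fiber u)" if "u \<in> tensor_carrier n"
    using image[OF that, of "(*) (gen y)" "gop y u"]
    by (simp add: weyl_module_def cyclic_module_def gr.word_act_mult gr.word_act_gen)
  have "\<psi> ` fa_part p = tensor_part n (\<lambda>_. par) p"
    using \<psi>_part \<psi>_part_surj by blast
  hence "fiber ` tensor_part n (\<lambda>_. par) p = (\<lambda>a. fiber (\<psi> a)) ` fa_part p"
    by (metis image_image)
  thus "fiber ` tensor_part n (\<lambda>_. par) p = part (weyl_module n) p"
    by (simp add: coset weyl_module_def cyclic_module_def)
qed

lemma graded_model_weyl:
  assumes "card (UNIV :: 'b set) = 3"
  shows "supermodule_iso graded_model (weyl_module n)"
  unfolding supermodule_iso_def
  using fiber_props[OF assms] by (intro exI[of _ fiber]) (simp add: graded_model_def)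

lemma tensor_act_const: "tensor_act n (\<lambda>_. par) (\<lambda>_. \<rho>) y u = act y 0 u"
  by (rule ext) (simp add: T_def tensor_act_def hcomp_monom eval_current_monom scaleC_one)

lemma weyl_tensor_iso:
  assumes "card (UNIV :: 'b set) = 3"
  shows "supermodule_iso (pull_back const_current (weyl_module n)) (tensor_module n (\<lambda>_. par) (\<lambda>_. \<rho>))"
proof (rule supermodule_iso_common_source[OF _ supermodule_iso_refl])
  show "supermodule_iso (tensor_module n (\<lambda>_. par) (\<lambda>_. \<rho>)) (pull_back const_current (weyl_module n))"
    unfolding supermodule_iso_def using fiber_props[OF assms]
    by (intro exI[of _ fiber]) (simp add: tensor_module_def pull_back_def tensor_act_const flip: gop_const)
qed (auto simp: tensor_module_def tensor_act_const T_carrier tensor_part_def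
    intro: fun_space.subspace_add[OF subspace_tensor_carrier] fun_space.subspace_scale[OF subspace_tensor_carrier])

text \<open>The family of classes of the graded components of \<open>u\<close>: the identification
  of the tensor product with the associated graded space.\<close>

definition symbols :: "('b list \<Rightarrow> complex) \<Rightarrow> nat \<Rightarrow> ('b list \<Rightarrow> complex) set" where
  "symbols u = (\<lambda>s. pr s u +o B s)"

text \<open>\<open>W\<close> is the whole space for surjectivity of \<open>symbols\<close>, and a
  parity part for compatibility with parities.\<close>

lemma symbols_lift:
  assumes "\<forall>s. \<exists>w\<in>F s \<inter> W. c s = w +o B s" and W: "\<And>s w. w \<in> W \<Longrightarrow> pr s w \<in> W" "fun_space.subspace W"
  shows "\<exists>u\<in>tensor_carrier n \<inter> W. symbols u = c"
proof -
  obtain w where w: "\<And>s. w s \<in> F s" "\<And>s. w s \<in> W" "\<And>s. c s = w s +o B s"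
    using assms(1) by (metis IntD1 IntD2)
  define u where "u = (\<Sum>s\<le>top_degree. pr s (w s))"
  have u: "u \<in> tensor_carrier n"
    unfolding u_def by (intro fun_space.subspace_sum[OF subspace_tensor_carrier] C_carrier[OF pr_props(1)])
  have "pr s u = pr s (w s)" for s
    by (rule pr_eqI[OF pr_props(1)]) (use restr_id[OF u] u_def in simp)
  moreover have "pr s (w s) +o B s = w s +o B s" for s
    using pr_diff_B[OF w(1)] by (simp add: coset_eq_iff[OF subspace_B, of "w s"] eq_commute[of "_ +o _" "w s +o _"])
  ultimately have "symbols u = c" by (intro ext) (simp add: symbols_def w(3))
  moreover have "u \<in> W" unfolding u_def by (intro fun_space.subspace_sum[OF W(2)] W(1) w(2))
  ultimately show ?thesis using u by blast
qed

lemma symbols_act: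
  "symbols (gop y u) s = (\<Sum>k\<le>s. act (coeff y k) k ` symbols u (s - k)) + B s"
proof -
  let ?t = "\<lambda>k. act (coeff y k) k (pr (s - k) u)"
  have F: "?t k \<in> F s" if "k \<le> s" for k
    using act_F[OF pr_F_mem[of "s - k" u], of "coeff y k" k] that by simp
  have "act (coeff y k) k ` symbols u (s - k) \<noteq> {} \<and>
      act (coeff y k) k ` symbols u (s - k) \<subseteq> ?t k +o B s" if "k \<le> s" for k
  proof
    have "pr (s - k) u + 0 \<in> symbols u (s - k)"
      unfolding symbols_def by (rule set_plus_intro2[OF fun_space.subspace_0[OF subspace_B]])
    thus "act (coeff y k) k ` symbols u (s - k) \<noteq> {}" by blast
    show "act (coeff y k) k ` symbols u (s - k) \<subseteq> ?t k +o B s"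
    proof
      fix w assume "w \<in> act (coeff y k) k ` symbols u (s - k)"
      then obtain b where b: "b \<in> B (s - k)" "w = act (coeff y k) k (pr (s - k) u + b)"
        by (auto simp: symbols_def elt_set_plus_def)
      have "act (coeff y k) k b \<in> B s" using act_B[OF b(1), of "coeff y k" k] that by simp
      thus "w \<in> ?t k +o B s" unfolding b(2) T_add_right elt_set_plus_def by blast
    qed
  qed
  hence "(\<Sum>k\<le>s. act (coeff y k) k ` symbols u (s - k)) \<noteq> {} \<and>
      (\<Sum>k\<le>s. act (coeff y k) k ` symbols u (s - k)) \<subseteq> (\<Sum>k\<le>s. ?t k) +o B s"
    by (intro coset_sum[OF subspace_B]) auto
  hence "(\<Sum>k\<le>s. act (coeff y k) k ` symbols u (s - k)) + B s = (\<Sum>k\<le>s. ?t k) +o B s"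
    by (intro coset_absorb[OF subspace_B]) auto
  also have "\<dots> = pr s (\<Sum>k\<le>s. ?t k) +o B s"
    unfolding coset_eq_iff[OF subspace_B]
    by (rule pr_diff_B, rule fun_space.subspace_sum[OF subspace_F]) (use F in simp)
  also have "pr s (\<Sum>k\<le>s. ?t k) = pr s (gop y u)" by (simp only: pr_gop pr_sum_right)
  finally show ?thesis by (simp add: symbols_def)
qed

lemma symbols_carrier: "u \<in> tensor_carrier n \<Longrightarrow> finite {s. symbols u s \<noteq> B s}"
proof (rule finite_subset[of _ "{..top_degree}"], rule subsetI)
  fix s assume "s \<in> {s. symbols u s \<noteq> B s}"
  hence "pr s u \<noteq> 0" by (auto simp: symbols_def)
  thus "s \<in> {..top_degree}" using C_above_top[OF _ pr_props(1), of s u] by (meson atMost_iff not_le)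
qed simp

lemma symbols_eqD:
  assumes "u \<in> tensor_carrier n" "w \<in> tensor_carrier n" "symbols u = symbols w"
  shows "u = w"
proof (rule eq_prI[OF assms(1,2)])
  fix s
  have "pr s u +o B s = pr s w +o B s" using fun_cong[OF assms(3), of s] by (simp add: symbols_def)
  hence "pr s u - pr s w \<in> B s" by (simp only: coset_eq_iff[OF subspace_B])
  moreover have "pr s u - pr s w \<in> C s" by (intro fun_space.subspace_diff[OF C_props(1)] pr_props)
  ultimately have "pr s u - pr s w = 0" using C_props(4)[of s] by blast
  thus "pr s u = pr s w" by simp
qed

lemma symbols_add: "symbols (u + w) s = symbols u s + symbols w s"
  by (simp add: symbols_def pr_add coset_plus[OF subspace_B])

lemma symbols_scale: "symbols (fun_scale c u) s = fun_scale c ` symbols u s + B s"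
proof -
  have "fun_scale c ` (pr s u +o B s) + B s = fun_scale c (pr s u) +o B s"
  proof (rule coset_absorb[OF subspace_B])
    have "pr s u + 0 \<in> pr s u +o B s"
      by (rule set_plus_intro2[OF fun_space.subspace_0[OF subspace_B]])
    thus "fun_scale c ` (pr s u +o B s) \<noteq> {}" by blast
    show "fun_scale c ` (pr s u +o B s) \<subseteq> fun_scale c (pr s u) +o B s"
    proof
      fix w assume "w \<in> fun_scale c ` (pr s u +o B s)"
      then obtain b where b: "b \<in> B s" "w = fun_scale c (pr s u + b)" by (auto simp: elt_set_plus_def)
      thus "w \<in> fun_scale c (pr s u) +o B s"
        using fun_space.subspace_scale[OF subspace_B b(1), of c]
        unfolding b(2) fun_space.scale_right_distrib elt_set_plus_def by blast
    qed
  qed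
  thus ?thesis by (simp add: symbols_def pr_scale)
qed

lemma graded_model_fusion:
  "supermodule_iso graded_model (graded_tensor_product n (\<lambda>_. par) (\<lambda>_. \<rho>) (\<lambda>_. x 0) z)"
proof -
  define CG where "CG = {c. (\<forall>s. \<exists>w\<in>F s. c s = w +o B s) \<and> finite {s. c s \<noteq> B s}}"
  have gr: "graded_tensor_product n (\<lambda>_. par) (\<lambda>_. \<rho>) (\<lambda>_. x 0) z = \<lparr>carrier = CG,
    mult = undefined, one = undefined, zero = B, add = (\<lambda>c d s. c s + d s),
    smult = (\<lambda>a c s. fun_scale a ` c s + B s),
    part = (\<lambda>p. {c \<in> CG. \<forall>s. \<exists>w\<in>F s \<inter> tensor_part n (\<lambda>_. par) p. c s = w +o B s}),
    act = (\<lambda>y c s. (\<Sum>k\<le>s. act (coeff y k) k ` c (s - k)) + B s)\<rparr>"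
  proof -
    have v: "pure_tensor n (\<lambda>_. x 0) = v0" by (simp add: v0_def x_tensor_def)
    show ?thesis
      unfolding graded_tensor_product_def assoc_graded_def v F_def[symmetric] Let_def
      unfolding B_def[symmetric] CG_def
      by (simp add: tensor_module_def T_def)
  qed
  have CG: "symbols u \<in> CG" if "u \<in> tensor_carrier n" for u
    using symbols_carrier[OF that] pr_F_mem by (auto simp: CG_def symbols_def)
  have "bij_betw symbols (tensor_carrier n) CG"
    unfolding bij_betw_def
  proof
    show "inj_on symbols (tensor_carrier n)" by (rule inj_onI) (rule symbols_eqD)
    show "symbols ` tensor_carrier n = CG"
    proof (intro equalityI subsetI)
      fix c assume "c \<in> CG"
      hence "\<forall>s. \<exists>w\<in>F s \<inter> UNIV. c s = w +o B s" by (simp add: CG_def)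
      from symbols_lift[OF this] show "c \<in> symbols ` tensor_carrier n" by auto
    qed (use CG in blast)
  qed
  moreover have "symbols ` tensor_part n (\<lambda>_. par) p =
      {c \<in> CG. \<forall>s. \<exists>w\<in>F s \<inter> tensor_part n (\<lambda>_. par) p. c s = w +o B s}" for p
  proof (intro equalityI subsetI)
    fix c assume "c \<in> symbols ` tensor_part n (\<lambda>_. par) p"
    then obtain u where u: "u \<in> tensor_part n (\<lambda>_. par) p" "c = symbols u" by blast
    have "pr s u \<in> F s \<inter> tensor_part n (\<lambda>_. par) p" for s using pr_F_mem pr_part[OF u(1)] by blast
    moreover have "u \<in> tensor_carrier n" using u(1) by (simp add: tensor_part_def)
    ultimately show "c \<in> {c \<in> CG. \<forall>s. \<exists>w\<in>F s \<inter> tensor_part n (\<lambda>_. par) p. c s = w +o B s}"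
      using CG u(2) by (auto simp: symbols_def)
  next
    fix c assume "c \<in> {c \<in> CG. \<forall>s. \<exists>w\<in>F s \<inter> tensor_part n (\<lambda>_. par) p. c s = w +o B s}"
    hence "\<forall>s. \<exists>w\<in>F s \<inter> tensor_part n (\<lambda>_. par) p. c s = w +o B s" by simp
    from symbols_lift[OF this pr_part subspace_tensor_part]
    show "c \<in> symbols ` tensor_part n (\<lambda>_. par) p" by blast
  qed
  ultimately show ?thesis
    unfolding supermodule_iso_def gr
    by (intro exI[of _ symbols])
      (simp add: graded_model_def fun_eq_iff[where ?'a = nat] symbols_add symbols_scale symbols_act)
qed

lemma fusion_weyl_iso:
  assumes "card (UNIV :: 'b set) = 3"
  shows "supermodule_iso (graded_tensor_product n (\<lambda>_. par) (\<lambda>_. \<rho>) (\<lambda>_. x 0) z) (weyl_module n)"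
  by (rule supermodule_iso_common_source[OF graded_model_fusion graded_model_weyl[OF assms]])
    (auto simp: graded_model_def gop_carrier tensor_part_def
      intro: fun_space.subspace_add[OF subspace_tensor_carrier] fun_space.subspace_scale[OF subspace_tensor_carrier])

end

theorem theorem0p1:
  fixes n :: nat
    and par :: "'b::finite \<Rightarrow> bit"
    and \<rho> :: "osp12 \<Rightarrow> ('b \<Rightarrow> complex) \<Rightarrow> ('b \<Rightarrow> complex)"
    and v :: "'b \<Rightarrow> complex"
  assumes "n \<ge> 1"
    and "card (UNIV :: 'b set) = 3"
    and "irreducible_supermodule (coord_module par \<rho>)"
    and "even_lowest_weight_vector (coord_module par \<rho>) (-1) v"
  shows "supermodule_iso (pull_back const_current (weyl_module n))
           (tensor_module n (\<lambda>_. par) (\<lambda>_. \<rho>)) \<and>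
         (\<forall>z :: nat \<Rightarrow> complex. inj_on z {..<n} \<longrightarrow>
            supermodule_iso (graded_tensor_product n (\<lambda>_. par) (\<lambda>_. \<rho>) (\<lambda>_. v) z) (weyl_module n))"
proof (intro conjI allI impI)
  interpret osp_fundamental \<rho> par "\<lambda>k. (\<rho> osp_gp ^^ k) v"
    by (rule three_dim_fundamental[OF assms(3,4)])
  have fusion: "osp_fusion \<rho> par (\<lambda>k. (\<rho> osp_gp ^^ k) v) n z" if "inj_on z {..<n}" for z
    using that by unfold_locales
  \<comment> \<open>The first claim mentions no points, but the argument needs distinct ones; the
    natural numbers \<open>0, ..., n-1\<close> serve as \<open>z\<close>.\<close>
  show "supermodule_iso (pull_back const_current (weyl_module n)) (tensor_module n (\<lambda>_. par) (\<lambda>_. \<rho>))"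
    by (rule osp_fusion.weyl_tensor_iso[OF fusion assms(2)]) (rule inj_on_of_nat)
  show "supermodule_iso (graded_tensor_product n (\<lambda>_. par) (\<lambda>_. \<rho>) (\<lambda>_. v) z) (weyl_module n)"
    if "inj_on z {..<n}" for z
    using osp_fusion.fusion_weyl_iso[OF fusion[OF that] assms(2)] by simp
qed

end
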